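(* Let $\mathcal{F}=\{f_0,\ldots,f_{N-1}\}$ be a finite family of homeomorphisms of the circle $(\mathbb{S}^1,d)$ such that $\mathcal{F}$ is proximal on $(\mathbb{S}^1,d)$ and there is no Borel probability measure $m$ on $\mathbb{S}^1$ satisfying $f_*m=m$ for every $f\in\mathcal{F}$. Let $\mu$ be any non-degenerate probability measure on $\mathcal{I}=\{0,\ldots,N-1\}$ (that is, $\mu(\{i\})>0$ for every $i\in\mathcal{I}$), and let $\nu$ be the unique $\mu$-stationary probability measure. Then for every Hölder continuous function $h\colon\mathbb{S}^1\to\mathbb{R}$, writing $\nu(h)=\int h\,d\nu$, the limit $$\sigma^2(h)=\lim_{n\to\infty}\frac1n\int_{\mathcal{I}^{\mathbb{N}}\times \mathbb{S}^1}\Big(\sum_{k=0}^{n-1}h(X_k^x(\mathbf{i}))-n\nu(h)\Big)^2\,d(\mu^{\mathbb{N}}\otimes\nu)(\mathbf{i},x)$$ exists and is finite, and: 1. (strong law of large numbers) for every $x\in \mathbb{S}^1$, $\lim_{n\to\infty}\frac1n\sum_{k=0}^{n-1}h(X_k^x)=\nu(h)$ $\mu^{\mathbb{N}}$-almost surely; 2. (central limit theorem) for every $x\in \mathbb{S}^1$, $\frac{1}{\sqrt n}\Big(\sum_{k=0}^{n-1}h(X_k^x)-n\nu(h)\Big)$ converges in distribution (under $\mu^{\mathbb{N}}$) to the normal law $\mathcal{N}(0,\sigma^2(h))$ as $n\to\infty$ (the Dirac measure at $0$ if $\sigma^2(h)=0$); 3. (law of the iterated logarithm) for every $x\in \mathbb{S}^1$,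 $\limsup_{n\to\infty}\frac{1}{\sqrt{2n\log\log n}}\Big(\sum_{k=0}^{n-1}h(X_k^x)-n\nu(h)\Big)=\sqrt{\sigma^2(h)}$ $\mu^{\mathbb{N}}$-almost surely.
   Context: $\mathbb{S}^1=[0,1)$ (i.e. $\mathbb{R}/\mathbb{Z}$) with $d(x,y)=\min\{|x-y|,1-|x-y|\}$. $\mu^{\mathbb{N}}$ is the product (Bernoulli) measure on $\mathcal{I}^{\mathbb{N}}$. For $\mathbf{i}=(i_1,i_2,\ldots)\in\mathcal{I}^{\mathbb{N}}$ and $n\in\mathbb{N}$ put $f_{\mathbf{i}}^n=f_{i_n}\circ\cdots\circ f_{i_1}$, $X_n^x(\mathbf{i})=f_{\mathbf{i}}^n(x)$, $X_0^x(\mathbf{i})=x$; for each $x$, $X_n^x$ is regarded as a random variable on $(\mathcal{I}^{\mathbb{N}},\mu^{\mathbb{N}})$. Proximal: for every $x,y\in \mathbb{S}^1$ there exist $\mathbf{i}\in\mathcal{I}^{\mathbb{N}}$ and a (strictly increasing) sequence $(n_k)_{k}$ with $\lim_{k\to\infty}d(f_{\mathbf{i}}^{n_k}(x),f_{\mathbf{i}}^{n_k}(y))=0$. A Borel probability measure $\nu$ on $\mathbb{S}^1$ is $\mu$-stationary if $\nu=\sum_{i\in\mathcal{I}}\mu(\{i\})\,(f_i)_*\nu$, where $(f_i)_*\nu=\nu\circ f_i^{-1}$. Under the hypotheses of the claim the $\mu$-stationary probability measure is unique. *)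

theory Defs
  imports "HOL-Probability.Probability"
begin

section \<open>The circle\<close>

typedef circle = "{0..<1::real}"
  morphisms circle_coord Circle
  by (rule exI[of _ 0]) simp

lemma circle_coord_bounds: "0 \<le> circle_coord x" "circle_coord x < 1"
  using circle_coord[of x] by auto

text \<open>
  The metric below wraps around at \<open>1\<close>, so the topology is that of \<open>\<real>/\<int>\<close> and not the
  subspace topology of \<open>[0, 1)\<close>.
\<close>

instantiation circle :: metric_space
begin

definition dist_circle :: "circle \<Rightarrow> circle \<Rightarrow> real" where
  "dist_circle x y =
     min \<bar>circle_coord x - circle_coord y\<bar> (1 - \<bar>circle_coord x - circle_coord y\<bar>)"

definition uniformity_circle :: "(circle \<times> circle) filter" where
  "uniformity_circle = (INF e\<in>{0<..}. principal {(x, y). dist x y < e})"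

definition open_circle :: "circle set \<Rightarrow> bool" where
  "open_circle U \<longleftrightarrow> (\<forall>x\<in>U. eventually (\<lambda>(x', y). x' = x \<longrightarrow> y \<in> U) uniformity)"

instance
proof
  fix x y z :: circle
  show "dist x y = 0 \<longleftrightarrow> x = y"
    using circle_coord_bounds[of x] circle_coord_bounds[of y] circle_coord_inject[of x y]
    unfolding dist_circle_def by (auto simp: min_def abs_if split: if_splits)
  show "dist x y \<le> dist x z + dist y z"
    using circle_coord_bounds[of x] circle_coord_bounds[of y] circle_coord_bounds[of z]
    unfolding dist_circle_def min_def abs_if by (auto split: if_splits)
qed (simp_all add: uniformity_circle_def open_circle_def)

end

text \<open>Exponents are restricted to \<open>(0, 1]\<close>; \<open>1\<close> is the Lipschitz case.\<close>

definition hoelder_continuous :: "(circle \<Rightarrow> real) \<Rightarrow> bool" where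
  "hoelder_continuous h \<longleftrightarrow>
     (\<exists>\<alpha> C. 0 < \<alpha> \<and> \<alpha> \<le> 1 \<and> 0 \<le> C \<and> (\<forall>x y. \<bar>h x - h y\<bar> \<le> C * dist x y powr \<alpha>))"

section \<open>Random iteration of a finite family of circle maps\<close>

text \<open>
  Sequences in the index set are indexed from \<open>0\<close>: \<open>\<omega> k\<close> is the \<open>(k+1)\<close>-st symbol
  \<open>i\<^sub>k\<^sub>+\<^sub>1\<close>, so that \<open>orbit f \<omega> n x\<close> is the image of \<open>x\<close> under
  \<open>f (\<omega> (n - 1)) \<circ> \<dots> \<circ> f (\<omega> 0)\<close>.
\<close>

primrec orbit :: "(nat \<Rightarrow> circle \<Rightarrow> circle) \<Rightarrow> (nat \<Rightarrow> nat) \<Rightarrow> nat \<Rightarrow> circle \<Rightarrow> circle" where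
  "orbit f \<omega> 0 x = x"
| "orbit f \<omega> (Suc n) x = f (\<omega> n) (orbit f \<omega> n x)"

definition proximal :: "nat \<Rightarrow> (nat \<Rightarrow> circle \<Rightarrow> circle) \<Rightarrow> bool" where
  "proximal N f \<longleftrightarrow>
     (\<forall>x y. \<exists>\<omega> r. (\<forall>k. \<omega> k < N) \<and> strict_mono r \<and>
        (\<lambda>k. dist (orbit f \<omega> (r k) x) (orbit f \<omega> (r k) y)) \<longlonglongrightarrow> 0)"

definition borel_prob :: "circle measure \<Rightarrow> bool" where
  "borel_prob m \<longleftrightarrow> prob_space m \<and> sets m = sets borel"

definition common_invariant :: "nat \<Rightarrow> (nat \<Rightarrow> circle \<Rightarrow> circle) \<Rightarrow> circle measure \<Rightarrow> bool" where
  "common_invariant N f m \<longleftrightarrow> borel_prob m \<and> (\<forall>i<N. distr m borel (f i) = m)"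

text \<open>Having all subsets of \<open>{..<N}\<close> as its \<open>\<sigma>\<close>-algebra forces the space of \<open>\<mu>\<close> to be \<open>{..<N}\<close>.\<close>

definition nondegenerate_prob :: "nat \<Rightarrow> nat measure \<Rightarrow> bool" where
  "nondegenerate_prob N \<mu> \<longleftrightarrow>
     prob_space \<mu> \<and> sets \<mu> = Pow {..<N} \<and> (\<forall>i<N. measure \<mu> {i} > 0)"

definition stationary ::
    "nat \<Rightarrow> (nat \<Rightarrow> circle \<Rightarrow> circle) \<Rightarrow> nat measure \<Rightarrow> circle measure \<Rightarrow> bool" where
  "stationary N f \<mu> \<nu> \<longleftrightarrow> borel_prob \<nu> \<and>
     (\<forall>A\<in>sets borel. measure \<nu> A = (\<Sum>i<N. measure \<mu> {i} * measure (distr \<nu> borel (f i)) A))"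

abbreviation bernoulli :: "nat measure \<Rightarrow> (nat \<Rightarrow> nat) measure" where
  "bernoulli \<mu> \<equiv> PiM UNIV (\<lambda>_. \<mu>)"

definition centered_sum ::
    "(nat \<Rightarrow> circle \<Rightarrow> circle) \<Rightarrow> circle measure \<Rightarrow> (circle \<Rightarrow> real) \<Rightarrow> nat \<Rightarrow> circle \<Rightarrow>
     (nat \<Rightarrow> nat) \<Rightarrow> real" where
  "centered_sum f \<nu> h n x \<omega> =
     (\<Sum>k<n. h (orbit f \<omega> k x)) - real n * integral\<^sup>L \<nu> h"

text \<open>The parameter is the variance; \<open>normal_density\<close> takes the standard deviation.\<close>

definition normal_law :: "real \<Rightarrow> real measure" where
  "normal_law v =
     (if v = 0 then return borel 0 else density lborel (\<lambda>t. ennreal (normal_density 0 (sqrt v) t)))"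

end

theory Submission
  imports Defs "HOL-Real_Asymp.Real_Asymp"
begin

text \<open>
  If the absence of an invariant measure is tested on normalised counting measures, strict convexity of
  the square norm shows that the lazy averaging operator is a strict contraction in mean square on
  values of small disjoint arcs. Hence a small arc is unlikely to avoid growing, and proximality turns
  this into a function \<open>E\<close> on pairs that dominates \<open>dist x y powr \<alpha>\<close> and is contracted
  exponentially on average. Functions that are Lipschitz with respect to \<open>E\<close> then admit a continuous
  solution \<open>u\<close> of the Poisson equation, so centred sums differ from a martingale with bounded
  increments by a bounded term. All limit theorems are proved for this martingale, with variance the
  \<open>\<nu>\<close>-integral of the conditional variance of one increment, which again solves a Poisson equation.
\<close>

section \<open>The circle as a quotient of the line\<close>

text \<open>The maps are mere homeomorphisms, so no derivative and no local contraction rate is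
  available: both hypotheses are qualitative, while the limit theorems need an exponential rate. It
  comes from functions on small sets whose squares sum to at most 1 over disjoint sets. The model is
  the square root of arc length, hence the initial value of \<open>killed\<close>. Laziness matters:
  if the averaged function nearly attains square norm 1, convexity forces it to be nearly equal on a
  set and on its image under each \<open>f i\<close> separately. The squared weights then nearly
  form a measure invariant under every map, not merely a stationary one; as the diameters tend to 0,
  it is immaterial at which point of a set its weight is placed. For the Poisson equation laziness
  is harmless, since identity minus the lazy operator is half of identity minus \<open>P\<close>.
  The limit theorems rest on first-step recursions with bounds uniform in the starting point. By
  this uniformity the central limit theorem holds along moving starting points; with the Markov
  property this gives the lower half of the law of the iterated logarithm.\<close>

definition wrap :: "real \<Rightarrow> circle" where
  "wrap t = Circle (frac t)"

lemma circle_coord_wrap: "circle_coord (wrap t) = frac t"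
  unfolding wrap_def by (subst Circle_inverse) (auto simp: frac_lt_1)

lemma wrap_circle_coord [simp]: "wrap (circle_coord x) = x"
  using circle_coord_bounds[of x] unfolding wrap_def
  by (simp add: frac_eq[THEN iffD2] circle_coord_inverse)

text \<open>The circle distance is the distance to the nearest lift. From this Lipschitz bound come
  the continuity and measurability of \<open>wrap\<close>, and the compactness of the circle as the
  image of \<open>{0..1}\<close>.\<close>

lemma dist_wrap_le: "dist (wrap s) (wrap t) \<le> \<bar>s - t\<bar>"
proof -
  define a where "a = frac s - frac t"
  define m where "m = \<lfloor>s\<rfloor> - \<lfloor>t\<rfloor>"
  have st: "s - t = a + of_int m"
    unfolding a_def m_def frac_def by simp
  have a: "\<bar>a\<bar> < 1"
    unfolding a_def using frac_ge_0[of s] frac_lt_1[of s] frac_ge_0[of t] frac_lt_1[of t] by linarith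
  have "min \<bar>a\<bar> (1 - \<bar>a\<bar>) \<le> \<bar>a + of_int m\<bar>"
  proof (cases "m = 0")
    case False
    then have "1 \<le> \<bar>m\<bar>" by simp
    then have "1 \<le> \<bar>of_int m :: real\<bar>"
      by (metis of_int_1_le_iff of_int_abs)
    then show ?thesis by linarith
  qed simp
  then show ?thesis
    by (simp add: dist_circle_def circle_coord_wrap st flip: a_def)
qed

lemma continuous_on_wrap: "continuous_on A wrap"
  unfolding continuous_on_iff
proof (intro ballI allI impI)
  fix x e :: real assume "0 < e"
  then show "\<exists>d>0. \<forall>x'\<in>A. dist x' x < d \<longrightarrow> dist (wrap x') (wrap x) < e"
    by (intro exI[of _ e]) (auto simp: dist_real_def intro: le_less_trans[OF dist_wrap_le])
qed

lemma wrap_measurable [measurable]: "wrap \<in> borel_measurable borel"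
  by (intro borel_measurable_continuous_onI continuous_on_wrap)

lemma range_wrap_Icc: "wrap ` {0..1} = UNIV"
proof -
  have "x \<in> wrap ` {0..1}" for x
    by (rule image_eqI[of _ _ "circle_coord x"]) (use circle_coord_bounds[of x] in auto)
  then show ?thesis by auto
qed

lemma compact_UNIV_circle: "compact (UNIV :: circle set)"
  by (metis range_wrap_Icc compact_Icc compact_continuous_image continuous_on_wrap)

lemma dist_circle_le_1: "dist (x :: circle) y \<le> 1"
  using circle_coord_bounds[of x] circle_coord_bounds[of y] unfolding dist_circle_def by linarith

text \<open>The shorter of the two arcs between the points, as the image of a real interval of
  length \<open>dist x y\<close>. Such arcs later turn a function of sets into a function of
  pairs.\<close>

lemma exists_arc:
  fixes x y :: circle
  shows "\<exists>J. compact J \<and> connected J \<and> x \<in> J \<and> y \<in> J \<and> (\<forall>z\<in>J. \<forall>w\<in>J. dist z w \<le> dist x y)"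
proof -
  have *: "\<exists>J. compact J \<and> connected J \<and> x \<in> J \<and> y \<in> J \<and> (\<forall>z\<in>J. \<forall>w\<in>J. dist z w \<le> dist x y)"
    if "a \<le> b" "b - a = dist x y" "x = wrap a \<and> y = wrap b \<or> x = wrap b \<and> y = wrap a" for a b
  proof (intro exI conjI)
    show "compact (wrap ` {a..b})" "connected (wrap ` {a..b})"
      by (auto intro!: compact_continuous_image connected_continuous_image continuous_on_wrap)
    show "x \<in> wrap ` {a..b}" "y \<in> wrap ` {a..b}" using that by auto
    show "\<forall>z\<in>wrap ` {a..b}. \<forall>w\<in>wrap ` {a..b}. dist z w \<le> dist x y"
    proof clarsimp
      fix s t assume "a \<le> s" "s \<le> b" "a \<le> t" "t \<le> b"
      then show "dist (wrap s) (wrap t) \<le> dist x y"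
        using dist_wrap_le[of s t] that(2) by linarith
    qed
  qed
  have w: "wrap (circle_coord z + 1) = z" for z
    by (metis wrap_def frac_1_eq wrap_circle_coord)
  let ?a = "circle_coord x" and ?b = "circle_coord y"
  note bds = circle_coord_bounds[of x] circle_coord_bounds[of y]
  show ?thesis
  proof (cases "\<bar>?a - ?b\<bar> \<le> 1 - \<bar>?a - ?b\<bar>")
    case True
    then have d: "dist x y = \<bar>?a - ?b\<bar>" by (simp add: dist_circle_def)
    show ?thesis
      by (cases "?a \<le> ?b"; rule *[of "min ?a ?b" "max ?a ?b"]) (auto simp: d)
  next
    case False
    then have d: "dist x y = 1 - \<bar>?a - ?b\<bar>" by (simp add: dist_circle_def)
    \<comment> \<open>The shorter arc passes through 0 here, so the smaller coordinate is lifted by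
      1.\<close>
    show ?thesis
      by (cases "?a \<le> ?b"; rule *[of "max ?a ?b" "min ?a ?b + 1"]) (use bds in \<open>auto simp: d w\<close>)
  qed
qed

lemma open_coord_between:
  assumes "0 \<le> p" "r \<le> 1"
  shows "open {z. p < circle_coord z \<and> circle_coord z < r}"
  unfolding open_dist
proof clarsimp
  fix z assume z: "p < circle_coord z" "circle_coord z < r"
  show "\<exists>e>0. \<forall>w. dist w z < e \<longrightarrow> p < circle_coord w \<and> circle_coord w < r"
  proof (intro exI[of _ "min (circle_coord z - p) (r - circle_coord z)"] conjI allI impI)
    fix w assume "dist w z < min (circle_coord z - p) (r - circle_coord z)"
    then show "p < circle_coord w" "circle_coord w < r"
      using assms circle_coord_bounds[of z] circle_coord_bounds[of w]
      unfolding dist_circle_def by (auto simp: min_def abs_if split: if_splits)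
  qed (use z in auto)
qed

text \<open>This arc contains the point 0, where the coordinate jumps. A neighbourhood must
  therefore also stay away from the far endpoint, at a distance measured through 0; hence the second
  term of each minimum.\<close>

lemma open_coord_outside:
  assumes "0 \<le> p" "p \<le> r" "r < 1"
  shows "open {z. circle_coord z < p \<or> r < circle_coord z}"
  unfolding open_dist
proof (intro ballI)
  fix z assume "z \<in> {z. circle_coord z < p \<or> r < circle_coord z}"
  then consider "circle_coord z < p" | "r < circle_coord z" by blast
  then show "\<exists>e>0. \<forall>w. dist w z < e \<longrightarrow> w \<in> {z. circle_coord z < p \<or> r < circle_coord z}"
  proof cases
    case 1
    show ?thesis
    proof (intro exI[of _ "min (p - circle_coord z) (1 - r + circle_coord z)"] conjI allI impI)
      show "0 < min (p - circle_coord z) (1 - r + circle_coord z)"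
        using 1 assms circle_coord_bounds[of z] by auto
      fix w assume "dist w z < min (p - circle_coord z) (1 - r + circle_coord z)"
      then show "w \<in> {z. circle_coord z < p \<or> r < circle_coord z}"
        using 1 assms circle_coord_bounds[of z] circle_coord_bounds[of w]
        unfolding dist_circle_def by (auto simp: min_def abs_if split: if_splits)
    qed
  next
    case 2
    show ?thesis
    proof (intro exI[of _ "min (circle_coord z - r) (1 - circle_coord z + p)"] conjI allI impI)
      fix w assume "dist w z < min (circle_coord z - r) (1 - circle_coord z + p)"
      then show "w \<in> {z. circle_coord z < p \<or> r < circle_coord z}"
        using 2 assms circle_coord_bounds[of z] circle_coord_bounds[of w]
        unfolding dist_circle_def by (auto simp: min_def abs_if split: if_splits)
    qed (use 2 assms circle_coord_bounds[of z] in auto)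
  qed
qed

text \<open>Removing \<open>wrap p\<close> and \<open>wrap r\<close> leaves two disjoint open arcs,
  and a connected set lies in one of them.\<close>

lemma connected_avoiding_two:
  assumes J: "connected J" and pr: "0 \<le> p" "p < r" "r < 1" and "wrap p \<notin> J" "wrap r \<notin> J"
    and x: "x \<in> J" "p < circle_coord x" "circle_coord x < r"
    and y: "y \<in> J"
  shows "p < circle_coord y \<and> circle_coord y < r"
proof (rule ccontr)
  assume ny: "\<not> ?thesis"
  let ?U = "{z. p < circle_coord z \<and> circle_coord z < r}"
  let ?V = "{z. circle_coord z < p \<or> r < circle_coord z}"
  have ne: "circle_coord z \<noteq> p" "circle_coord z \<noteq> r" if "z \<in> J" for z
    using assms(5,6) that by (metis wrap_circle_coord)+
  have "open ?U" "open ?V"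
    using pr by (auto intro: open_coord_between open_coord_outside)
  moreover have "?U \<inter> J \<noteq> {}" "?V \<inter> J \<noteq> {}"
    using x y ny ne[OF y] by force+
  moreover have "?U \<inter> ?V \<inter> J = {}" using pr by auto
  moreover have "J \<subseteq> ?U \<union> ?V" using ne by force
  ultimately show False using J unfolding connected_def by blast
qed

section \<open>Normalised arc length compared with distance\<close>

definition arclen :: "circle measure" where
  "arclen = distr (uniform_measure lborel {0..<1}) borel wrap"

lemma prob_space_arclen: "prob_space arclen"
  unfolding arclen_def by (intro prob_space.prob_space_distr prob_space_uniform_measure) auto

lemma sets_arclen [simp, measurable_cong]: "sets arclen = sets borel"
  by (simp add: arclen_def)

lemma measure_arclen:
  assumes [measurable]: "A \<in> sets borel"
  shows "measure arclen A = measure lborel {t\<in>{0..<1}. wrap t \<in> A}"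
proof -
  have "measure arclen A = measure (uniform_measure lborel {0..<1}) (wrap -` A)"
    unfolding arclen_def by (subst measure_distr) auto
  also have "\<dots> = measure lborel ({0..<1} \<inter> wrap -` A)"
    using measurable_sets[OF wrap_measurable assms] by (subst measure_uniform_measure) auto
  also have "{0..<1} \<inter> wrap -` A = {t\<in>{0..<1}. wrap t \<in> A}" by auto
  finally show ?thesis .
qed

text \<open>A connected set containing both points contains one of the two arcs between them, since
  one missing point on each arc would separate them. Either arc is at least as long as the
  distance.\<close>

lemma dist_le_arclen:
  assumes J: "connected J" "J \<in> sets borel" and x: "x \<in> J" and y: "y \<in> J"
  shows "dist x y \<le> measure arclen J"
proof -
  have *: "dist x y \<le> measure arclen J"
    if x: "x \<in> J" and y: "y \<in> J" and le: "circle_coord x \<le> circle_coord y" for x y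
  proof -
    let ?a = "circle_coord x" and ?b = "circle_coord y"
    let ?S = "{t\<in>{0..<1}. wrap t \<in> J}"
    have S: "?S \<in> sets lborel"
      using J(2) by measurable
    have mono: "measure lborel A \<le> measure lborel ?S" if "A \<subseteq> ?S" "A \<in> sets borel" for A
    proof (rule measure_mono_fmeasurable)
      have "emeasure lborel ?S \<le> emeasure lborel {0..<1::real}"
        by (intro emeasure_mono) auto
      also have "\<dots> < \<infinity>" by simp
      finally show "?S \<in> fmeasurable lborel" using S by (intro fmeasurableI)
    qed (use that in auto)
    have "{?a..?b} \<subseteq> ?S \<or> {0..?a} \<union> {?b..<1} \<subseteq> ?S"
    proof (rule ccontr)
      assume "\<not> ?thesis"
      then have "\<not> {?a..?b} \<subseteq> ?S" "\<not> {0..?a} \<union> {?b..<1} \<subseteq> ?S"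
        by simp_all
      then obtain p r where "p \<in> {?a..?b}" "p \<notin> ?S" "r \<in> {0..?a} \<union> {?b..<1}" "r \<notin> ?S"
        by (meson subsetI)
      then have p: "?a \<le> p" "p \<le> ?b" "wrap p \<notin> J"
        and r: "0 \<le> r" "r < 1" "r \<le> ?a \<or> ?b \<le> r" "wrap r \<notin> J"
        using circle_coord_bounds[of x] circle_coord_bounds[of y] le by auto
      have pab: "p \<noteq> ?a" "p \<noteq> ?b" "r \<noteq> ?a" "r \<noteq> ?b"
        using x y p(3) r(4) by (metis wrap_circle_coord)+
      show False
      proof (cases "r \<le> ?a")
        case True
        then have "r < ?a" "?a < p" "p < ?b" using p(1,2) pab by simp_all
        moreover have "p < 1" using p(2) circle_coord_bounds[of y] by simp
        ultimately show False
          using connected_avoiding_two[OF J(1) r(1) _ _ r(4) p(3) x _ _ y] by simp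
      next
        case False
        then have "?a < p" "p < ?b" "?b < r" using p(1,2) r(3) pab by simp_all
        moreover have "0 \<le> p" using p(1) circle_coord_bounds[of x] by simp
        ultimately show False
          using connected_avoiding_two[OF J(1) _ _ r(2) p(3) r(4) y _ _ x] by simp
      qed
    qed
    then have "min (?b - ?a) (1 - (?b - ?a)) \<le> measure lborel ?S"
    proof
      assume "{?a..?b} \<subseteq> ?S"
      from mono[OF this] show ?thesis using le by auto
    next
      assume "{0..?a} \<union> {?b..<1} \<subseteq> ?S"
      \<comment> \<open>The right end is opened so that the two pieces are disjoint even if
        \<open>?a = ?b\<close>.\<close>
      moreover have "{0..<?a} \<union> {?b..<1} \<subseteq> {0..?a} \<union> {?b..<1}" by auto
      ultimately have "{0..<?a} \<union> {?b..<1} \<subseteq> ?S" by (rule order_trans[rotated])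
      from mono[OF this]
      have "measure lborel ({0..<?a} \<union> {?b..<1}) \<le> measure lborel ?S" by auto
      moreover have "measure lborel ({0..<?a} \<union> {?b..<1}) = ?a + (1 - ?b)"
        using circle_coord_bounds[of x] circle_coord_bounds[of y] le
        by (subst measure_Union) auto
      ultimately show ?thesis by linarith
    qed
    then show ?thesis
      using le J(2) by (simp add: dist_circle_def measure_arclen abs_if)
  qed
  show ?thesis
    using *[OF x y] *[OF y x] by (cases "circle_coord x \<le> circle_coord y") (simp_all add: dist_commute)
qed

text \<open>The coordinates lie within \<open>e\<close> of that of one fixed point or, because of
  the jump at 0, within \<open>e\<close> of an end of the unit interval. These intervals have
  lengths \<open>2 * e\<close>, \<open>e\<close> and \<open>e\<close>, hence the factor 4.\<close>

lemma arclen_le: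
  assumes J: "J \<in> sets borel" "\<And>x y. x \<in> J \<Longrightarrow> y \<in> J \<Longrightarrow> dist x y \<le> e" and e: "0 \<le> e"
  shows "measure arclen J \<le> 4 * e"
proof (cases "J = {}")
  case False
  then obtain x where x: "x \<in> J" by auto
  let ?a = "circle_coord x"
  let ?S = "{t\<in>{0..<1}. wrap t \<in> J}"
  let ?T = "{?a-e..?a+e} \<union> ({0..e} \<union> {1-e..1})"
  have "?S \<subseteq> ?T"
  proof
    fix t assume "t \<in> ?S"
    then have t: "0 \<le> t" "t < 1" "wrap t \<in> J" by auto
    have "circle_coord (wrap t) = t" using t by (simp add: circle_coord_wrap frac_eq[THEN iffD2])
    then have "min \<bar>t - ?a\<bar> (1 - \<bar>t - ?a\<bar>) \<le> e"
      using J(2)[OF t(3) x] unfolding dist_circle_def by auto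
    then show "t \<in> ?T" using t circle_coord_bounds[of x] by (auto simp: min_def abs_if split: if_splits)
  qed
  moreover have "?T \<in> fmeasurable lborel"
    by (intro fmeasurable.Un fmeasurableI) (auto simp: emeasure_lborel_Icc_eq)
  moreover have "?S \<in> sets lborel" using J(1) by measurable
  ultimately have "measure lborel ?S \<le> measure lborel ?T"
    by (intro measure_mono_fmeasurable) auto
  also have "\<dots> \<le> measure lborel {?a-e..?a+e} + (measure lborel {0..e} + measure lborel {1-e..1})"
    by (intro order.trans[OF measure_Un_le] add_mono order.refl) auto
  also have "\<dots> = 4 * e" using e by simp
  finally show ?thesis using J(1) by (simp add: measure_arclen)
qed (use e in simp)

section \<open>Invariant measures as limits of almost invariant ones\<close>

text \<open>Closed sets are an intersection-stable generator, and the indicator of a nonempty closed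
  set is the pointwise limit of the bounded continuous functions \<open>\<phi> n\<close>.\<close>

lemma borel_measure_eqI_continuous:
  fixes M M' :: "'a::metric_space measure"
  assumes "prob_space M" "prob_space M'" and sets: "sets M = sets borel" "sets M' = sets borel"
    and eq: "\<And>\<phi>::'a \<Rightarrow> real. continuous_on UNIV \<phi> \<Longrightarrow> (\<And>x. 0 \<le> \<phi> x \<and> \<phi> x \<le> 1) \<Longrightarrow>
      integral\<^sup>L M \<phi> = integral\<^sup>L M' \<phi>"
  shows "M = M'"
proof -
  interpret M: prob_space M by fact
  interpret M': prob_space M' by fact
  note [measurable_cong] = sets
  have meas: "measure M K = measure M' K" if K: "closed K" for K
  proof (cases "K = {}")
    case False
    define \<phi> where "\<phi> n x = max 0 (1 - real n * infdist x K)" for n :: nat and x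
    have \<phi>c: "continuous_on UNIV (\<phi> n)" for n
      unfolding \<phi>_def by (intro continuous_intros)
    have \<phi>b: "0 \<le> \<phi> n x \<and> \<phi> n x \<le> 1" for n x
      unfolding \<phi>_def by (auto simp: infdist_nonneg)
    have [measurable]: "\<phi> n \<in> borel_measurable borel" for n
      by (intro borel_measurable_continuous_onI \<phi>c)
    have lim: "(\<lambda>n. \<phi> n x) \<longlonglongrightarrow> indicator K x" for x
    proof (cases "x \<in> K")
      case True
      then show ?thesis by (simp add: \<phi>_def)
    next
      case False
      then have pos: "0 < infdist x K"
        using K \<open>K \<noteq> {}\<close> by (simp add: infdist_pos_not_in_closed)
      obtain m :: nat where m: "1 < real m * infdist x K"
        using reals_Archimedean3[OF pos] by blast
      have "\<phi> n x = 0" if "n \<ge> m" for n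
      proof -
        have "real m * infdist x K \<le> real n * infdist x K"
          using that pos by (intro mult_right_mono) auto
        then show ?thesis using m by (simp add: \<phi>_def)
      qed
      then have "eventually (\<lambda>n. \<phi> n x = 0) sequentially"
        unfolding eventually_sequentially by blast
      then show ?thesis using False by (simp add: tendsto_eventually)
    qed
    have [measurable]: "K \<in> sets borel" using K by simp
    have "(\<lambda>n. integral\<^sup>L M (\<phi> n)) \<longlonglongrightarrow> integral\<^sup>L M (indicator K)"
      by (rule integral_dominated_convergence[where w="\<lambda>_. 1"]) (use lim \<phi>b in auto)
    moreover have "(\<lambda>n. integral\<^sup>L M' (\<phi> n)) \<longlonglongrightarrow> integral\<^sup>L M' (indicator K)"
      by (rule integral_dominated_convergence[where w="\<lambda>_. 1"]) (use lim \<phi>b in auto)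
    moreover have "integral\<^sup>L M (\<phi> n) = integral\<^sup>L M' (\<phi> n)" for n
      by (rule eq[OF \<phi>c \<phi>b])
    ultimately have "integral\<^sup>L M (indicator K) = (integral\<^sup>L M' (indicator K) :: real)"
      by (simp add: LIMSEQ_unique)
    then show ?thesis
      using sets sets_eq_imp_space_eq[OF sets(1)] sets_eq_imp_space_eq[OF sets(2)] by simp
  qed simp
  show ?thesis
  proof (rule measure_eqI_generator_eq[where E="Collect closed" and \<Omega>=UNIV and A="\<lambda>_. UNIV"])
    show "Int_stable (Collect (closed :: 'a set \<Rightarrow> bool))"
      by (auto simp: Int_stable_def)
    show "sets M = sigma_sets UNIV (Collect closed)" "sets M' = sigma_sets UNIV (Collect closed)"
      using sets by (simp_all add: borel_eq_closed)
  qed (auto simp: M.emeasure_eq_measure M'.emeasure_eq_measure meas)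
qed

text \<open>The coordinate is discontinuous at 0, but its superlevel sets at nonnegative levels are
  open arcs.\<close>

lemma circle_coord_measurable [measurable]: "circle_coord \<in> borel_measurable borel"
proof (rule borel_measurable_iff_greater[THEN iffD2], intro allI)
  fix a
  have "{w. a < circle_coord w} = (if a < 0 then UNIV else {z. a < circle_coord z \<and> circle_coord z < 1})"
    by (auto simp: circle_coord_bounds(2) intro: less_le_trans[OF _ circle_coord_bounds(1)])
  moreover have "open {z. a < circle_coord z \<and> circle_coord z < 1}" if "\<not> a < 0"
    using that by (intro open_coord_between) auto
  ultimately show "{w \<in> space borel. a < circle_coord w} \<in> sets borel" by auto
qed

text \<open>Weak compactness is borrowed from the real line: the laws of the coordinate are tight,
  and a test function composed with \<open>wrap\<close> is continuous on the line although the
  coordinate itself is not. The one-sided hypothesis also covers \<open>1 - \<phi>\<close>, which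
  supplies the reverse inequality.\<close>

lemma common_invariant_from_limit:
  fixes \<rho> :: "nat \<Rightarrow> circle measure"
  assumes \<rho>: "\<And>k. prob_space (\<rho> k)" "\<And>k. sets (\<rho> k) = sets borel"
    and f: "\<And>i. i < N \<Longrightarrow> continuous_on UNIV (f i)"
    and inv: "\<And>i \<phi> e. i < N \<Longrightarrow> continuous_on UNIV \<phi> \<Longrightarrow> (\<And>x. 0 \<le> \<phi> x \<and> \<phi> x \<le> (1::real)) \<Longrightarrow> 0 < e \<Longrightarrow>
      eventually (\<lambda>k. (\<integral>x. \<phi> (f i x) \<partial>\<rho> k) \<le> integral\<^sup>L (\<rho> k) \<phi> + e) sequentially"
  shows "\<exists>m. common_invariant N f m"
proof -
  note [measurable_cong] = \<rho>(2)
  define R where "R k = distr (\<rho> k) borel circle_coord" for k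
  have Rd: "real_distribution (R k)" for k
    unfolding R_def by (intro prob_space.real_distribution_distr \<rho>) auto
  have "tight R"
    unfolding tight_def
  proof (intro conjI allI impI Rd)
    fix \<epsilon> :: real assume "0 < \<epsilon>"
    have neg: "-1 < circle_coord z" for z
      using circle_coord_bounds(1)[of z] by linarith
    have "measure (R k) {-1<..1} = 1" for k
    proof -
      have "measure (R k) {-1<..1} = measure (\<rho> k) (circle_coord -` {-1<..1} \<inter> space (\<rho> k))"
        unfolding R_def by (subst measure_distr) auto
      also have "circle_coord -` {-1<..1} \<inter> space (\<rho> k) = space (\<rho> k)"
        using less_imp_le[OF circle_coord_bounds(2)] neg by auto
      finally show ?thesis using prob_space.prob_space[OF \<rho>(1)] by simp
    qed
    then show "\<exists>a b. a < b \<and> (\<forall>n. 1 - \<epsilon> < measure (R n) {a<..b})"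
      using \<open>0 < \<epsilon>\<close> by (intro exI[of _ "-1"] exI[of _ 1]) auto
  qed
  then obtain r M where r: "strict_mono (r :: nat \<Rightarrow> nat)" and M: "real_distribution M"
    and wc: "weak_conv_m (R \<circ> id \<circ> r) M"
    using tight_imp_convergent_subsubsequence[of R id] strict_mono_id by blast
  interpret M: real_distribution M by fact
  \<comment> \<open>The limit law may charge 1, where mass approaching the jump from below
    accumulates; \<open>wrap\<close> returns it to the point 0.\<close>
  define m where "m = distr M borel wrap"
  have m: "prob_space m" "sets m = sets borel"
    unfolding m_def by (auto intro!: M.prob_space_distr)
  have lim: "(\<lambda>k. integral\<^sup>L (\<rho> (r k)) \<phi>) \<longlonglongrightarrow> integral\<^sup>L m \<phi>"
    if \<phi>: "continuous_on UNIV \<phi>" and b: "\<And>x. 0 \<le> \<phi> x \<and> \<phi> x \<le> (1::real)" for \<phi>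
  proof -
    have [measurable]: "\<phi> \<in> borel_measurable borel"
      by (intro borel_measurable_continuous_onI \<phi>)
    have c: "continuous_on UNIV (\<lambda>t. \<phi> (wrap t))"
      by (rule continuous_on_compose2[OF \<phi> continuous_on_wrap]) auto
    have "(\<lambda>k. integral\<^sup>L ((R \<circ> id \<circ> r) k) (\<lambda>t. \<phi> (wrap t))) \<longlonglongrightarrow> integral\<^sup>L M (\<lambda>t. \<phi> (wrap t))"
      by (rule weak_conv_imp_integral_bdd_continuous_conv[OF _ M wc, where B=1])
         (use c b Rd in \<open>auto simp: continuous_on_eq_continuous_at\<close>)
    moreover have "integral\<^sup>L ((R \<circ> id \<circ> r) k) (\<lambda>t. \<phi> (wrap t)) = integral\<^sup>L (\<rho> (r k)) \<phi>" for k
      by (simp add: R_def integral_distr)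
    moreover have "integral\<^sup>L m \<phi> = integral\<^sup>L M (\<lambda>t. \<phi> (wrap t))"
      by (simp add: m_def integral_distr)
    ultimately show ?thesis by simp
  qed
  have le: "integral\<^sup>L m (\<lambda>x. \<phi> (f i x)) \<le> integral\<^sup>L m \<phi>"
    if i: "i < N" and \<phi>: "continuous_on UNIV \<phi>" and b: "\<And>x. 0 \<le> \<phi> x \<and> \<phi> x \<le> (1::real)" for i \<phi>
  proof (rule field_le_epsilon)
    fix e :: real assume e: "0 < e"
    have c: "continuous_on UNIV (\<lambda>x. \<phi> (f i x))"
      by (rule continuous_on_compose2[OF \<phi> f[OF i]]) auto
    show "integral\<^sup>L m (\<lambda>x. \<phi> (f i x)) \<le> integral\<^sup>L m \<phi> + e"
    proof (rule tendsto_le[OF _ tendsto_add[OF lim[OF \<phi> b] tendsto_const] lim[OF c b]])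
      show "eventually (\<lambda>k. (\<integral>x. \<phi> (f i x) \<partial>\<rho> (r k)) \<le> integral\<^sup>L (\<rho> (r k)) \<phi> + e) sequentially"
        using inv[OF i \<phi> b e] r by (rule eventually_subseq[rotated])
    qed simp
  qed
  have eq: "integral\<^sup>L m (\<lambda>x. \<phi> (f i x)) = integral\<^sup>L m \<phi>"
    if i: "i < N" and \<phi>: "continuous_on UNIV \<phi>" and b: "\<And>x. 0 \<le> \<phi> x \<and> \<phi> x \<le> (1::real)" for i \<phi>
  proof (rule antisym[OF le[OF i \<phi> b]])
    interpret m: prob_space m by (rule m)
    have [measurable]: "\<phi> \<in> borel_measurable m" "f i \<in> m \<rightarrow>\<^sub>M borel"
      unfolding m_def using borel_measurable_continuous_onI[OF \<phi>] borel_measurable_continuous_onI[OF f[OF i]]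
      by simp_all
    have \<phi>m: "\<phi> \<in> borel_measurable borel" by (intro borel_measurable_continuous_onI \<phi>)
    have "integrable m \<phi>" "integrable m (\<lambda>x. \<phi> (f i x))"
      by (intro m.integrable_const_bound[where B=1]; use b \<phi>m in \<open>auto intro: measurable_compose\<close>)+
    moreover have "integral\<^sup>L m (\<lambda>x. 1 - \<phi> (f i x)) \<le> integral\<^sup>L m (\<lambda>x. 1 - \<phi> x)"
      by (rule le[OF i]) (use b \<phi> in \<open>auto intro!: continuous_intros\<close>)
    ultimately show "integral\<^sup>L m \<phi> \<le> integral\<^sup>L m (\<lambda>x. \<phi> (f i x))" by (simp add: m.prob_space)
  qed
  have "common_invariant N f m"
    unfolding common_invariant_def borel_prob_def
  proof (intro conjI m allI impI)
    fix i assume i: "i < N"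
    have fm: "f i \<in> borel_measurable borel" by (intro borel_measurable_continuous_onI f i)
    then have fm': "f i \<in> m \<rightarrow>\<^sub>M borel" using m by (simp cong: measurable_cong_sets)
    show "distr m borel (f i) = m"
    proof (rule borel_measure_eqI_continuous)
      fix \<phi> :: "circle \<Rightarrow> real" assume \<phi>: "continuous_on UNIV \<phi>" and b: "\<And>x. 0 \<le> \<phi> x \<and> \<phi> x \<le> 1"
      have "integral\<^sup>L (distr m borel (f i)) \<phi> = integral\<^sup>L m (\<lambda>x. \<phi> (f i x))"
        by (rule integral_distr[OF fm']) (intro borel_measurable_continuous_onI \<phi>)
      then show "integral\<^sup>L (distr m borel (f i)) \<phi> = integral\<^sup>L m \<phi>"
        using eq[OF i \<phi> b] by simp
    qed (use m fm' in \<open>auto intro: prob_space.prob_space_distr\<close>)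
  qed
  then show ?thesis ..
qed

section \<open>Square-summable contraction along disjoint small sets\<close>

text \<open>The state space is left open because the operator acts on functions of points, of sets
  (through images) and of pairs (through \<open>map_prod\<close>).\<close>

definition lazy_op :: "nat \<Rightarrow> (nat \<Rightarrow> real) \<Rightarrow> (nat \<Rightarrow> 'a \<Rightarrow> 'a) \<Rightarrow> ('a \<Rightarrow> real) \<Rightarrow> 'a \<Rightarrow> real" where
  "lazy_op N p F \<phi> x = \<phi> x / 2 + (\<Sum>i<N. p i * \<phi> (F i x)) / 2"

text \<open>Nonemptiness provides sample points and makes disjoint members of two families
  distinct.\<close>

definition small_set :: "real \<Rightarrow> circle set \<Rightarrow> bool" where
  "small_set \<delta> J \<longleftrightarrow> compact J \<and> J \<noteq> {} \<and> (\<forall>x\<in>J. \<forall>y\<in>J. dist x y \<le> \<delta>)"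

definition packing :: "real \<Rightarrow> circle set set \<Rightarrow> bool" where
  "packing \<delta> D \<longleftrightarrow> finite D \<and> disjoint D \<and> (\<forall>J\<in>D. small_set \<delta> J)"

text \<open>The inequality is integrated over a uniform level \<open>u\<close> in
  \<open>[0, 1]\<close>. The event \<open>u < s\<close> has probability at least \<open>s\<close>
  when \<open>s \<le> 1\<close>, and \<open>t \<le> u\<close> has probability at least
  \<open>1 - t\<close> when \<open>0 \<le> t\<close>.\<close>

lemma layer_cake_bound:
  fixes a b s t :: "'a \<Rightarrow> real"
  assumes "finite D" and ab: "\<And>J. J \<in> D \<Longrightarrow> 0 \<le> a J \<and> 0 \<le> b J \<and> 0 \<le> t J \<and> s J \<le> 1"
    and le: "\<And>u. (\<Sum>J\<in>D. b J * indicator {..<s J} u) + (\<Sum>J\<in>D. a J * indicator {t J..} u) \<le> 1"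
  shows "(\<Sum>J\<in>D. b J * s J) + (\<Sum>J\<in>D. a J * (1 - t J)) \<le> 1"
proof -
  define U where "U = uniform_measure lborel {0..1::real}"
  interpret U: prob_space U unfolding U_def by (intro prob_space_uniform_measure) auto
  have U: "measure U A = measure lborel ({0..1} \<inter> A)" if "A \<in> sets borel" for A
    unfolding U_def using that by (subst measure_uniform_measure) auto
  have [measurable_cong]: "sets U = sets borel" by (simp add: U_def)
  have "(\<Sum>J\<in>D. b J * s J) + (\<Sum>J\<in>D. a J * (1 - t J))
      \<le> (\<Sum>J\<in>D. b J * measure U {..<s J}) + (\<Sum>J\<in>D. a J * measure U {t J..})"
  proof (intro add_mono sum_mono mult_left_mono)
    fix J assume J: "J \<in> D"
    show "s J \<le> measure U {..<s J}"
    proof (cases "s J \<le> 0")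
      case False
      then have "{0..1} \<inter> {..<s J} = {0..<s J}" using ab[OF J] by auto
      then show ?thesis using False by (simp add: U)
    qed (auto intro: order_trans[OF _ measure_nonneg])
    show "1 - t J \<le> measure U {t J..}"
    proof (cases "1 \<le> t J")
      case False
      then have "{0..1} \<inter> {t J..} = {t J..1}" using ab[OF J] by auto
      then show ?thesis using False by (simp add: U)
    qed (auto intro: order_trans[OF _ measure_nonneg])
  qed (use ab in auto)
  also have "\<dots> = (\<integral>u. (\<Sum>J\<in>D. b J * indicator {..<s J} u) + (\<Sum>J\<in>D. a J * indicator {t J..} u) \<partial>U)"
  proof -
    have [simp]: "space U = UNIV" by (simp add: U_def)
    have [simp]: "integrable U (indicator A :: real \<Rightarrow> real)" "integral\<^sup>L U (indicator A) = measure U A"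
      if "A \<in> sets borel" for A
      using that by (auto simp: U.emeasure_eq_measure)
    show ?thesis
      by (simp add: Bochner_Integration.integral_add Bochner_Integration.integral_sum Bochner_Integration.integrable_sum)
  qed
  also have "\<dots> \<le> (\<integral>u. 1 \<partial>U)"
    by (intro integral_mono le Bochner_Integration.integrable_add Bochner_Integration.integrable_sum
        integrable_mult_right) (auto simp: U.emeasure_eq_measure)
  finally show ?thesis by (simp add: U.prob_space)
qed

lemma disjoint_UnI:
  assumes "disjoint A" "disjoint B" and "\<And>a b. a \<in> A \<Longrightarrow> b \<in> B \<Longrightarrow> b \<inter> a = {}"
  shows "disjoint (A \<union> B)"
  using assms unfolding disjoint_def by (metis Un_iff inf_commute)

locale circle_system =
  fixes N :: nat and p :: "nat \<Rightarrow> real" and f :: "nat \<Rightarrow> circle \<Rightarrow> circle"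
  assumes cont_f: "\<And>i. i < N \<Longrightarrow> continuous_on UNIV (f i)"
    and inj_f: "\<And>i. i < N \<Longrightarrow> inj (f i)"
    and p_pos: "\<And>i. i < N \<Longrightarrow> 0 < p i"
    and p_sum: "(\<Sum>i<N. p i) = 1"
begin

abbreviation T :: "(circle set \<Rightarrow> real) \<Rightarrow> circle set \<Rightarrow> real" where
  "T \<equiv> lazy_op N p (\<lambda>i. (`) (f i))"

lemma N_pos: "0 < N"
  using p_sum by (cases N) auto

lemma p_le_1: "i < N \<Longrightarrow> p i \<le> 1"
  using p_sum member_le_sum[of i "{..<N}" p] p_pos by (simp add: less_imp_le)

text \<open>Injectivity keeps images disjoint; images that are no longer small are dropped, which
  loses nothing for a function vanishing on them.\<close>

lemma packing_image:
  assumes D: "packing \<delta> D" and i: "i < N"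
  shows "packing \<delta> ((`) (f i) ` {J\<in>D. small_set \<delta> (f i ` J)})"
  unfolding packing_def
proof (intro conjI)
  have "f i ` a \<inter> f i ` b = {}" if "a \<in> D" "b \<in> D" "a \<noteq> b" for a b
    using that D inj_f[OF i] unfolding packing_def disjoint_def by (metis image_Int image_empty)
  then show "disjoint ((`) (f i) ` {J\<in>D. small_set \<delta> (f i ` J)})"
    unfolding disjoint_def by blast
qed (use D in \<open>auto simp: packing_def\<close>)

text \<open>Strict convexity, quantified. With \<open>Y\<close> the mean of the \<open>y j\<close>,
  convexity of the square loses \<open>(x - Y)\<^sup>2 / 4\<close> in the lazy average and half of
  the variance in the inner one. Together these control \<open>(x - y i)\<^sup>2\<close> with factor
  \<open>p i / 8\<close>.\<close>

lemma lazy_square_defect: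
  fixes x :: real and y :: "nat \<Rightarrow> real"
  assumes i: "i < N"
  shows "(x / 2 + (\<Sum>j<N. p j * y j) / 2)\<^sup>2 + p i / 8 * (x - y i)\<^sup>2
    \<le> x\<^sup>2 / 2 + (\<Sum>j<N. p j * (y j)\<^sup>2) / 2"
proof -
  define Y where "Y = (\<Sum>j<N. p j * y j)"
  have "p i * (y i - Y)\<^sup>2 \<le> (\<Sum>j<N. p j * (y j - Y)\<^sup>2)"
    by (rule member_le_sum[of i _ "\<lambda>j. p j * (y j - Y)\<^sup>2"]) (use i p_pos in \<open>auto simp: less_imp_le\<close>)
  also have "\<dots> = (\<Sum>j<N. p j * (y j)\<^sup>2) - Y\<^sup>2"
  proof -
    have "p j * (y j - Y)\<^sup>2 = p j * (y j)\<^sup>2 - 2 * Y * (p j * y j) + Y\<^sup>2 * p j" for j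
      by (simp add: power2_eq_square algebra_simps)
    then have "(\<Sum>j<N. p j * (y j - Y)\<^sup>2) = (\<Sum>j<N. p j * (y j)\<^sup>2) - 2 * Y * Y + Y\<^sup>2 * 1"
      by (simp add: sum.distrib sum_subtractf Y_def p_sum flip: sum_distrib_left)
    then show ?thesis by (simp add: power2_eq_square)
  qed
  finally have 1: "p i * (y i - Y)\<^sup>2 \<le> (\<Sum>j<N. p j * (y j)\<^sup>2) - Y\<^sup>2" .
  have "p i * (x - y i)\<^sup>2 \<le> p i * (2 * (x - Y)\<^sup>2 + 2 * (y i - Y)\<^sup>2)"
  proof (rule mult_left_mono)
    have "0 \<le> ((x - Y) + (y i - Y))\<^sup>2" by simp
    then show "(x - y i)\<^sup>2 \<le> 2 * (x - Y)\<^sup>2 + 2 * (y i - Y)\<^sup>2"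
      by (simp add: power2_eq_square algebra_simps)
  qed (use p_pos[OF i] in simp)
  also have "\<dots> \<le> 2 * (x - Y)\<^sup>2 + 2 * (p i * (y i - Y)\<^sup>2)"
    using mult_right_mono[OF p_le_1[OF i], of "2 * (x - Y)\<^sup>2"] by (simp add: algebra_simps)
  also have "\<dots> \<le> 2 * (x - Y)\<^sup>2 + 4 * (p i * (y i - Y)\<^sup>2)"
    using p_pos[OF i] by simp
  also have "\<dots> \<le> 2 * (x - Y)\<^sup>2 + 4 * ((\<Sum>j<N. p j * (y j)\<^sup>2) - Y\<^sup>2)"
    using 1 by (intro add_left_mono mult_left_mono) auto
  finally have 2: "p i * (x - y i)\<^sup>2 \<le> 2 * (x - Y)\<^sup>2 + 4 * ((\<Sum>j<N. p j * (y j)\<^sup>2) - Y\<^sup>2)" .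
  have 3: "(x / 2 + Y / 2)\<^sup>2 = x\<^sup>2 / 2 + Y\<^sup>2 / 2 - (x - Y)\<^sup>2 / 4"
    by (simp add: power2_eq_square field_simps)
  show ?thesis unfolding Y_def[symmetric] 3 using 2 by simp
qed

lemma almost_invariance:
  assumes D: "packing \<delta> D" and F0: "\<And>J. 0 \<le> F J" and Fs: "\<And>J. \<not> small_set \<delta> J \<Longrightarrow> F J = 0"
    and Fb: "\<And>D. packing \<delta> D \<Longrightarrow> (\<Sum>J\<in>D. (F J)\<^sup>2) \<le> 1"
    and big: "1 - \<epsilon> < (\<Sum>J\<in>D. (T F J)\<^sup>2)"
    and i: "i < N" and x: "\<And>J. J \<in> D \<Longrightarrow> x J \<in> J"
    and \<phi>: "\<And>z. 0 \<le> \<phi> z \<and> \<phi> z \<le> (1::real)"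
    and e: "0 \<le> e" "\<And>z w. dist z w \<le> \<delta> \<Longrightarrow> \<bar>\<phi> z - \<phi> w\<bar> < e"
  shows "1 - 2 * \<epsilon> \<le> (\<Sum>J\<in>D. (F J)\<^sup>2)"
    and "(\<Sum>J\<in>D. (F J)\<^sup>2 * \<phi> (f i (x J)))
      \<le> (\<Sum>J\<in>D. (F J)\<^sup>2 * \<phi> (x J)) + 2 * \<epsilon> + 2 * e + 2 * sqrt (8 * \<epsilon> / p i)"
proof -
  define b where "b j J = (F (f j ` J))\<^sup>2" for j J
  have Fs': "small_set \<delta> J" if "F J \<noteq> 0" for J using Fs that by blast
  have fin: "finite D" using D by (simp add: packing_def)
  have inj_img: "inj_on ((`) (f j)) A" if "j < N" for j A
    using inj_f[OF that] by (auto simp: inj_on_def inj_image_eq_iff)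
  have b1: "(\<Sum>J\<in>D. b j J) \<le> 1" if j: "j < N" for j
  proof -
    have "(\<Sum>J\<in>D. b j J) = (\<Sum>J\<in>{J\<in>D. small_set \<delta> (f j ` J)}. b j J)"
      using fin by (intro sum.mono_neutral_right) (auto simp: b_def Fs)
    also have "\<dots> = (\<Sum>J\<in>(`) (f j) ` {J\<in>D. small_set \<delta> (f j ` J)}. (F J)\<^sup>2)"
      by (subst sum.reindex[OF inj_img[OF j]]) (simp add: b_def)
    also have "\<dots> \<le> 1" by (rule Fb[OF packing_image[OF D j]])
    finally show ?thesis .
  qed
  have a1: "(\<Sum>J\<in>D. (F J)\<^sup>2) \<le> 1" by (rule Fb[OF D])
  have "(\<Sum>J\<in>D. (T F J)\<^sup>2) + p i / 8 * (\<Sum>J\<in>D. (F J - F (f i ` J))\<^sup>2)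
    = (\<Sum>J\<in>D. (T F J)\<^sup>2 + p i / 8 * (F J - F (f i ` J))\<^sup>2)"
    by (simp add: sum.distrib sum_distrib_left)
  also have "\<dots> \<le> (\<Sum>J\<in>D. (F J)\<^sup>2 / 2 + (\<Sum>j<N. p j * b j J) / 2)"
    unfolding lazy_op_def b_def by (intro sum_mono lazy_square_defect i)
  also have "\<dots> = (\<Sum>J\<in>D. (F J)\<^sup>2) / 2 + (\<Sum>j<N. p j * (\<Sum>J\<in>D. b j J)) / 2"
    by (simp add: sum.distrib sum_distrib_left sum.swap[of _ "{..<N}" D] flip: sum_divide_distrib)
  also have "(\<Sum>j<N. p j * (\<Sum>J\<in>D. b j J)) \<le> (\<Sum>j<N. p j * 1)"
    by (intro sum_mono mult_left_mono b1) (use p_pos in \<open>auto simp: less_imp_le\<close>)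
  finally have main: "(\<Sum>J\<in>D. (T F J)\<^sup>2) + p i / 8 * (\<Sum>J\<in>D. (F J - F (f i ` J))\<^sup>2)
      \<le> (\<Sum>J\<in>D. (F J)\<^sup>2) / 2 + 1 / 2"
    by (simp add: p_sum)
  moreover have "0 \<le> p i / 8 * (\<Sum>J\<in>D. (F J - F (f i ` J))\<^sup>2)"
    using p_pos[OF i] by (intro mult_nonneg_nonneg sum_nonneg) auto
  ultimately show lower: "1 - 2 * \<epsilon> \<le> (\<Sum>J\<in>D. (F J)\<^sup>2)"
    using big by linarith
  have "p i / 8 * (\<Sum>J\<in>D. (F J - F (f i ` J))\<^sup>2) \<le> \<epsilon>"
    using main big a1 by linarith
  then have diff: "(\<Sum>J\<in>D. (F J - F (f i ` J))\<^sup>2) \<le> 8 * \<epsilon> / p i"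
    using p_pos[OF i] by (simp add: field_simps)
  have l1: "(\<Sum>J\<in>D. \<bar>(F J)\<^sup>2 - b i J\<bar>) \<le> 2 * sqrt (8 * \<epsilon> / p i)"
  proof -
    have "(\<Sum>J\<in>D. \<bar>(F J)\<^sup>2 - b i J\<bar>) = (\<Sum>J\<in>D. \<bar>F J - F (f i ` J)\<bar> * \<bar>F J + F (f i ` J)\<bar>)"
      by (intro sum.cong refl) (simp add: b_def power2_eq_square algebra_simps flip: abs_mult)
    also have "\<dots> \<le> L2_set (\<lambda>J. F J - F (f i ` J)) D * L2_set (\<lambda>J. F J + F (f i ` J)) D"
      by (rule L2_set_mult_ineq)
    also have "\<dots> \<le> sqrt (8 * \<epsilon> / p i) * 2"
    proof (intro mult_mono)
      show "L2_set (\<lambda>J. F J - F (f i ` J)) D \<le> sqrt (8 * \<epsilon> / p i)"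
        unfolding L2_set_def using diff by (rule real_sqrt_le_mono)
      have "(\<Sum>J\<in>D. (F J + F (f i ` J))\<^sup>2) \<le> (\<Sum>J\<in>D. 2 * (F J)\<^sup>2 + 2 * b i J)"
      proof (intro sum_mono)
        fix J
        have "0 \<le> (F J - F (f i ` J))\<^sup>2" by simp
        then show "(F J + F (f i ` J))\<^sup>2 \<le> 2 * (F J)\<^sup>2 + 2 * b i J"
          by (simp add: b_def power2_eq_square algebra_simps)
      qed
      also have "\<dots> \<le> 4"
        using a1 b1[OF i] by (simp add: sum.distrib flip: sum_distrib_left)
      finally show "L2_set (\<lambda>J. F J + F (f i ` J)) D \<le> 2"
        unfolding L2_set_def by (metis real_sqrt_le_mono real_sqrt_four)
      have "0 \<le> (\<Sum>J\<in>D. (F J - F (f i ` J))\<^sup>2)" by (intro sum_nonneg) auto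
      then show "0 \<le> sqrt (8 * \<epsilon> / p i)" using diff by simp
    qed (rule L2_set_nonneg)
    finally show ?thesis by simp
  qed
  \<comment> \<open>The shift by \<open>e\<close>, which bounds the oscillation of
    \<open>\<phi>\<close> on a small set, makes a level comparison at the sample point valid on the
    whole set.\<close>
  define s t where "s J = \<phi> (f i (x J)) - e" and "t J = \<phi> (x J) + e" for J
  have *: "(\<Sum>J\<in>D. b i J * s J) + (\<Sum>J\<in>D. (F J)\<^sup>2 * (1 - t J)) \<le> 1"
  proof (rule layer_cake_bound[OF fin])
    fix J assume "J \<in> D"
    show "0 \<le> (F J)\<^sup>2 \<and> 0 \<le> b i J \<and> 0 \<le> t J \<and> s J \<le> 1"
      using e(1) \<phi>[of "x J"] \<phi>[of "f i (x J)"] unfolding b_def s_def t_def by auto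
  next
    fix u :: real
    \<comment> \<open>Original sets on which \<open>\<phi>\<close> is at most \<open>u\<close>, and
      small images on which it exceeds \<open>u\<close>. The level separates the two families, so
      their union is again a packing and has total weight at most 1.\<close>
    let ?A = "{J\<in>D. t J \<le> u}" and ?B = "{J\<in>D. u < s J \<and> small_set \<delta> (f i ` J)}"
    let ?B' = "(`) (f i) ` ?B"
    have small: "small_set \<delta> J" if "J \<in> D" for J using D that by (auto simp: packing_def)
    have onA: "\<phi> z \<le> u" if "J \<in> ?A" "z \<in> J" for J z
    proof -
      have J: "J \<in> D" "t J \<le> u" using that(1) by simp_all
      have "dist z (x J) \<le> \<delta>" using small[OF J(1)] x[OF J(1)] that(2) by (simp add: small_set_def)
      from e(2)[OF this] show ?thesis using J(2) unfolding t_def by linarith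
    qed
    have onB: "u < \<phi> z" if KB: "K \<in> ?B'" and zK: "z \<in> K" for K z
    proof -
      obtain J where K: "K = f i ` J" and "J \<in> ?B"
        using KB by (rule imageE)
      then have J: "J \<in> D" "u < s J" "small_set \<delta> (f i ` J)" by simp_all
      have "dist z (f i (x J)) \<le> \<delta>"
        using J zK x[OF J(1)] unfolding small_set_def K by auto
      from e(2)[OF this] show ?thesis using J(2) unfolding s_def by linarith
    qed
    have cross: "K \<inter> J = {}" if "J \<in> ?A" "K \<in> ?B'" for J K
    proof (rule ccontr)
      assume "K \<inter> J \<noteq> {}"
      then obtain z where "z \<in> K" "z \<in> J" by blast
      then show False using onA[OF that(1), of z] onB[OF that(2), of z] by simp
    qed
    have "packing \<delta> (?A \<union> ?B')"
      unfolding packing_def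
    proof (intro conjI)
      have "?B' \<subseteq> (`) (f i) ` {J\<in>D. small_set \<delta> (f i ` J)}" by auto
      then have "disjoint ?B'"
        using packing_image[OF D i] unfolding packing_def by (meson pairwise_subset)
      moreover have "disjoint ?A"
        using D unfolding packing_def disjoint_def by auto
      ultimately show "disjoint (?A \<union> ?B')"
        by (intro disjoint_UnI cross)
    qed (use fin small in auto)
    then have "(\<Sum>J\<in>?A \<union> ?B'. (F J)\<^sup>2) \<le> 1" by (rule Fb)
    moreover have "?A \<inter> ?B' = {}"
    proof (rule ccontr)
      assume "?A \<inter> ?B' \<noteq> {}"
      then obtain J where "J \<in> ?A" "J \<in> ?B'" by blast
      with cross[OF this] small[of J] show False by (auto simp: small_set_def)
    qed
    ultimately have "(\<Sum>J\<in>?A. (F J)\<^sup>2) + (\<Sum>J\<in>?B'. (F J)\<^sup>2) \<le> 1"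
      using fin by (subst (asm) sum.union_disjoint) auto
    moreover have "(\<Sum>J\<in>?B'. (F J)\<^sup>2) = (\<Sum>J\<in>?B. b i J)"
      by (subst sum.reindex[OF inj_img[OF i]]) (simp add: b_def)
    moreover have "(\<Sum>J\<in>?B. b i J) = (\<Sum>J\<in>D. b i J * indicator {..<s J} u)"
      using fin by (intro sum.mono_neutral_cong_left) (auto simp: b_def indicator_def dest: Fs')
    moreover have "(\<Sum>J\<in>?A. (F J)\<^sup>2) = (\<Sum>J\<in>D. (F J)\<^sup>2 * indicator {t J..} u)"
      using fin by (intro sum.mono_neutral_cong_left) (auto simp: indicator_def)
    ultimately show "(\<Sum>J\<in>D. b i J * indicator {..<s J} u) + (\<Sum>J\<in>D. (F J)\<^sup>2 * indicator {t J..} u) \<le> 1"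
      by linarith
  qed
  \<comment> \<open>The total weight of \<open>D\<close> is at least
    \<open>1 - 2 * \<epsilon>\<close>, and each of the two shifts costs at most
    \<open>e\<close>.\<close>
  have lc: "(\<Sum>J\<in>D. b i J * \<phi> (f i (x J))) \<le> (\<Sum>J\<in>D. (F J)\<^sup>2 * \<phi> (x J)) + 2 * \<epsilon> + 2 * e"
  proof -
    have "(\<Sum>J\<in>D. b i J * s J) = (\<Sum>J\<in>D. b i J * \<phi> (f i (x J))) - (\<Sum>J\<in>D. b i J) * e"
      by (simp add: s_def right_diff_distrib sum_subtractf sum_distrib_right)
    moreover have "(\<Sum>J\<in>D. (F J)\<^sup>2 * (1 - t J))
        = (\<Sum>J\<in>D. (F J)\<^sup>2) - (\<Sum>J\<in>D. (F J)\<^sup>2 * \<phi> (x J)) - (\<Sum>J\<in>D. (F J)\<^sup>2) * e"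
      by (simp add: t_def right_diff_distrib distrib_left sum_subtractf sum.distrib sum_distrib_right)
    moreover have "(\<Sum>J\<in>D. b i J) * e \<le> 1 * e"
      by (rule mult_right_mono[OF b1[OF i] e(1)])
    moreover have "(\<Sum>J\<in>D. (F J)\<^sup>2) * e \<le> 1 * e"
      by (rule mult_right_mono[OF a1 e(1)])
    ultimately show ?thesis using * lower by linarith
  qed
  have "(\<Sum>J\<in>D. (F J)\<^sup>2 * \<phi> (f i (x J)))
      \<le> (\<Sum>J\<in>D. b i J * \<phi> (f i (x J)) + \<bar>(F J)\<^sup>2 - b i J\<bar>)"
  proof (rule sum_mono)
    fix J
    have "((F J)\<^sup>2 - b i J) * \<phi> (f i (x J)) \<le> \<bar>(F J)\<^sup>2 - b i J\<bar> * 1"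
      using \<phi>[of "f i (x J)"] by (intro mult_mono) auto
    then show "(F J)\<^sup>2 * \<phi> (f i (x J)) \<le> b i J * \<phi> (f i (x J)) + \<bar>(F J)\<^sup>2 - b i J\<bar>"
      by (simp add: algebra_simps)
  qed
  then show "(\<Sum>J\<in>D. (F J)\<^sup>2 * \<phi> (f i (x J)))
      \<le> (\<Sum>J\<in>D. (F J)\<^sup>2 * \<phi> (x J)) + 2 * \<epsilon> + 2 * e + 2 * sqrt (8 * \<epsilon> / p i)"
    using lc l1 by (simp add: sum.distrib)
qed

end

section \<open>Contraction over packings when no common invariant measure exists\<close>

definition admissible :: "real \<Rightarrow> (circle set \<Rightarrow> real) \<Rightarrow> bool" where
  "admissible \<delta> F \<longleftrightarrow> (\<forall>J. 0 \<le> F J) \<and> (\<forall>J. \<not> small_set \<delta> J \<longrightarrow> F J = 0) \<and>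
    (\<forall>D. packing \<delta> D \<longrightarrow> (\<Sum>J\<in>D. (F J)\<^sup>2) \<le> 1)"

context circle_system
begin

text \<open>If every scale \<open>\<delta>\<close> and every \<open>q < 1\<close> failed,
  near-extremal functions would exist on packings with \<open>\<delta> k\<close> tending to 0. Their
  normalised squares, placed at sample points, are almost invariant probability measures, and a weak
  limit is a forbidden invariant one.\<close>

lemma packing_contraction:
  assumes no_inv: "\<not> (\<exists>m. common_invariant N f m)"
  shows "\<exists>\<delta>>0. \<exists>q. 0 < q \<and> q < 1 \<and>
    (\<forall>F D. admissible \<delta> F \<longrightarrow> packing \<delta> D \<longrightarrow> (\<Sum>J\<in>D. (T F J)\<^sup>2) \<le> q\<^sup>2)"
proof (rule ccontr)
  assume "\<not> ?thesis"
  then have neg: "\<exists>F D. admissible \<delta> F \<and> packing \<delta> D \<and> q\<^sup>2 < (\<Sum>J\<in>D. (T F J)\<^sup>2)"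
    if "0 < \<delta>" "0 < q" "q < 1" for \<delta> q
    using that by (meson not_less)
  \<comment> \<open>The offset 3 gives \<open>\<epsilon> k \<le> 1 / 3\<close> and thus total weight
    \<open>S k \<ge> 1 / 3\<close>, so normalising costs at most a factor 3.\<close>
  define \<epsilon> where "\<epsilon> k = 1 / (real k + 3)" for k :: nat
  define \<delta> where "\<delta> k = 1 / (real k + 1)" for k :: nat
  have \<epsilon>: "0 < \<epsilon> k" "\<epsilon> k \<le> 1 / 3" for k by (auto simp: \<epsilon>_def field_simps)
  have "\<exists>F D. admissible (\<delta> k) F \<and> packing (\<delta> k) D \<and> 1 - \<epsilon> k < (\<Sum>J\<in>D. (T F J)\<^sup>2)" for k
  proof -
    have "0 < sqrt (1 - \<epsilon> k)" "sqrt (1 - \<epsilon> k) < 1" "0 < \<delta> k" "(sqrt (1 - \<epsilon> k))\<^sup>2 = 1 - \<epsilon> k"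
      using \<epsilon>[of k] by (auto simp: \<delta>_def)
    with neg[of "\<delta> k" "sqrt (1 - \<epsilon> k)"] show ?thesis by simp
  qed
  then obtain F D where adm: "\<And>k. admissible (\<delta> k) (F k)" and D: "\<And>k. packing (\<delta> k) (D k)"
    and big: "\<And>k. 1 - \<epsilon> k < (\<Sum>J\<in>D k. (T (F k) J)\<^sup>2)"
    by metis
  have F0: "0 \<le> F k J" and Fs: "\<not> small_set (\<delta> k) J \<Longrightarrow> F k J = 0"
    and Fb: "packing (\<delta> k) D' \<Longrightarrow> (\<Sum>J\<in>D'. (F k J)\<^sup>2) \<le> 1" for k J D'
    using adm[of k] unfolding admissible_def by blast+
  define x where "x J = (SOME z. z \<in> J)" for J :: "circle set"
  have x: "x J \<in> J" if "J \<in> D k" for k J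
  proof -
    have "J \<noteq> {}" using D[of k] that by (simp add: packing_def small_set_def)
    then show ?thesis unfolding x_def by (rule some_in_eq[THEN iffD2])
  qed
  define S where "S k = (\<Sum>J\<in>D k. (F k J)\<^sup>2)" for k
  define \<rho> where "\<rho> k = distr (point_measure (D k) (\<lambda>J. ennreal ((F k J)\<^sup>2 / S k))) borel x" for k
  have S: "1 / 3 \<le> S k" for k
  proof -
    have "1 - 2 * \<epsilon> k \<le> S k"
      unfolding S_def
      by (rule almost_invariance(1)[where x=x and \<phi>="\<lambda>_. 0" and e=1, OF D F0 Fs Fb big N_pos x]) auto
    then show ?thesis using \<epsilon>[of k] by linarith
  qed
  have fin: "finite (D k)" for k using D by (simp add: packing_def)
  have \<rho>: "prob_space (\<rho> k)" for k
  proof -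
    have "(\<Sum>J\<in>D k. (F k J)\<^sup>2 / S k) = 1"
      using S[of k] by (simp add: S_def flip: sum_divide_distrib)
    then have "(\<Sum>J\<in>D k. ennreal ((F k J)\<^sup>2 / S k)) = 1"
      using S[of k] by (subst sum_ennreal) auto
    then show ?thesis
      unfolding \<rho>_def using fin
      by (intro prob_space.prob_space_distr prob_space_point_measure) auto
  qed
  have int: "integral\<^sup>L (\<rho> k) \<phi> = (\<Sum>J\<in>D k. (F k J)\<^sup>2 * \<phi> (x J)) / S k" if "\<phi> \<in> borel_measurable borel" for \<phi> k
    unfolding \<rho>_def using that fin[of k] S[of k]
    by (subst integral_distr)
       (auto simp: lebesgue_integral_point_measure_finite sum_divide_distrib)
  have "\<exists>m. common_invariant N f m"
  proof (rule common_invariant_from_limit[of \<rho>])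
    fix i and \<phi> :: "circle \<Rightarrow> real" and e :: real
    assume i: "i < N" and \<phi>: "continuous_on UNIV \<phi>" and b: "\<And>x. 0 \<le> \<phi> x \<and> \<phi> x \<le> (1::real)" and e: "0 < e"
    obtain d where d: "0 < d" "\<And>z w. dist z w < d \<Longrightarrow> dist (\<phi> z) (\<phi> w) < e / 12"
    proof (rule uniformly_continuous_onE)
      show "uniformly_continuous_on UNIV \<phi>"
        by (rule compact_uniformly_continuous[OF \<phi> compact_UNIV_circle])
      show "0 < e / 12" using e by simp
    qed blast
    \<comment> \<open>Error budget: the terms with \<open>\<epsilon> k\<close> stay below
      \<open>e / 6\<close>, the oscillation contributes \<open>2 * (e / 12)\<close>, and the sum
      \<open>e / 3\<close> is at most \<open>e * S k\<close>.\<close>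
    have "(\<lambda>k. 3 * (2 * \<epsilon> k + 2 * sqrt (8 * \<epsilon> k / p i))) \<longlonglongrightarrow> 3 * (2 * 0 + 2 * sqrt (8 * 0 / p i))"
      unfolding \<epsilon>_def using p_pos[OF i]
      by (intro tendsto_intros) (auto, real_asymp+)
    then have "eventually (\<lambda>k. 3 * (2 * \<epsilon> k + 2 * sqrt (8 * \<epsilon> k / p i)) < e / 2) sequentially"
      using e by (intro order_tendstoD) auto
    moreover have "\<delta> \<longlonglongrightarrow> 0" unfolding \<delta>_def by real_asymp
    then have "eventually (\<lambda>k. \<delta> k < d) sequentially" using d(1) by (rule order_tendstoD)
    ultimately show "eventually (\<lambda>k. (\<integral>x. \<phi> (f i x) \<partial>\<rho> k) \<le> integral\<^sup>L (\<rho> k) \<phi> + e) sequentially"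
    proof eventually_elim
      case (elim k)
      have "(\<Sum>J\<in>D k. (F k J)\<^sup>2 * \<phi> (f i (x J)))
        \<le> (\<Sum>J\<in>D k. (F k J)\<^sup>2 * \<phi> (x J)) + 2 * \<epsilon> k + 2 * (e / 12) + 2 * sqrt (8 * \<epsilon> k / p i)"
      proof (rule almost_invariance(2)[OF D F0 Fs Fb big i x b])
        fix z w :: circle assume "dist z w \<le> \<delta> k"
        then show "\<bar>\<phi> z - \<phi> w\<bar> < e / 12" using d(2)[of z w] elim by (simp add: dist_real_def)
      qed (use e in auto)
      also have "\<dots> \<le> (\<Sum>J\<in>D k. (F k J)\<^sup>2 * \<phi> (x J)) + e / 3"
        using elim by simp
      also have "\<dots> \<le> (\<Sum>J\<in>D k. (F k J)\<^sup>2 * \<phi> (x J)) + e * S k"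
        using S[of k] e by (simp add: field_simps)
      finally have "(\<Sum>J\<in>D k. (F k J)\<^sup>2 * \<phi> (f i (x J))) / S k \<le> (\<Sum>J\<in>D k. (F k J)\<^sup>2 * \<phi> (x J)) / S k + e"
        using S[of k] by (simp add: field_simps)
      moreover have "(\<lambda>x. \<phi> (f i x)) \<in> borel_measurable borel" "\<phi> \<in> borel_measurable borel"
        by (auto intro!: borel_measurable_continuous_onI \<phi> continuous_on_compose2[OF \<phi> cont_f[OF i]])
      ultimately show ?case by (simp add: int)
    qed
  qed (simp_all add: \<rho> cont_f, simp add: \<rho>_def)
  then show False using no_inv by blast
qed

section \<open>Iterates of the lazy operator, and the walk killed on leaving the small sets\<close>

lemma lazy_op_mono:
  assumes "\<And>x. \<phi> x \<le> \<psi> x"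
  shows "lazy_op N p F \<phi> x \<le> lazy_op N p F \<psi> x"
  unfolding lazy_op_def
  by (intro add_mono divide_right_mono sum_mono mult_left_mono) (use assms p_pos in \<open>auto simp: less_imp_le\<close>)

lemma lazy_op_affine: "lazy_op N p F (\<lambda>x. c + d * \<phi> x) x = c + d * lazy_op N p F \<phi> x"
proof -
  have "(\<Sum>i<N. p i * (c + d * \<phi> (F i x))) = (\<Sum>i<N. p i) * c + d * (\<Sum>i<N. p i * \<phi> (F i x))"
    by (simp add: distrib_left sum.distrib sum_distrib_right sum_distrib_left mult_ac)
  then show ?thesis unfolding lazy_op_def p_sum by (simp add: field_simps)
qed

lemma lazy_op_scale: "lazy_op N p F (\<lambda>x. d * \<phi> x) x = d * lazy_op N p F \<phi> x"
  using lazy_op_affine[of F 0 d \<phi> x] by simp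

lemma lazy_op_const: "lazy_op N p F (\<lambda>x. c) x = c"
  using lazy_op_affine[of F c 0 "\<lambda>_. 0" x] by simp

lemma lazy_pow_mono:
  assumes "\<And>x. \<phi> x \<le> \<psi> x"
  shows "(lazy_op N p F ^^ n) \<phi> x \<le> (lazy_op N p F ^^ n) \<psi> x"
  by (induction n arbitrary: x) (auto intro: lazy_op_mono assms)

lemma lazy_pow_affine: "(lazy_op N p F ^^ n) (\<lambda>x. c + d * \<phi> x) x = c + d * (lazy_op N p F ^^ n) \<phi> x"
proof -
  have "(lazy_op N p F ^^ n) (\<lambda>x. c + d * \<phi> x) = (\<lambda>x. c + d * (lazy_op N p F ^^ n) \<phi> x)"
    by (induction n) (auto simp: lazy_op_affine intro!: ext)
  then show ?thesis by simp
qed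

lemma lazy_pow_bounds:
  assumes "\<And>x. c \<le> \<phi> x \<and> \<phi> x \<le> d"
  shows "c \<le> (lazy_op N p F ^^ n) \<phi> x \<and> (lazy_op N p F ^^ n) \<phi> x \<le> d"
proof -
  have "(lazy_op N p F ^^ n) (\<lambda>_. c) x \<le> (lazy_op N p F ^^ n) \<phi> x"
    "(lazy_op N p F ^^ n) \<phi> x \<le> (lazy_op N p F ^^ n) (\<lambda>_. d) x"
    using assms by (auto intro: lazy_pow_mono)
  moreover have "(lazy_op N p F ^^ n) (\<lambda>_. c) x = c" for c
    using lazy_pow_affine[where d=0 and c=c] by simp
  ultimately show ?thesis by simp
qed

text \<open>Expected square root of the length of the image after \<open>n\<close> lazy steps, over
  paths along which the set stays small up to and including time \<open>n\<close>. Lengths of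
  disjoint sets add up to at most 1, so these square roots start in the unit ball described by
  \<open>admissible\<close>.\<close>

primrec killed :: "real \<Rightarrow> nat \<Rightarrow> circle set \<Rightarrow> real" where
  "killed \<delta> 0 J = (if small_set \<delta> J then sqrt (measure arclen J) else 0)"
| "killed \<delta> (Suc n) J = (if small_set \<delta> J then T (killed \<delta> n) J else 0)"

lemma killed_nonneg: "0 \<le> killed \<delta> n J"
proof (induction n arbitrary: J)
  case (Suc n)
  then show ?case by (auto simp: lazy_op_def intro!: add_nonneg_nonneg sum_nonneg mult_nonneg_nonneg less_imp_le[OF p_pos])
qed auto

lemma killed_not_small: "\<not> small_set \<delta> J \<Longrightarrow> killed \<delta> n J = 0"
  by (cases n) auto

lemma sum_arclen_packing_le:
  assumes "packing \<delta> D"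
  shows "(\<Sum>J\<in>D. measure arclen J) \<le> 1"
proof -
  interpret prob_space arclen by (rule prob_space_arclen)
  have "D \<subseteq> sets borel"
    using assms by (auto simp: packing_def small_set_def dest!: compact_imp_closed)
  then have "(\<Sum>J\<in>D. measure arclen J) = measure arclen (\<Union>D)"
    using finite_measure_finite_Union[of D id] assms
    by (auto simp: packing_def disjoint_family_on_def disjoint_def)
  then show ?thesis by simp
qed

text \<open>Divided by \<open>q ^ n\<close>, the function \<open>killed \<delta> n\<close> lies
  again in the unit ball, so the one-step contraction can be repeated.\<close>

lemma killed_square_sum:
  assumes q: "0 < q" and step: "\<And>F D. admissible \<delta> F \<Longrightarrow> packing \<delta> D \<Longrightarrow> (\<Sum>J\<in>D. (T F J)\<^sup>2) \<le> q\<^sup>2"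
    and "packing \<delta> D"
  shows "(\<Sum>J\<in>D. (killed \<delta> n J)\<^sup>2) \<le> (q ^ n)\<^sup>2"
  using assms(3)
proof (induction n arbitrary: D)
  case 0
  have "(\<Sum>J\<in>D. (killed \<delta> 0 J)\<^sup>2) = (\<Sum>J\<in>D. measure arclen J)"
    using 0 by (intro sum.cong) (auto simp: packing_def)
  then show ?case using sum_arclen_packing_le[OF 0] by simp
next
  case (Suc n)
  let ?F = "\<lambda>J. (1 / q ^ n) * killed \<delta> n J"
  have "T (killed \<delta> n) J = q ^ n * T ?F J" for J
    unfolding lazy_op_scale using q by simp
  then have "(\<Sum>J\<in>D. (killed \<delta> (Suc n) J)\<^sup>2) = (\<Sum>J\<in>D. (q ^ n * T ?F J)\<^sup>2)"
    using Suc.prems by (intro sum.cong) (auto simp: packing_def)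
  also have "\<dots> = (q ^ n)\<^sup>2 * (\<Sum>J\<in>D. (T ?F J)\<^sup>2)"
    by (simp add: power_mult_distrib sum_distrib_left)
  also have "\<dots> \<le> (q ^ n)\<^sup>2 * q\<^sup>2"
  proof (intro mult_left_mono step, unfold admissible_def, intro conjI allI impI)
    fix D' assume "packing \<delta> D'"
    have "(\<Sum>J\<in>D'. (?F J)\<^sup>2) = (\<Sum>J\<in>D'. (killed \<delta> n J)\<^sup>2) / (q ^ n)\<^sup>2"
      by (simp add: power_divide sum_divide_distrib)
    then show "(\<Sum>J\<in>D'. (?F J)\<^sup>2) \<le> 1"
      using Suc.IH[OF \<open>packing \<delta> D'\<close>] q by (simp add: divide_le_eq)
  qed (use q Suc.prems in \<open>auto simp: killed_nonneg killed_not_small\<close>)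
  finally show ?case by (simp add: power_mult_distrib mult_ac)
qed

lemma common_modulus:
  assumes "0 < e"
  shows "\<exists>d>0. \<forall>i<N. \<forall>x y. dist x y < d \<longrightarrow> dist (f i x) (f i y) < e"
proof -
  have "\<exists>d>0. \<forall>x y. dist x y < d \<longrightarrow> dist (f i x) (f i y) < e" if i: "i < N" for i
  proof -
    obtain d where "0 < d" "\<And>y x. y \<in> UNIV \<Longrightarrow> x \<in> UNIV \<Longrightarrow> dist x y < d \<Longrightarrow> dist (f i x) (f i y) < e"
      using compact_uniformly_continuous[OF cont_f[OF i] compact_UNIV_circle] assms
      by (rule uniformly_continuous_onE) blast
    then show ?thesis by auto
  qed
  then have "\<forall>i\<in>{..<N}. \<exists>d. 0 < d \<and> (\<forall>x y. dist x y < d \<longrightarrow> dist (f i x) (f i y) < e)"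
    by simp
  from bchoice[OF this] obtain d where
    d: "\<And>i. i < N \<Longrightarrow> 0 < d i \<and> (\<forall>x y. dist x y < d i \<longrightarrow> dist (f i x) (f i y) < e)"
    by auto
  have "0 < Min (d ` {..<N})" using d N_pos by (subst Min_gr_iff) auto
  moreover have "dist (f i x) (f i y) < e" if "i < N" "dist x y < Min (d ` {..<N})" for i x y
  proof -
    have "Min (d ` {..<N}) \<le> d i" using that(1) by auto
    then have "dist x y < d i" using that(2) by linarith
    then show ?thesis using d[OF that(1)] by simp
  qed
  ultimately show ?thesis by (intro exI[of _ "Min (d ` {..<N})"]) simp
qed

text \<open>The admissible \<open>d\<close> depends on \<open>n\<close>. In the summed potential
  this lemma handles finitely many leading terms, the geometric decay the rest.\<close>

lemma killed_small:
  assumes "0 < e"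
  shows "\<exists>d>0. \<forall>J. compact J \<longrightarrow> (\<forall>x\<in>J. \<forall>y\<in>J. dist x y < d) \<longrightarrow> killed \<delta> n J \<le> e"
  using assms
proof (induction n arbitrary: e)
  case 0
  \<comment> \<open>The value \<open>e\<^sup>2 / 4\<close> undoes the square root and the factor 4
    in \<open>arclen_le\<close>.\<close>
  have "killed \<delta> 0 J \<le> e" if J: "compact J" "\<forall>x\<in>J. \<forall>y\<in>J. dist x y < e\<^sup>2 / 4" for J
  proof -
    have "J \<in> sets borel" by (rule borel_closed[OF compact_imp_closed[OF J(1)]])
    then have "measure arclen J \<le> 4 * (e\<^sup>2 / 4)"
    proof (rule arclen_le)
      show "dist x y \<le> e\<^sup>2 / 4" if "x \<in> J" "y \<in> J" for x y
        using J(2) that by (simp add: less_imp_le)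
    qed auto
    then have "sqrt (measure arclen J) \<le> e"
      using 0 by (intro real_le_lsqrt) auto
    then show ?thesis using 0 by simp
  qed
  then show ?case using 0 by (intro exI[of _ "e\<^sup>2 / 4"]) auto
next
  case (Suc n)
  obtain d where d: "0 < d" "\<And>J. compact J \<Longrightarrow> (\<forall>x\<in>J. \<forall>y\<in>J. dist x y < d) \<Longrightarrow> killed \<delta> n J \<le> e"
    using Suc.IH[OF Suc.prems] by auto
  obtain d' where d': "0 < d'" "\<And>i x y. i < N \<Longrightarrow> dist x y < d' \<Longrightarrow> dist (f i x) (f i y) < d"
    using common_modulus[OF d(1)] by auto
  have "killed \<delta> (Suc n) J \<le> e" if J: "compact J" "\<forall>x\<in>J. \<forall>y\<in>J. dist x y < min d d'" for J
  proof -
    have "killed \<delta> n J \<le> e" using J by (intro d(2)) auto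
    moreover have "killed \<delta> n (f i ` J) \<le> e" if "i < N" for i
    proof (rule d(2))
      show "compact (f i ` J)"
        by (rule compact_continuous_image[OF continuous_on_subset[OF cont_f[OF that]] J(1)]) simp
      show "\<forall>x\<in>f i ` J. \<forall>y\<in>f i ` J. dist x y < d"
        using J(2) d'(2)[OF that] by simp
    qed
    then have "(\<Sum>i<N. p i * killed \<delta> n (f i ` J)) \<le> (\<Sum>i<N. p i * e)"
      by (intro sum_mono mult_left_mono) (auto simp: less_imp_le[OF p_pos])
    ultimately show ?thesis
      using Suc.prems by (simp add: lazy_op_def p_sum flip: sum_distrib_right)
  qed
  then show ?case using d(1) d'(1) by (intro exI[of _ "min d d'"]) auto
qed

end

section \<open>A contracting comparison function\<close>

context circle_system
begin

abbreviation L :: "(circle \<times> circle \<Rightarrow> real) \<Rightarrow> circle \<times> circle \<Rightarrow> real" where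
  "L \<equiv> lazy_op N p (\<lambda>i. map_prod (f i) (f i))"

text \<open>
  The potential \<open>G J = \<Sum>n. s ^ n * killed \<delta> n J\<close> with \<open>1 < s < 1 / q\<close>. The killed walk only leaves the
  small sets from sets on which \<open>G\<close> is bounded below, so truncating a multiple of \<open>G\<close> at \<open>1\<close>
  gives a contracted function.
\<close>

lemma contracting_set_function:
  assumes no_inv: "\<not> (\<exists>m. common_invariant N f m)"
  shows "\<exists>(H :: circle set \<Rightarrow> real) s. 1 < s \<and> (\<forall>J. 0 \<le> H J \<and> H J \<le> 1) \<and>
    (\<forall>J. compact J \<longrightarrow> connected J \<longrightarrow> H J < 1 \<longrightarrow> T H J \<le> H J / s) \<and>
    (\<forall>J x y. compact J \<longrightarrow> connected J \<longrightarrow> x \<in> J \<longrightarrow> y \<in> J \<longrightarrow> sqrt (dist x y) \<le> H J) \<and>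
    (\<forall>e>0. \<exists>d>0. \<forall>J. compact J \<longrightarrow> J \<noteq> {} \<longrightarrow> (\<forall>x\<in>J. \<forall>y\<in>J. dist x y < d) \<longrightarrow> H J \<le> e)"
proof -
  obtain \<delta> q where \<delta>: "0 < \<delta>" and q: "0 < q" "q < 1"
    and step: "\<And>F D. admissible \<delta> F \<Longrightarrow> packing \<delta> D \<Longrightarrow> (\<Sum>J\<in>D. (T F J)\<^sup>2) \<le> q\<^sup>2"
    using packing_contraction[OF no_inv] by auto
  \<comment> \<open>A single small set is a packing, so the mean square bound is also a pointwise
    one.\<close>
  have k_le: "killed \<delta> n J \<le> q ^ n" for n J
  proof (cases "small_set \<delta> J")
    case True
    then have "packing \<delta> {J}" by (simp add: packing_def)
    from killed_square_sum[OF q(1) step this] have "(killed \<delta> n J)\<^sup>2 \<le> (q ^ n)\<^sup>2" by simp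
    then show ?thesis using q by (simp add: power2_le_iff_abs_le)
  qed (use q in \<open>simp add: killed_not_small\<close>)
  define s where "s = (1 + 1 / q) / 2"
  have s: "1 < s" "0 \<le> s * q" "s * q < 1" using q by (auto simp: s_def field_simps)
  define G where "G J = (\<Sum>n. s ^ n * killed \<delta> n J)" for J
  have term_le: "s ^ n * killed \<delta> n J \<le> (s * q) ^ n" for n J
    using k_le[of n J] s by (simp add: power_mult_distrib mult_left_mono)
  have term_nonneg: "0 \<le> s ^ n * killed \<delta> n J" for n J
    using s by (simp add: killed_nonneg)
  have sgeo: "summable (\<lambda>n. (s * q) ^ n)" using s by (simp add: summable_geometric)
  have sG: "summable (\<lambda>n. s ^ n * killed \<delta> n J)" for J
    by (rule summable_comparison_test'[OF sgeo, of 0]) (use term_le term_nonneg in simp)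
  have G0: "0 \<le> G J" for J unfolding G_def by (intro suminf_nonneg sG term_nonneg)
  have G_rec: "G J = sqrt (measure arclen J) + s * T G J" if J: "small_set \<delta> J" for J
  proof -
    have 1: "(\<lambda>n. s ^ n * killed \<delta> n K) sums G K" for K
      unfolding G_def by (rule summable_sums[OF sG])
    have "(\<lambda>n. s ^ n * killed \<delta> n J / 2 + (\<Sum>i<N. p i * (s ^ n * killed \<delta> n (f i ` J))) / 2) sums T G J"
      unfolding lazy_op_def by (intro sums_add sums_divide sums_sum sums_mult 1)
    also have "(\<lambda>n. s ^ n * killed \<delta> n J / 2 + (\<Sum>i<N. p i * (s ^ n * killed \<delta> n (f i ` J))) / 2)
        = (\<lambda>n. s ^ n * killed \<delta> (Suc n) J)"
      using J by (auto simp: lazy_op_def distrib_left sum_distrib_left mult_ac intro!: ext)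
    finally have "(\<lambda>n. s * (s ^ n * killed \<delta> (Suc n) J)) sums (s * T G J)"
      by (rule sums_mult)
    then have "(\<lambda>n. s ^ Suc n * killed \<delta> (Suc n) J) sums (s * T G J)" by (simp add: mult_ac)
    then have "(\<lambda>n. s ^ n * killed \<delta> n J) sums (s * T G J + s ^ 0 * killed \<delta> 0 J)"
      by (subst (asm) sums_Suc_iff) (simp add: algebra_simps)
    then show ?thesis using sums_unique2[OF 1[of J]] J by simp
  qed
  have G_ge: "sqrt (measure arclen J) \<le> G J" if J: "small_set \<delta> J" for J
  proof -
    have "0 \<le> T G J"
      unfolding lazy_op_def by (intro add_nonneg_nonneg divide_nonneg_nonneg sum_nonneg mult_nonneg_nonneg)
        (auto simp: G0 less_imp_le[OF p_pos])
    then show ?thesis using G_rec[OF J] s by simp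
  qed
  obtain d where d: "0 < d" "\<And>i x y. i < N \<Longrightarrow> dist x y < d \<Longrightarrow> dist (f i x) (f i y) < \<delta>"
    using common_modulus[OF \<delta>] by auto
  \<comment> \<open>Since \<open>A * d \<ge> 1\<close>, the bound \<open>A * G J < 1\<close> forces
    the length of \<open>J\<close> below \<open>d\<close>, so all images of a connected
    \<open>J\<close> are still small. Since \<open>A \<ge> 1\<close>, the lower bound by the square
    root of the length survives.\<close>
  define A where "A = 1 + 1 / d"
  have A: "1 \<le> A" "1 \<le> A * d" using d(1) by (auto simp: A_def field_simps)
  define H where "H J = (if small_set \<delta> J then min 1 (A * G J) else 1)" for J
  have H01: "0 \<le> H J \<and> H J \<le> 1" for J using A G0[of J] by (simp add: H_def)
  have H_contr: "T H J \<le> H J / s" if J: "compact J" "connected J" "H J < 1" for J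
  proof -
    have sm: "small_set \<delta> J" and AG: "A * G J < 1" and HJ: "H J = A * G J"
      using J(3) by (auto simp: H_def min_def split: if_splits)
    have meas: "measure arclen J < d"
    proof -
      have "sqrt (measure arclen J) * 1 \<le> sqrt (measure arclen J) * (A * d)"
        using A(2) by (intro mult_left_mono) auto
      also have "\<dots> = A * sqrt (measure arclen J) * d" by simp
      also have "\<dots> \<le> A * G J * d"
        using G_ge[OF sm] A d(1) by (intro mult_right_mono mult_left_mono) auto
      also have "\<dots> < 1 * d" using AG d(1) by (rule mult_strict_right_mono)
      finally have 1: "sqrt (measure arclen J) < d" by simp
      \<comment> \<open>A length is at most 1, hence at most its own square root.\<close>
      have "measure arclen J \<le> 1"
        using prob_space.prob_le_1[OF prob_space_arclen] .
      then have "sqrt (measure arclen J) * sqrt (measure arclen J) \<le> sqrt (measure arclen J) * 1"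
        by (intro mult_left_mono) auto
      then show ?thesis using 1 by simp
    qed
    have sm': "small_set \<delta> (f i ` J)" if i: "i < N" for i
      unfolding small_set_def
    proof (intro conjI ballI)
      show "compact (f i ` J)"
        by (rule compact_continuous_image[OF continuous_on_subset[OF cont_f[OF i]] J(1)]) simp
      show "f i ` J \<noteq> {}" using sm by (simp add: small_set_def)
      fix x' y' assume "x' \<in> f i ` J" "y' \<in> f i ` J"
      then obtain x y where xy: "x \<in> J" "y \<in> J" "x' = f i x" "y' = f i y" by auto
      have "dist x y \<le> measure arclen J"
        by (rule dist_le_arclen[OF J(2) borel_closed[OF compact_imp_closed[OF J(1)]] xy(1,2)])
      then show "dist x' y' \<le> \<delta>" using d(2)[OF i, of x y] meas xy by simp
    qed
    have "T H J \<le> T (\<lambda>K. A * G K) J"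
    proof -
      have "H (f i ` J) \<le> A * G (f i ` J)" if "i < N" for i
        using sm'[OF that] by (simp add: H_def)
      then have "(\<Sum>i<N. p i * H (f i ` J)) \<le> (\<Sum>i<N. p i * (A * G (f i ` J)))"
        by (intro sum_mono mult_left_mono) (auto simp: less_imp_le[OF p_pos])
      then show ?thesis unfolding lazy_op_def HJ by simp
    qed
    also have "\<dots> = A * T G J" by (rule lazy_op_scale)
    also have "\<dots> \<le> A * (G J / s)"
    proof (rule mult_left_mono)
      have "s * T G J \<le> G J" using G_rec[OF sm] real_sqrt_ge_zero[OF measure_nonneg] by simp
      then show "T G J \<le> G J / s" using s(1) by (simp add: field_simps)
    qed (use A in simp)
    finally show ?thesis by (simp add: HJ)
  qed
  have H_ge: "sqrt (dist x y) \<le> H J" if J: "compact J" "connected J" "x \<in> J" "y \<in> J" for J x y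
  proof (cases "H J = 1")
    case True
    then show ?thesis using dist_circle_le_1 by simp
  next
    case False
    then have sm: "small_set \<delta> J" and HJ: "H J = A * G J"
      by (auto simp: H_def min_def split: if_splits)
    have "sqrt (dist x y) \<le> sqrt (measure arclen J)"
      by (intro real_sqrt_le_mono dist_le_arclen[OF J(2) borel_closed[OF compact_imp_closed[OF J(1)]] J(3,4)])
    also have "\<dots> \<le> G J" by (rule G_ge[OF sm])
    also have "\<dots> \<le> A * G J" using A(1) G0[of J] mult_right_mono[of 1 A "G J"] by simp
    finally show ?thesis by (simp add: HJ)
  qed
  have H_small: "\<exists>d>0. \<forall>J. compact J \<longrightarrow> J \<noteq> {} \<longrightarrow> (\<forall>x\<in>J. \<forall>y\<in>J. dist x y < d) \<longrightarrow> H J \<le> e" if e: "0 < e" for e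
  proof -
    \<comment> \<open>Head and tail of the series each receive half of the allowance
      \<open>e / A\<close>: \<open>m\<close> is chosen for the tail, then \<open>e'\<close> for the
      \<open>m\<close> leading terms.\<close>
    have "(\<lambda>n. (s * q) ^ n) \<longlonglongrightarrow> 0" using s by (intro LIMSEQ_realpow_zero) auto
    then have "(\<lambda>n. (s * q) ^ n / (1 - s * q)) \<longlonglongrightarrow> 0 / (1 - s * q)"
      using s by (intro tendsto_divide tendsto_const) auto
    then have "eventually (\<lambda>n. (s * q) ^ n / (1 - s * q) < e / (2 * A)) sequentially"
      using e A by (intro order_tendstoD) auto
    then obtain m where m: "(s * q) ^ m / (1 - s * q) < e / (2 * A)"
      by (auto simp: eventually_sequentially)
    define e' where "e' = e / (2 * A) / (1 + real m) / s ^ m"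
    have e': "0 < e'" using e A s by (simp add: e'_def)
    have "\<forall>n. \<exists>d. 0 < d \<and> (\<forall>J. compact J \<longrightarrow> (\<forall>x\<in>J. \<forall>y\<in>J. dist x y < d) \<longrightarrow> killed \<delta> n J \<le> e')"
      using killed_small[OF e'] by simp
    from choice[OF this] obtain c where
      "\<forall>n. 0 < c n \<and> (\<forall>J. compact J \<longrightarrow> (\<forall>x\<in>J. \<forall>y\<in>J. dist x y < c n) \<longrightarrow> killed \<delta> n J \<le> e')" ..
    then have c: "\<And>n. 0 < c n"
      "\<And>J n. compact J \<Longrightarrow> \<forall>x\<in>J. \<forall>y\<in>J. dist x y < c n \<Longrightarrow> killed \<delta> n J \<le> e'" by simp_all
    define c' where "c' = min \<delta> (Min (c ` {..m}))"
    have c': "0 < c'" using \<delta> c(1) by (simp add: c'_def)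
    have "H J \<le> e" if J: "compact J" "J \<noteq> {}" "\<forall>x\<in>J. \<forall>y\<in>J. dist x y < c'" for J
    proof -
      have sm: "small_set \<delta> J" using J unfolding small_set_def c'_def by (auto intro: less_imp_le)
      have head: "s ^ n * killed \<delta> n J \<le> s ^ m * e'" if n: "n < m" for n
      proof (rule mult_mono)
        have "c' \<le> c n" using n unfolding c'_def by (intro min.coboundedI2 Min_le) auto
        then show "killed \<delta> n J \<le> e'"
          using J by (intro c(2)[of J n]) (auto intro: less_le_trans)
        show "s ^ n \<le> s ^ m" using n s by (intro power_increasing) auto
      qed (use s killed_nonneg in auto)
      have "G J = (\<Sum>n. s ^ (n + m) * killed \<delta> (n + m) J) + (\<Sum>n<m. s ^ n * killed \<delta> n J)"
        unfolding G_def by (rule suminf_split_initial_segment[OF sG])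
      also have "(\<Sum>n. s ^ (n + m) * killed \<delta> (n + m) J) \<le> (\<Sum>n. (s * q) ^ m * (s * q) ^ n)"
      proof (intro suminf_le summable_ignore_initial_segment[OF sG] summable_mult sgeo)
        show "s ^ (n + m) * killed \<delta> (n + m) J \<le> (s * q) ^ m * (s * q) ^ n" for n
          using term_le[of "n + m" J] by (simp only: power_add mult.commute)
      qed
      also have "\<dots> = (s * q) ^ m / (1 - s * q)"
        using s by (simp add: suminf_mult sgeo suminf_geometric)
      also have "(\<Sum>n<m. s ^ n * killed \<delta> n J) \<le> (\<Sum>n<m. s ^ m * e')"
        using head by (intro sum_mono) auto
      also have "\<dots> \<le> (1 + real m) * (s ^ m * e')" using s e' by simp
      also have "(1 + real m) * (s ^ m * e') = e / (2 * A)"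
        proof -
          have "1 + real m \<noteq> 0" "s ^ m \<noteq> 0" using s by auto
          then show ?thesis by (simp add: e'_def)
        qed
      finally have "G J \<le> e / (2 * A) + e / (2 * A)" using m by linarith
      also have "\<dots> = e / A" by (simp add: field_simps)
      finally have "A * G J \<le> e" using A by (simp add: field_simps)
      then show ?thesis using sm by (simp add: H_def)
    qed
    then show ?thesis using c' by blast
  qed
  show ?thesis
    using s(1) H01 H_contr H_ge H_small by (intro exI[of _ H] exI[of _ s]) simp
qed

text \<open>\<open>D\<close> is the infimum of \<open>H\<close> over compact connected sets
  containing both points. The image of such a set is one for the image pair, so \<open>L D\<close>
  is at most \<open>T H\<close> on every competitor.\<close>

lemma exists_contracting_pair_function:
  assumes no_inv: "\<not> (\<exists>m. common_invariant N f m)"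
  shows "\<exists>(D :: circle \<times> circle \<Rightarrow> real) s. 1 < s \<and> (\<forall>z. 0 \<le> D z \<and> D z \<le> 1) \<and>
    (\<forall>z. L D z \<le> D z) \<and> (\<forall>z. D z < 1 \<longrightarrow> L D z \<le> D z / s) \<and>
    (\<forall>x y. sqrt (dist x y) \<le> D (x, y)) \<and> (\<forall>e>0. \<exists>d>0. \<forall>x y. dist x y < d \<longrightarrow> D (x, y) \<le> e)"
proof -
  obtain H :: "circle set \<Rightarrow> real" and s :: real where s: "1 < s" and "\<forall>J. 0 \<le> H J \<and> H J \<le> 1"
    and "\<forall>J. compact J \<longrightarrow> connected J \<longrightarrow> H J < 1 \<longrightarrow> T H J \<le> H J / s"
    and "\<forall>J x y. compact J \<longrightarrow> connected J \<longrightarrow> x \<in> J \<longrightarrow> y \<in> J \<longrightarrow> sqrt (dist x y) \<le> H J"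
    and "\<forall>e>0. \<exists>d>0. \<forall>J. compact J \<longrightarrow> J \<noteq> {} \<longrightarrow> (\<forall>x\<in>J. \<forall>y\<in>J. dist x y < d) \<longrightarrow> H J \<le> e"
    using contracting_set_function[OF no_inv] by (elim exE conjE) (rule that; assumption)
  then have H01: "\<And>J. 0 \<le> H J \<and> H J \<le> 1"
    and H_contr: "\<And>J. compact J \<Longrightarrow> connected J \<Longrightarrow> H J < 1 \<Longrightarrow> T H J \<le> H J / s"
    and H_ge: "\<And>J x y. compact J \<Longrightarrow> connected J \<Longrightarrow> x \<in> J \<Longrightarrow> y \<in> J \<Longrightarrow> sqrt (dist x y) \<le> H J"
    and H_small: "\<And>e. 0 < e \<Longrightarrow>
      \<exists>d>0. \<forall>J. compact J \<longrightarrow> J \<noteq> {} \<longrightarrow> (\<forall>x\<in>J. \<forall>y\<in>J. dist x y < d) \<longrightarrow> H J \<le> e"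
    by simp_all
  define \<J> where "\<J> z = {J. compact J \<and> connected J \<and> fst z \<in> J \<and> snd z \<in> J}" for z :: "circle \<times> circle"
  define D where "D z = (INF J\<in>\<J> z. H J)" for z
  have ne: "\<J> z \<noteq> {}" for z using exists_arc[of "fst z" "snd z"] unfolding \<J>_def by auto
  have bdd: "bdd_below (H ` \<J> z)" for z by (rule bdd_belowI[of _ 0]) (use H01 in auto)
  have D_le: "D z \<le> H J" if "J \<in> \<J> z" for z J
    unfolding D_def by (rule cINF_lower[OF bdd that])
  have D_ge: "c \<le> D z" if "\<And>J. J \<in> \<J> z \<Longrightarrow> c \<le> H J" for z c
    unfolding D_def by (rule cINF_greatest[OF ne that])
  have D0: "0 \<le> D z" for z using H01 by (intro D_ge) auto
  have D1: "D z \<le> 1" for z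
    using ne[of z] D_le[of _ z] H01 by (meson all_not_in_conv order_trans)
  have LD_TH: "L D z \<le> T H J" if J: "J \<in> \<J> z" for z J
  proof -
    have "D (map_prod (f i) (f i) z) \<le> H (f i ` J)" if i: "i < N" for i
    proof (rule D_le)
      have "continuous_on J (f i)" by (rule continuous_on_subset[OF cont_f[OF i]]) simp
      then show "f i ` J \<in> \<J> (map_prod (f i) (f i) z)"
        using J unfolding \<J>_def by (auto simp: compact_continuous_image connected_continuous_image)
    qed
    then have "(\<Sum>i<N. p i * D (map_prod (f i) (f i) z)) \<le> (\<Sum>i<N. p i * H (f i ` J))"
      by (intro sum_mono mult_left_mono) (auto simp: less_imp_le[OF p_pos])
    then show ?thesis unfolding lazy_op_def using D_le[OF J] by simp
  qed
  have LD_le_1: "L D z \<le> 1" for z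
    using lazy_op_mono[of D "\<lambda>_. 1"] D1 by (simp add: lazy_op_const)
  have contr: "L D z \<le> H J / s" if "J \<in> \<J> z" "H J < 1" for z J
    using LD_TH[OF that(1)] H_contr[of J] that unfolding \<J>_def by auto
  have "L D z \<le> D z" for z
  proof (rule D_ge)
    fix J assume J: "J \<in> \<J> z"
    show "L D z \<le> H J"
    proof (cases "H J < 1")
      case True
      have "1 * H J \<le> s * H J" using s H01[of J] by (intro mult_right_mono) auto
      then have "H J / s \<le> H J" using s by (simp add: field_simps)
      then show ?thesis using contr[OF J True] by simp
    next
      case False
      then show ?thesis using LD_le_1[of z] by simp
    qed
  qed
  moreover have "L D z \<le> D z / s" if z: "D z < 1" for z
  proof -
    obtain J0 where J0: "J0 \<in> \<J> z" "H J0 < 1"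
      using z D_ge[of z 1] by (meson not_less)
    \<comment> \<open>The infimum also runs over sets with \<open>H J = 1\<close>, on which
      \<open>H\<close> need not contract; for these the bound through \<open>J0\<close> suffices,
      because \<open>H J0 < 1\<close>.\<close>
    have "s * L D z \<le> D z"
    proof (rule D_ge)
      fix J assume J: "J \<in> \<J> z"
      show "s * L D z \<le> H J"
      proof (cases "H J < 1")
        case True
        then show ?thesis using contr[OF J True] s by (simp add: field_simps)
      next
        case False
        then show ?thesis using contr[OF J0] J0(2) s by (simp add: field_simps)
      qed
    qed
    then show ?thesis using s by (simp add: field_simps)
  qed
  moreover have "sqrt (dist x y) \<le> D (x, y)" for x y
    by (rule D_ge) (auto simp: \<J>_def intro: H_ge)
  moreover have "\<exists>d>0. \<forall>x y. dist x y < d \<longrightarrow> D (x, y) \<le> e" if e: "0 < e" for e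
  proof -
    from H_small[OF e] obtain d where d: "0 < d \<and>
      (\<forall>J. compact J \<longrightarrow> J \<noteq> {} \<longrightarrow> (\<forall>x\<in>J. \<forall>y\<in>J. dist x y < d) \<longrightarrow> H J \<le> e)" ..
    have "D (x, y) \<le> e" if xy: "dist x y < d" for x y
    proof -
      obtain J where J: "compact J" "connected J" "x \<in> J" "y \<in> J" "\<forall>z\<in>J. \<forall>w\<in>J. dist z w \<le> dist x y"
        using exists_arc[of x y] by auto
      have "D (x, y) \<le> H J" by (rule D_le) (use J in \<open>simp add: \<J>_def\<close>)
      also have "H J \<le> e"
      proof -
        have "dist z w < d" if "z \<in> J" "w \<in> J" for z w using J(5) xy that by fastforce
        then show ?thesis using d J by blast
      qed
      finally show ?thesis .
    qed
    then show ?thesis using d by blast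
  qed
  ultimately show ?thesis
    using s D0 D1 by (intro exI[of _ D] exI[of _ s]) simp
qed

section \<open>From one-step decrease to exponential contraction of a function on pairs\<close>

lemma lazy_pow_mono_time:
  assumes "\<And>z. lazy_op N p F \<phi> z \<le> \<phi> z" and "m \<le> n"
  shows "(lazy_op N p F ^^ n) \<phi> z \<le> (lazy_op N p F ^^ m) \<phi> z"
proof -
  have step: "(lazy_op N p F ^^ Suc k) \<phi> z \<le> (lazy_op N p F ^^ k) \<phi> z" for k z
    unfolding funpow_Suc_right comp_def by (rule lazy_pow_mono) (rule assms)
  show ?thesis
    using assms(2) by (induction n rule: dec_induct) (auto intro: order_trans[OF step] simp del: funpow.simps)
qed

text \<open>In each step the lazy walk follows the prescribed letter with probability at least
  \<open>c\<close>, hence the whole word with probability at least \<open>c ^ n\<close>; elsewhere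
  \<open>E\<close> is bounded by 1. Peeling off the last letter replaces \<open>E\<close> by
  \<open>L E\<close>, so the induction keeps \<open>E\<close> arbitrary.\<close>

lemma lazy_pow_word:
  assumes E: "\<And>z. 0 \<le> E z \<and> E z \<le> 1" and \<omega>: "\<And>k. \<omega> k < N" and c: "0 < c" "\<And>i. i < N \<Longrightarrow> c \<le> p i / 2"
  shows "(L ^^ n) E (x, y) \<le> 1 - c ^ n * (1 - E (orbit f \<omega> n x, orbit f \<omega> n y))"
  using E
proof (induction n arbitrary: E)
  case (Suc n)
  have LE: "0 \<le> L E z \<and> L E z \<le> 1" for z
    using lazy_pow_bounds[where c=0 and d=1 and n=1 and \<phi>=E and x=z] Suc.prems by simp
  have step: "c * (1 - E (map_prod (f i) (f i) z)) \<le> 1 - L E z" if i: "i < N" for i z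
  proof -
    let ?e = "\<lambda>j. 1 - E (map_prod (f j) (f j) z)"
    have "c * ?e i \<le> p i / 2 * ?e i"
      using c(2)[OF i] Suc.prems by (intro mult_right_mono) auto
    also have "\<dots> = p i * ?e i / 2" by simp
    also have "p i * ?e i \<le> (\<Sum>j<N. p j * ?e j)"
      by (rule member_le_sum[of i _ "\<lambda>j. p j * ?e j"])
         (use i Suc.prems in \<open>auto simp: less_imp_le[OF p_pos] intro!: mult_nonneg_nonneg\<close>)
    also have "(\<Sum>j<N. p j * ?e j) = 1 - (\<Sum>j<N. p j * E (map_prod (f j) (f j) z))"
      by (simp add: right_diff_distrib sum_subtractf p_sum)
    finally have "c * ?e i \<le> (1 - (\<Sum>j<N. p j * E (map_prod (f j) (f j) z))) / 2" by simp
    moreover have "E z \<le> 1" using Suc.prems by simp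
    ultimately show ?thesis by (simp add: lazy_op_def field_simps)
  qed
  have "(L ^^ Suc n) E (x, y) = (L ^^ n) (L E) (x, y)"
    by (simp add: funpow_Suc_right del: funpow.simps)
  also have "\<dots> \<le> 1 - c ^ n * (1 - L E (orbit f \<omega> n x, orbit f \<omega> n y))"
    by (rule Suc.IH) (rule LE)
  also have "\<dots> \<le> 1 - c ^ n * (c * (1 - E (orbit f \<omega> (Suc n) x, orbit f \<omega> (Suc n) y)))"
    using step[OF \<omega>, of n "(orbit f \<omega> n x, orbit f \<omega> n y)"] c(1)
    by (intro diff_left_mono mult_left_mono) auto
  finally show ?case by (simp add: mult_ac)
qed simp

lemma continuous_orbit:
  assumes "\<And>k. \<omega> k < N"
  shows "continuous_on UNIV (orbit f \<omega> n)"
proof (induction n)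
  case 0
  then show ?case by (simp add: continuous_on_id[unfolded id_def])
next
  case (Suc n)
  then show ?case
    using continuous_on_compose2[OF cont_f[OF assms[of n]] Suc] by simp
qed

text \<open>One step is enough where \<open>D z < 1\<close>. Where \<open>D z = 1\<close>,
  proximality provides a word bringing the pair within \<open>d\<close>; being that close after a
  fixed word is an open condition, so by compactness of the set of pairs finitely many words suffice
  and the gain is uniform.\<close>

lemma pair_function_eventually_contracts:
  assumes prox: "proximal N f" and s: "1 < s" and D: "\<And>z. 0 \<le> D z \<and> D z \<le> 1"
    and LD: "\<And>z. L D z \<le> D z" and LD': "\<And>z. D z < 1 \<Longrightarrow> L D z \<le> D z / s"
    and d: "0 < d" "\<And>x y. dist x y < d \<Longrightarrow> D (x, y) \<le> 1 / 2"
  shows "\<exists>k>0. \<exists>r. 0 < r \<and> r < 1 \<and> (\<forall>z. (L ^^ k) D z \<le> r * D z)"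
proof -
  define c where "c = Min (p ` {..<N}) / 2"
  have c: "0 < c" "\<And>i. i < N \<Longrightarrow> c \<le> p i / 2"
  proof -
    have "0 < Min (p ` {..<N})" using N_pos p_pos by (subst Min_gr_iff) auto
    then show "0 < c" by (simp add: c_def)
    show "c \<le> p i / 2" if "i < N" for i using that by (simp add: c_def)
  qed
  have c1: "c \<le> 1" using c(2)[OF N_pos] p_le_1[OF N_pos] by simp
  define I where "I = (UNIV :: nat set) \<times> {\<omega>. \<forall>k::nat. \<omega> k < N}"
  define U where "U a = {z. dist (orbit f (snd a) (fst a) (fst z)) (orbit f (snd a) (fst a) (snd z)) < d}"
    for a :: "nat \<times> (nat \<Rightarrow> nat)"
  have oU: "open (U a)" if "a \<in> I" for a
  proof -
    have *: "continuous_on UNIV (orbit f (snd a) (fst a))"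
      using that by (intro continuous_orbit) (auto simp: I_def)
    have "continuous_on UNIV (\<lambda>z. orbit f (snd a) (fst a) (fst z))"
      "continuous_on UNIV (\<lambda>z. orbit f (snd a) (fst a) (snd z))"
      by (rule continuous_on_compose2[OF *]; auto intro: continuous_on_fst continuous_on_snd continuous_on_id)+
    then show ?thesis
      unfolding U_def by (intro open_Collect_less continuous_on_dist continuous_on_const)
  qed
  have cov: "(UNIV :: (circle \<times> circle) set) \<subseteq> \<Union> (U ` I)"
  proof
    fix z :: "circle \<times> circle"
    obtain \<omega> r where \<omega>: "\<forall>k. \<omega> k < N"
      and lim: "(\<lambda>k. dist (orbit f \<omega> (r k) (fst z)) (orbit f \<omega> (r k) (snd z))) \<longlonglongrightarrow> 0"
      using prox unfolding proximal_def by meson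
    have "eventually (\<lambda>k. dist (orbit f \<omega> (r k) (fst z)) (orbit f \<omega> (r k) (snd z)) < d) sequentially"
      using lim d(1) by (rule order_tendstoD)
    then obtain k where "dist (orbit f \<omega> (r k) (fst z)) (orbit f \<omega> (r k) (snd z)) < d"
      by (auto simp: eventually_sequentially)
    then have "z \<in> U (r k, \<omega>)" "(r k, \<omega>) \<in> I" using \<omega> by (auto simp: U_def I_def)
    then show "z \<in> \<Union> (U ` I)" by blast
  qed
  have "compact (UNIV :: (circle \<times> circle) set)"
    using compact_Times[OF compact_UNIV_circle compact_UNIV_circle] by simp
  then obtain C where C: "C \<subseteq> I" "finite C" "UNIV \<subseteq> \<Union> (U ` C)"
    using compactE_image[OF _ oU cov] by metis
  \<comment> \<open>\<open>Suc\<close> guarantees at least one step, as the region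
    \<open>D z < 1\<close> requires, even if all chosen times are 0.\<close>
  define k where "k = Suc (Max (insert 0 (fst ` C)))"
  have LkD: "(L ^^ k) D z \<le> 1 - c ^ k / 2" for z
  proof -
    have "z \<in> \<Union> (U ` C)" using C(3) by (rule subsetD) simp
    then obtain a where a: "a \<in> C" "z \<in> U a" by (rule UN_E)
    obtain n \<omega> where n: "a = (n, \<omega>)" by (cases a)
    have \<omega>: "\<omega> k < N" for k using a C(1) n by (auto simp: I_def)
    have nk: "n \<le> k" unfolding k_def using C(2) a n by (intro le_SucI Max_ge) (auto intro: rev_image_eqI)
    have "(L ^^ k) D z \<le> (L ^^ n) D z" by (rule lazy_pow_mono_time[OF LD nk])
    also have "\<dots> \<le> 1 - c ^ n * (1 - D (orbit f \<omega> n (fst z), orbit f \<omega> n (snd z)))"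
      using lazy_pow_word[where \<omega>=\<omega> and x="fst z" and y="snd z", OF D \<omega> c] by simp
    also have "\<dots> \<le> 1 - c ^ k * (1 / 2)"
    proof (intro diff_left_mono mult_mono)
      show "c ^ k \<le> c ^ n" using nk c c1 by (intro power_decreasing) auto
      show "1 / 2 \<le> 1 - D (orbit f \<omega> n (fst z), orbit f \<omega> n (snd z))"
        using d(2) a(2) n by (force simp: U_def)
    qed (use c in auto)
    finally show ?thesis by simp
  qed
  define r where "r = max (1 / s) (1 - c ^ k / 2)"
  have r: "0 < r" "r < 1" using s c by (auto simp: r_def less_max_iff_disj)
  have "(L ^^ k) D z \<le> r * D z" for z
  proof (cases "D z < 1")
    case True
    have "(L ^^ k) D z \<le> (L ^^ 1) D z" by (rule lazy_pow_mono_time[OF LD]) (simp add: k_def)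
    also have "\<dots> \<le> 1 / s * D z" using LD'[OF True] by simp
    also have "\<dots> \<le> r * D z" using D by (intro mult_right_mono) (auto simp: r_def)
    finally show ?thesis .
  next
    case False
    then have "D z = 1" using D[of z] by simp
    then show ?thesis using LkD[of z] by (simp add: r_def)
  qed
  then show ?thesis using r by (intro exI[of _ k] conjI exI[of _ r]) (auto simp: k_def)
qed

text \<open>The exponential decay of \<open>D\<close> is passed on to a power of \<open>D\<close>,
  with the exponent adapted to \<open>\<alpha>\<close>.\<close>

theorem contraction_on_average:
  assumes no_inv: "\<not> (\<exists>m. common_invariant N f m)" and prox: "proximal N f" and \<alpha>: "0 < \<alpha>"
  shows "\<exists>(E :: circle \<times> circle \<Rightarrow> real) C \<kappa>. 0 \<le> C \<and> 0 < \<kappa> \<and> \<kappa> < 1 \<and> (\<forall>z. 0 \<le> E z \<and> E z \<le> 1) \<and>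
    (\<forall>x y. dist x y powr \<alpha> \<le> E (x, y)) \<and> (\<forall>n z. (L ^^ n) E z \<le> C * \<kappa> ^ n * E z)"
proof -
  obtain D :: "circle \<times> circle \<Rightarrow> real" and s :: real where s: "1 < s" and "\<forall>z. 0 \<le> D z \<and> D z \<le> 1"
    and "\<forall>z. L D z \<le> D z" and "\<forall>z. D z < 1 \<longrightarrow> L D z \<le> D z / s"
    and "\<forall>x y. sqrt (dist x y) \<le> D (x, y)" and near: "\<forall>e>0. \<exists>d>0. \<forall>x y. dist x y < d \<longrightarrow> D (x, y) \<le> e"
    using exists_contracting_pair_function[OF no_inv] by (elim exE conjE) (rule that; assumption)
  then have D: "\<And>z. 0 \<le> D z \<and> D z \<le> 1" and LD: "\<And>z. L D z \<le> D z"
    and LD': "\<And>z. D z < 1 \<Longrightarrow> L D z \<le> D z / s" and D_ge: "\<And>x y. sqrt (dist x y) \<le> D (x, y)"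
    by (simp_all del: split_paired_All)
  have "\<exists>d>0. \<forall>x y. dist x y < d \<longrightarrow> D (x, y) \<le> 1 / 2"
    by (rule near[rule_format]) simp
  then obtain d where d: "0 < d \<and> (\<forall>x y. dist x y < d \<longrightarrow> D (x, y) \<le> 1 / 2)" ..
  have "\<exists>k>0. \<exists>r. 0 < r \<and> r < 1 \<and> (\<forall>z. (L ^^ k) D z \<le> r * D z)"
    by (rule pair_function_eventually_contracts[OF prox s D LD LD', of d]) (use d in auto)
  then obtain k r where k: "0 < k" and r: "0 < r" "r < 1" and Lk: "\<And>z. (L ^^ k) D z \<le> r * D z" by auto
  define t where "t = r powr (1 / real k)"
  have t: "0 < t" "t < 1" using r k powr_less_mono2[of "1 / real k" r 1] by (simp_all add: t_def)
  have tk: "t ^ k = r" using r k by (simp add: t_def powr_realpow[symmetric] powr_powr)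
  have LnD: "(L ^^ n) D z \<le> t ^ n / r * D z" for n z
  proof -
    have m: "(L ^^ (k * m)) D z \<le> r ^ m * D z" for m z
    proof (induction m arbitrary: z)
      case (Suc m)
      have "(L ^^ (k * Suc m)) D z = (L ^^ k) ((L ^^ (k * m)) D) z"
        by (simp add: funpow_add)
      also have "\<dots> \<le> (L ^^ k) (\<lambda>z. 0 + r ^ m * D z) z" by (rule lazy_pow_mono) (simp add: Suc.IH)
      also have "\<dots> = r ^ m * (L ^^ k) D z" by (subst lazy_pow_affine) simp
      also have "\<dots> \<le> r ^ m * (r * D z)" using r Lk by (intro mult_left_mono) auto
      finally show ?case by (simp add: mult_ac)
    qed simp
    \<comment> \<open>Whole blocks of length \<open>k\<close> gain a factor \<open>r\<close> each;
      the incomplete last block costs the factor \<open>1 / r\<close>.\<close>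
    let ?m = "n div k"
    have "(L ^^ n) D z \<le> (L ^^ (k * ?m)) D z" by (rule lazy_pow_mono_time[OF LD]) simp
    also have "\<dots> \<le> r ^ ?m * D z" by (rule m)
    also have "r ^ ?m = t ^ (k * ?m + k) / r" using r by (simp add: power_add power_mult tk)
    also have "t ^ (k * ?m + k) \<le> t ^ n"
    proof (rule power_decreasing)
      show "n \<le> k * ?m + k" using k
        by (metis add_le_cancel_left less_imp_le mod_less_divisor mult_div_mod_eq)
    qed (use t in auto)
    finally show ?thesis using r D[of z] by (simp add: divide_right_mono mult_right_mono)
  qed
  \<comment> \<open>At most \<open>2 * \<alpha>\<close>, because \<open>D\<close> dominates only the
    square root of the distance; at most 1, so that the power is concave and can be
    averaged.\<close>
  define \<beta> where "\<beta> = min 1 (2 * \<alpha>)"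
  have \<beta>: "0 < \<beta>" "\<beta> \<le> 1" "\<beta> \<le> 2 * \<alpha>" using \<alpha> by (auto simp: \<beta>_def)
  define E where "E z = D z powr \<beta>" for z
  define \<kappa> where "\<kappa> = t powr \<beta>"
  have \<kappa>: "0 < \<kappa>" "\<kappa> < 1" using t \<beta> powr_less_mono2[of \<beta> t 1] by (simp_all add: \<kappa>_def)
  have E01: "0 \<le> E z \<and> E z \<le> 1" for z using powr_mono2[of \<beta> "D z" 1] D[of z] \<beta> by (simp add: E_def)
  \<comment> \<open>Concavity in the form
    \<open>w powr \<beta> \<le> a powr \<beta> * (1 + w / a)\<close> for any scale
    \<open>a > 0\<close>; the right side is affine in \<open>w\<close> and thus commutes with
    averaging.\<close>
  have split: "(L ^^ n) E z \<le> a powr \<beta> * (1 + (L ^^ n) D z / a)" if a: "0 < a" for a n z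
  proof -
    have "E w \<le> a powr \<beta> + a powr \<beta> / a * D w" for w
    proof (cases "D w \<le> a")
      case True
      then have "E w \<le> a powr \<beta>" unfolding E_def using D \<beta> by (intro powr_mono2) auto
      moreover have "0 \<le> a powr \<beta> / a * D w" using D a by simp
      ultimately show ?thesis by linarith
    next
      case False
      then have Dw: "0 < D w" using a by simp
      have "E w = D w powr (\<beta> - 1) * D w" using Dw by (simp add: E_def powr_diff)
      also have "D w powr (\<beta> - 1) \<le> a powr (\<beta> - 1)"
        using False a \<beta> by (intro powr_mono2') auto
      also have "a powr (\<beta> - 1) = a powr \<beta> / a" using a by (simp add: powr_diff)
      finally have "E w \<le> a powr \<beta> / a * D w" using Dw by (simp add: mult_right_mono)
      then show ?thesis by (simp add: add_increasing)
    qed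
    then have "(L ^^ n) E z \<le> (L ^^ n) (\<lambda>w. a powr \<beta> + a powr \<beta> / a * D w) z"
      by (rule lazy_pow_mono)
    also have "\<dots> = a powr \<beta> + a powr \<beta> / a * (L ^^ n) D z" by (rule lazy_pow_affine)
    finally show ?thesis by (simp add: algebra_simps)
  qed
  have LnE: "(L ^^ n) E z \<le> (1 + 1 / r) * \<kappa> ^ n * E z" for n z
  proof (cases "D z = 0")
    case True
    \<comment> \<open>The average of \<open>D\<close> is at most 0 here, so the scale may be chosen
      with \<open>a powr \<beta> = e\<close> for arbitrary \<open>e\<close>.\<close>
    have "(L ^^ n) E z \<le> 0 + e" if e: "0 < e" for e
    proof -
      have "(L ^^ n) D z \<le> 0" using LnD[of n z] True by simp
      moreover have pos: "0 < e powr (1 / \<beta>)" using e by simp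
      ultimately have "(L ^^ n) D z / e powr (1 / \<beta>) \<le> 0" by (simp add: divide_nonpos_pos)
      then have "(e powr (1 / \<beta>)) powr \<beta> * (1 + (L ^^ n) D z / e powr (1 / \<beta>)) \<le> (e powr (1 / \<beta>)) powr \<beta> * 1"
        by (intro mult_left_mono) auto
      from order_trans[OF split[OF pos] this] show ?thesis using e \<beta> by (simp add: powr_powr)
    qed
    then have "(L ^^ n) E z \<le> 0" by (rule field_le_epsilon)
    then show ?thesis using True \<beta> by (simp add: E_def)
  next
    case False
    then have Dz: "0 < D z" using D[of z] by simp
    \<comment> \<open>The scale is the predicted decay of \<open>D\<close>, so the quotient in
      \<open>split\<close> is at most \<open>1 / r\<close>.\<close>
    define a where "a = t ^ n * D z"
    have a: "0 < a" using t Dz by (simp add: a_def)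
    have "(L ^^ n) D z / a \<le> 1 / r"
      using LnD[of n z] a r by (simp add: a_def field_simps)
    then have "a powr \<beta> * (1 + (L ^^ n) D z / a) \<le> a powr \<beta> * (1 + 1 / r)"
      by (intro mult_left_mono) auto
    moreover have "a powr \<beta> = \<kappa> ^ n * E z"
      using t Dz by (simp add: a_def \<kappa>_def E_def powr_mult powr_realpow[symmetric] powr_powr mult_ac)
    ultimately show ?thesis using split[OF a, of n z] by (simp add: mult_ac)
  qed
  have "dist x y powr \<alpha> \<le> E (x, y)" for x y
  proof -
    have "dist x y powr \<alpha> = sqrt (dist x y) powr (2 * \<alpha>)"
      by (simp add: powr_half_sqrt[symmetric] powr_powr)
    also have "\<dots> \<le> D (x, y) powr (2 * \<alpha>)" using D_ge \<alpha> by (intro powr_mono2) auto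
    also have "\<dots> \<le> E (x, y)" unfolding E_def using D \<beta> by (intro powr_mono') auto
    finally show ?thesis .
  qed
  then show ?thesis
    using \<kappa> E01 LnE r by (intro exI[of _ E] exI[of _ "1 + 1 / r"] exI[of _ \<kappa>]) simp
qed

end

section \<open>The Poisson equation\<close>

text \<open>
  \<open>E\<close> is a comparison function contracted on average; the functions that are Lipschitz with respect to
  it form an algebra in which the Poisson equation of the walk can be solved.
\<close>

locale contracting_walk = circle_system N p f for N p f +
  fixes \<mu> :: "nat measure" and \<nu> :: "circle measure"
    and E :: "circle \<times> circle \<Rightarrow> real" and C \<kappa> :: real
  assumes mu: "nondegenerate_prob N \<mu>" and p_eq: "\<And>i. p i = measure \<mu> {i}"
    and nu: "stationary N f \<mu> \<nu>"
    and C_nonneg: "0 \<le> C" and kappa: "0 < \<kappa>" "\<kappa> < 1"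
    and E_bounds: "\<And>z. 0 \<le> E z \<and> E z \<le> 1"
    and E_contr: "\<And>n z. (L ^^ n) E z \<le> C * \<kappa> ^ n * E z"
begin

text \<open>Transition operator of the walk itself; the lazy operator is the mean of the identity
  and \<open>P\<close>.\<close>

definition P :: "(circle \<Rightarrow> real) \<Rightarrow> circle \<Rightarrow> real" where
  "P \<phi> x = (\<Sum>i<N. p i * \<phi> (f i x))"

text \<open>Continuity is a separate requirement because \<open>E\<close> is not assumed to be
  continuous or to vanish on the diagonal.\<close>

definition regular :: "(circle \<Rightarrow> real) \<Rightarrow> bool" where
  "regular \<phi> \<longleftrightarrow> continuous_on UNIV \<phi> \<and> (\<exists>B\<ge>0. \<forall>x y. \<bar>\<phi> x - \<phi> y\<bar> \<le> B * E (x, y))"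

sublocale \<nu>: prob_space \<nu>
  using nu by (simp add: stationary_def borel_prob_def)

lemma sets_nu [measurable_cong, simp]: "sets \<nu> = sets borel"
  using nu by (simp add: stationary_def borel_prob_def)

lemma space_nu [simp]: "space \<nu> = UNIV"
  using sets_eq_imp_space_eq[OF sets_nu] by simp

lemma measure_nu_UNIV [simp]: "measure \<nu> UNIV = 1"
  using \<nu>.prob_space by simp

lemma continuous_bounded:
  assumes "continuous_on UNIV (\<phi> :: circle \<Rightarrow> real)"
  shows "\<exists>B\<ge>0. \<forall>x. \<bar>\<phi> x\<bar> \<le> B"
proof -
  have "bounded (\<phi> ` UNIV)"
    by (intro compact_imp_bounded compact_continuous_image assms compact_UNIV_circle)
  then obtain b where "\<And>x. norm (\<phi> x) \<le> b" unfolding bounded_iff by auto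
  then show ?thesis by (intro exI[of _ b]) (auto intro: order_trans[OF abs_ge_zero, of "\<phi> undefined"])
qed

lemma continuous_measurable: "continuous_on UNIV \<phi> \<Longrightarrow> \<phi> \<in> borel_measurable borel"
  by (rule borel_measurable_continuous_onI)

lemma f_measurable [measurable]: "i < N \<Longrightarrow> f i \<in> borel_measurable borel"
  by (intro borel_measurable_continuous_onI cont_f)

lemma continuous_integrable_nu:
  fixes \<phi> :: "circle \<Rightarrow> real"
  assumes "continuous_on UNIV \<phi>"
  shows "integrable \<nu> \<phi>"
proof -
  obtain B where "\<And>x. \<bar>\<phi> x\<bar> \<le> B" using continuous_bounded[OF assms] by auto
  then show ?thesis
    using continuous_measurable[OF assms] by (intro \<nu>.integrable_const_bound[where B=B]) auto
qed

lemma continuous_comp_f: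
  assumes "i < N" "continuous_on UNIV \<phi>"
  shows "continuous_on UNIV (\<lambda>x. \<phi> (f i x))"
  by (rule continuous_on_compose2[OF assms(2) cont_f[OF assms(1)]]) auto

lemma continuous_P: "continuous_on UNIV \<phi> \<Longrightarrow> continuous_on UNIV (P \<phi>)"
  unfolding P_def by (intro continuous_intros continuous_comp_f) auto

lemma sets_mu: "sets \<mu> = Pow {..<N}"
  using mu by (simp add: nondegenerate_prob_def)

lemma space_mu [simp]: "space \<mu> = {..<N}"
proof
  show "space \<mu> \<subseteq> {..<N}" using sets.top[of \<mu>] by (simp add: sets_mu)
  have "{..<N} \<in> sets \<mu>" by (simp add: sets_mu)
  then show "{..<N} \<subseteq> space \<mu>" by (rule sets.sets_into_space)
qed

sublocale \<mu>: prob_space \<mu>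
  using mu by (simp add: nondegenerate_prob_def)

sublocale seq: sequence_space \<mu> ..

lemma integral_mu:
  fixes g :: "nat \<Rightarrow> 'b::{banach,second_countable_topology}"
  shows "integral\<^sup>L \<mu> g = (\<Sum>i<N. p i *\<^sub>R g i)"
proof -
  have "integral\<^sup>L \<mu> g = (\<integral>j. (\<Sum>i<N. indicator {i} j *\<^sub>R g i) \<partial>\<mu>)"
  proof (rule Bochner_Integration.integral_cong[OF refl])
    fix j assume "j \<in> space \<mu>"
    then show "g j = (\<Sum>i<N. indicator {i} j *\<^sub>R g i)"
      by (subst sum.remove[of _ j]) (auto simp: indicator_def intro!: sum.neutral)
  qed
  also have "\<dots> = (\<Sum>i<N. \<integral>j. indicator {i} j *\<^sub>R g i \<partial>\<mu>)"
    by (intro Bochner_Integration.integral_sum integrable_scaleR_left)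
       (auto simp: sets_mu \<mu>.emeasure_eq_measure)
  also have "\<dots> = (\<Sum>i<N. p i *\<^sub>R g i)"
  proof (intro sum.cong refl)
    fix i assume "i \<in> {..<N}"
    then have i: "{i} \<in> sets \<mu>" by (simp add: sets_mu)
    then have "(\<integral>j. indicator {i} j *\<^sub>R g i \<partial>\<mu>) = (\<integral>j. indicator {i} j \<partial>\<mu>) *\<^sub>R g i"
      by (intro integral_scaleR_left) (auto simp: \<mu>.emeasure_eq_measure)
    moreover have "{i} \<inter> {..<N} = {i}" using \<open>i \<in> {..<N}\<close> by auto
    ultimately show "(\<integral>j. indicator {i} j *\<^sub>R g i \<partial>\<mu>) = p i *\<^sub>R g i"
      using i by (simp add: p_eq)
  qed
  finally show ?thesis .
qed

text \<open>\<open>\<mu>\<close> carries all subsets of a finite set, so measurability can be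
  checked letter by letter.\<close>

lemma measurable_select:
  assumes g: "g \<in> M \<rightarrow>\<^sub>M \<mu>" and h: "\<And>i. i < N \<Longrightarrow> h i \<in> M \<rightarrow>\<^sub>M M'"
  shows "(\<lambda>x. h (g x) x) \<in> M \<rightarrow>\<^sub>M M'"
proof (rule measurable_compose_countable'[where I="{..<N}"])
  have "sets \<mu> = sets (count_space {..<N})" by (simp add: sets_mu)
  then show "g \<in> M \<rightarrow>\<^sub>M count_space {..<N}" using g measurable_cong_sets[OF refl] by blast
qed (use h in auto)

text \<open>Stationarity is stated for measures of sets; it says that \<open>\<nu>\<close> is the law of one step of the
  walk started from \<open>\<nu>\<close>.\<close>

lemma integral_P_nu:
  assumes \<phi>: "continuous_on UNIV \<phi>"
  shows "integral\<^sup>L \<nu> (P \<phi>) = integral\<^sup>L \<nu> \<phi>"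
proof -
  interpret pr: pair_prob_space \<mu> \<nu> ..
  let ?F = "\<lambda>z. f (fst z) (snd z)"
  have F [measurable]: "?F \<in> \<mu> \<Otimes>\<^sub>M \<nu> \<rightarrow>\<^sub>M borel"
    by (rule measurable_select[where h="\<lambda>i z. f i (snd z)"])
       (auto intro!: measurable_compose[OF measurable_snd f_measurable] measurable_fst simp: measurable_cong_sets[OF sets_nu refl])
  have int: "(\<integral>x. g x \<partial>distr (\<mu> \<Otimes>\<^sub>M \<nu>) borel ?F) = (\<Sum>i<N. p i * (\<integral>x. g (f i x) \<partial>\<nu>))"
    if g [measurable]: "g \<in> borel_measurable borel" and b: "\<And>x. \<bar>g x\<bar> \<le> b" for g :: "circle \<Rightarrow> real" and b
  proof -
    have "(\<integral>x. g x \<partial>distr (\<mu> \<Otimes>\<^sub>M \<nu>) borel ?F) = (\<integral>z. g (f (fst z) (snd z)) \<partial>(\<mu> \<Otimes>\<^sub>M \<nu>))"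
      by (rule integral_distr) auto
    also have "\<dots> = (\<integral>i. (\<integral>x. g (f i x) \<partial>\<nu>) \<partial>\<mu>)"
      by (subst pr.integral_fst'[symmetric]) (auto intro!: pr.P.integrable_const_bound[where B=b] simp: b)
    finally show ?thesis by (simp add: integral_mu)
  qed
  have "distr (\<mu> \<Otimes>\<^sub>M \<nu>) borel ?F = \<nu>"
  proof (rule measure_eqI)
    fix A assume "A \<in> sets (distr (\<mu> \<Otimes>\<^sub>M \<nu>) borel ?F)"
    then have A [measurable]: "A \<in> sets borel" by simp
    interpret d: prob_space "distr (\<mu> \<Otimes>\<^sub>M \<nu>) borel ?F" by (rule pr.P.prob_space_distr[OF F])
    have "measure (distr (\<mu> \<Otimes>\<^sub>M \<nu>) borel ?F) A = (\<Sum>i<N. p i * (\<integral>x. indicator A (f i x) \<partial>\<nu>))"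
      using int[of "indicator A" 1] by simp
    also have "\<dots> = (\<Sum>i<N. measure \<mu> {i} * measure (distr \<nu> borel (f i)) A)"
    proof (intro sum.cong refl)
      fix i assume "i \<in> {..<N}"
      then have [measurable]: "f i \<in> \<nu> \<rightarrow>\<^sub>M borel"
        using f_measurable[of i] by (simp cong: measurable_cong_sets)
      have "(\<integral>x. (indicator A (f i x) :: real) \<partial>\<nu>) = (\<integral>x. indicator A x \<partial>distr \<nu> borel (f i))"
        by (subst integral_distr) auto
      then show "p i * (\<integral>x. indicator A (f i x) \<partial>\<nu>) = measure \<mu> {i} * measure (distr \<nu> borel (f i)) A"
        by (simp add: p_eq)
    qed
    also have "\<dots> = measure \<nu> A" using nu A by (simp add: stationary_def)
    finally show "emeasure (distr (\<mu> \<Otimes>\<^sub>M \<nu>) borel ?F) A = emeasure \<nu> A"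
      by (simp add: d.emeasure_eq_measure \<nu>.emeasure_eq_measure)
  qed simp
  moreover obtain B where B: "\<And>x. \<bar>\<phi> x\<bar> \<le> B" using continuous_bounded[OF \<phi>] by auto
  ultimately have "integral\<^sup>L \<nu> \<phi> = (\<Sum>i<N. p i * (\<integral>x. \<phi> (f i x) \<partial>\<nu>))"
    using int[OF continuous_measurable[OF \<phi>] B] by simp
  also have "\<dots> = integral\<^sup>L \<nu> (P \<phi>)"
    unfolding P_def using continuous_integrable_nu[OF continuous_comp_f[OF _ \<phi>]]
    by (subst Bochner_Integration.integral_sum) auto
  finally show ?thesis by simp
qed

lemma lazy_eq_P: "lazy_op N p f \<phi> x = \<phi> x / 2 + P \<phi> x / 2"
  by (simp add: lazy_op_def P_def)

lemma regular_continuous: "regular \<phi> \<Longrightarrow> continuous_on UNIV \<phi>"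
  by (simp add: regular_def)

lemma regular_const: "regular (\<lambda>_. c)"
  unfolding regular_def by (auto intro!: exI[of _ 0])

lemma regular_diff:
  assumes "regular \<phi>" "regular \<psi>"
  shows "regular (\<lambda>x. \<phi> x - \<psi> x)"
proof -
  obtain A B where AB: "0 \<le> A" "\<And>x y. \<bar>\<phi> x - \<phi> y\<bar> \<le> A * E (x, y)" "0 \<le> B" "\<And>x y. \<bar>\<psi> x - \<psi> y\<bar> \<le> B * E (x, y)"
    using assms unfolding regular_def by auto
  have "\<bar>\<phi> x - \<psi> x - (\<phi> y - \<psi> y)\<bar> \<le> (A + B) * E (x, y)" for x y
    using AB(2)[of x y] AB(4)[of x y] by (simp add: distrib_right)
  then show ?thesis
    using assms AB unfolding regular_def by (auto intro!: continuous_intros exI[of _ "A + B"])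
qed

lemma regular_mult:
  assumes "regular \<phi>" "regular \<psi>"
  shows "regular (\<lambda>x. \<phi> x * \<psi> x)"
proof -
  obtain A B where AB: "0 \<le> A" "\<And>x y. \<bar>\<phi> x - \<phi> y\<bar> \<le> A * E (x, y)" "0 \<le> B" "\<And>x y. \<bar>\<psi> x - \<psi> y\<bar> \<le> B * E (x, y)"
    using assms unfolding regular_def by auto
  obtain a b where ab: "0 \<le> a" "\<And>x. \<bar>\<phi> x\<bar> \<le> a" "0 \<le> b" "\<And>x. \<bar>\<psi> x\<bar> \<le> b"
    using continuous_bounded regular_continuous assms by metis
  have "\<bar>\<phi> x * \<psi> x - \<phi> y * \<psi> y\<bar> \<le> (a * B + b * A) * E (x, y)" for x y
  proof -
    have "\<phi> x * \<psi> x - \<phi> y * \<psi> y = \<phi> x * (\<psi> x - \<psi> y) + \<psi> y * (\<phi> x - \<phi> y)"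
      by (simp add: algebra_simps)
    also have "\<bar>\<dots>\<bar> \<le> \<bar>\<phi> x\<bar> * \<bar>\<psi> x - \<psi> y\<bar> + \<bar>\<psi> y\<bar> * \<bar>\<phi> x - \<phi> y\<bar>"
      by (metis abs_mult abs_triangle_ineq)
    also have "\<dots> \<le> a * (B * E (x, y)) + b * (A * E (x, y))"
      using ab AB by (intro add_mono mult_mono) auto
    finally show ?thesis by (simp add: algebra_simps)
  qed
  then show ?thesis
    using assms AB ab unfolding regular_def by (auto intro!: continuous_intros exI[of _ "a * B + b * A"])
qed

text \<open>Synchronous coupling: both points are moved by the same map.\<close>

lemma lazy_osc:
  assumes "\<And>x y. \<bar>\<phi> x - \<phi> y\<bar> \<le> F (x, y)"
  shows "\<bar>lazy_op N p f \<phi> x - lazy_op N p f \<phi> y\<bar> \<le> L F (x, y)"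
proof -
  have "lazy_op N p f \<phi> x - lazy_op N p f \<phi> y
      = (\<phi> x - \<phi> y) / 2 + (\<Sum>i<N. p i * (\<phi> (f i x) - \<phi> (f i y))) / 2"
    by (simp add: lazy_op_def right_diff_distrib sum_subtractf diff_divide_distrib)
  also have "\<bar>\<dots>\<bar> \<le> \<bar>\<phi> x - \<phi> y\<bar> / 2 + \<bar>\<Sum>i<N. p i * (\<phi> (f i x) - \<phi> (f i y))\<bar> / 2"
    using abs_triangle_ineq[of "(\<phi> x - \<phi> y) / 2" "(\<Sum>i<N. p i * (\<phi> (f i x) - \<phi> (f i y))) / 2"]
    by simp
  also have "\<dots> \<le> \<bar>\<phi> x - \<phi> y\<bar> / 2 + (\<Sum>i<N. \<bar>p i * (\<phi> (f i x) - \<phi> (f i y))\<bar>) / 2"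
    by (intro add_left_mono divide_right_mono sum_abs) simp
  also have "\<dots> \<le> F (x, y) / 2 + (\<Sum>i<N. p i * F (f i x, f i y)) / 2"
    using assms by (intro add_mono divide_right_mono sum_mono) (auto simp: abs_mult less_imp_le[OF p_pos] intro!: mult_left_mono)
  finally show ?thesis by (simp add: lazy_op_def)
qed

lemma lazy_pow_osc:
  assumes "\<And>x y. \<bar>\<phi> x - \<phi> y\<bar> \<le> B * E (x, y)" "0 \<le> B"
  shows "\<bar>(lazy_op N p f ^^ n) \<phi> x - (lazy_op N p f ^^ n) \<phi> y\<bar> \<le> B * C * \<kappa> ^ n * E (x, y)"
proof -
  have "\<bar>(lazy_op N p f ^^ n) \<phi> x - (lazy_op N p f ^^ n) \<phi> y\<bar> \<le> (L ^^ n) (\<lambda>z. 0 + B * E z) (x, y)"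
    using assms by (induction n arbitrary: x y) (auto intro: lazy_osc)
  also have "\<dots> = B * (L ^^ n) E (x, y)" by (subst lazy_pow_affine) simp
  also have "\<dots> \<le> B * (C * \<kappa> ^ n * E (x, y))" by (intro mult_left_mono E_contr assms)
  finally show ?thesis by (simp add: mult_ac)
qed

text \<open>The contraction is known for the lazy operator only; \<open>P\<close> is twice that
  operator minus the identity.\<close>

lemma regular_P:
  assumes "regular \<phi>"
  shows "regular (P \<phi>)"
proof -
  obtain B where B: "0 \<le> B" "\<And>x y. \<bar>\<phi> x - \<phi> y\<bar> \<le> B * E (x, y)"
    using assms unfolding regular_def by auto
  have "\<bar>P \<phi> x - P \<phi> y\<bar> \<le> (2 * (B * C * \<kappa>) + B) * E (x, y)" for x y
  proof -
    have "\<bar>lazy_op N p f \<phi> x - lazy_op N p f \<phi> y\<bar> \<le> B * C * \<kappa> * E (x, y)"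
      using lazy_pow_osc[OF B(2,1), where n=1] by simp
    moreover have "P \<phi> x - P \<phi> y = 2 * (lazy_op N p f \<phi> x - lazy_op N p f \<phi> y) - (\<phi> x - \<phi> y)"
      by (simp add: lazy_eq_P field_simps)
    ultimately show ?thesis using B(2)[of x y] by (simp add: distrib_right)
  qed
  then show ?thesis
    using assms B C_nonneg kappa unfolding regular_def
    by (auto intro!: continuous_P exI[of _ "2 * (B * C * \<kappa>) + B"])
qed

text \<open>Neumann series of the lazy operator: the iterates \<open>Q n\<close> approach the mean
  geometrically and uniformly, so the sum of \<open>Q n x - m\<close> is continuous and Lipschitz
  with respect to \<open>E\<close>. Identity minus the lazy operator is half of identity minus
  \<open>P\<close>, hence half of this sum solves the equation.\<close>

theorem poisson_equation:
  assumes "regular \<phi>"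
  shows "\<exists>u. regular u \<and> (\<forall>x. u x - P u x = \<phi> x - integral\<^sup>L \<nu> \<phi>)"
proof -
  obtain B where B: "0 \<le> B" "\<And>x y. \<bar>\<phi> x - \<phi> y\<bar> \<le> B * E (x, y)"
    using assms unfolding regular_def by auto
  define Q where "Q n = (lazy_op N p f ^^ n) \<phi>" for n
  define m where "m = integral\<^sup>L \<nu> \<phi>"
  define K where "K = B * C"
  have K: "0 \<le> K" using B C_nonneg by (simp add: K_def)
  have Qs: "Q (Suc n) = (\<lambda>x. Q n x / 2 + P (Q n) x / 2)" for n
    by (simp add: Q_def lazy_eq_P fun_eq_iff)
  have Qc: "continuous_on UNIV (Q n)" for n
  proof (induction n)
    case (Suc n)
    then show ?case unfolding Qs by (auto intro!: continuous_intros continuous_P)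
  qed (use assms in \<open>simp add: Q_def regular_def\<close>)
  have Qm: "integral\<^sup>L \<nu> (Q n) = m" for n
  proof (induction n)
    case (Suc n)
    have "integral\<^sup>L \<nu> (Q (Suc n)) = (\<integral>x. Q n x / 2 + P (Q n) x / 2 \<partial>\<nu>)"
      by (simp add: Qs)
    also have "\<dots> = integral\<^sup>L \<nu> (Q n) / 2 + integral\<^sup>L \<nu> (P (Q n)) / 2"
      using continuous_integrable_nu[OF Qc[of n]] continuous_integrable_nu[OF continuous_P[OF Qc[of n]]] by simp
    finally show ?case using Suc integral_P_nu[OF Qc[of n]] by simp
  qed (simp add: Q_def m_def)
  have osc: "\<bar>Q n x - Q n y\<bar> \<le> K * \<kappa> ^ n * E (x, y)" for n x y
    unfolding Q_def K_def by (rule lazy_pow_osc[OF B(2,1)])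
  have osc': "\<bar>Q n x - Q n y\<bar> \<le> K * \<kappa> ^ n" for n x y
  proof -
    have "K * \<kappa> ^ n * E (x, y) \<le> K * \<kappa> ^ n * 1"
      using K kappa E_bounds by (intro mult_left_mono) auto
    then show ?thesis using osc[of n x y] by simp
  qed
  \<comment> \<open>Every value lies within the oscillation of the mean, and stationarity keeps the
    mean of \<open>Q n\<close> equal to \<open>m\<close>.\<close>
  have bound: "\<bar>Q n x - m\<bar> \<le> K * \<kappa> ^ n" for n x
  proof -
    note int = continuous_integrable_nu[OF Qc[of n]]
    have "Q n x - m = (\<integral>y. Q n x - Q n y \<partial>\<nu>)"
      using int by (simp add: Qm \<nu>.prob_space)
    also have "\<bar>\<dots>\<bar> \<le> (\<integral>y. \<bar>Q n x - Q n y\<bar> \<partial>\<nu>)" by (rule integral_abs_bound)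
    also have "\<dots> \<le> (\<integral>y. K * \<kappa> ^ n \<partial>\<nu>)"
      using int osc' by (intro integral_mono) auto
    finally show ?thesis by (simp add: \<nu>.prob_space)
  qed
  have sK: "summable (\<lambda>n. K * \<kappa> ^ n)" using kappa by (intro summable_mult summable_geometric) auto
  have sQ: "summable (\<lambda>n. Q n x - m)" for x
    by (rule summable_comparison_test'[OF sK, of 0]) (use bound in simp)
  define g where "g x = (\<Sum>n. Q n x - m)" for x
  have gc: "continuous_on UNIV g"
  proof (rule uniform_limit_theorem)
    show "uniform_limit UNIV (\<lambda>n x. \<Sum>i<n. Q i x - m) g sequentially"
      unfolding g_def by (rule Weierstrass_m_test[OF _ sK]) (use bound in simp)
    show "\<forall>\<^sub>F n in sequentially. continuous_on UNIV (\<lambda>x. \<Sum>i<n. Q i x - m)"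
      by (intro always_eventually allI continuous_intros Qc)
  qed simp
  have gE: "\<bar>g x - g y\<bar> \<le> K / (1 - \<kappa>) * E (x, y)" for x y
  proof -
    have sE: "summable (\<lambda>n. K * E (x, y) * \<kappa> ^ n)" using kappa by (intro summable_mult summable_geometric) auto
    have le: "\<bar>Q n x - m - (Q n y - m)\<bar> \<le> K * E (x, y) * \<kappa> ^ n" for n
      using osc[of n x y] by (simp add: mult_ac)
    have sa: "summable (\<lambda>n. \<bar>Q n x - m - (Q n y - m)\<bar>)"
      by (rule summable_comparison_test'[OF sE, of 0]) (use le in simp)
    have "g x - g y = (\<Sum>n. Q n x - m - (Q n y - m))" unfolding g_def by (rule suminf_diff[OF sQ sQ])
    also have "\<bar>\<dots>\<bar> \<le> (\<Sum>n. \<bar>Q n x - m - (Q n y - m)\<bar>)" by (rule summable_rabs[OF sa])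
    also have "\<dots> \<le> (\<Sum>n. K * E (x, y) * \<kappa> ^ n)" by (rule suminf_le[OF le sa sE])
    also have "\<dots> = K * E (x, y) * (1 / (1 - \<kappa>))"
      using kappa by (subst suminf_mult) (auto simp: suminf_geometric summable_geometric)
    finally show ?thesis by simp
  qed
  \<comment> \<open>Applying the lazy operator shifts the series by one index, so only the term at
    time 0 remains.\<close>
  have eq: "g x - lazy_op N p f g x = \<phi> x - m" for x
  proof -
    have 1: "(\<lambda>n. Q n y - m) sums g y" for y unfolding g_def by (rule summable_sums[OF sQ])
    have "(\<lambda>n. (Q n x - m) / 2 + (\<Sum>i<N. p i * (Q n (f i x) - m)) / 2) sums lazy_op N p f g x"
      unfolding lazy_op_def by (intro sums_add sums_divide sums_sum sums_mult 1)
    also have "(\<lambda>n. (Q n x - m) / 2 + (\<Sum>i<N. p i * (Q n (f i x) - m)) / 2) = (\<lambda>n. Q (Suc n) x - m)"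
    proof
      fix n
      have "(\<Sum>i<N. p i * (Q n (f i x) - m)) = (\<Sum>i<N. p i * Q n (f i x)) - m"
        by (simp add: right_diff_distrib sum_subtractf p_sum flip: sum_distrib_right)
      then show "(Q n x - m) / 2 + (\<Sum>i<N. p i * (Q n (f i x) - m)) / 2 = Q (Suc n) x - m"
        by (simp add: Q_def lazy_op_def field_simps)
    qed
    finally have "(\<lambda>n. Q n x - m) sums (lazy_op N p f g x + (Q 0 x - m))"
      by (subst (asm) sums_Suc_iff)
    then have "g x = lazy_op N p f g x + (Q 0 x - m)" using 1 sums_unique2 by blast
    then show ?thesis by (simp add: Q_def)
  qed
  define K' where "K' = K / (1 - \<kappa>)"
  have K': "0 \<le> K'" using K kappa by (simp add: K'_def)
  have gE': "\<bar>g x - g y\<bar> \<le> K' * E (x, y)" for x y using gE by (simp add: K'_def)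
  have "regular (\<lambda>x. g x / 2)"
    unfolding regular_def
  proof (intro conjI exI[of _ "K' / 2"] allI)
    show "continuous_on UNIV (\<lambda>x. g x / 2)" by (intro continuous_intros gc) simp
    show "0 \<le> K' / 2" using K' by simp
    show "\<bar>g x / 2 - g y / 2\<bar> \<le> K' / 2 * E (x, y)" for x y
    proof -
      have "\<bar>g x / 2 - g y / 2\<bar> = \<bar>g x - g y\<bar> / 2" by (simp flip: diff_divide_distrib)
      then show ?thesis using gE'[of x y] by simp
    qed
  qed
  moreover have "g x / 2 - P (\<lambda>x. g x / 2) x = \<phi> x - m" for x
  proof -
    have "P (\<lambda>x. g x / 2) x = P g x / 2" by (simp add: P_def sum_divide_distrib)
    then show ?thesis using eq[of x] by (simp add: lazy_eq_P field_simps)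
  qed
  ultimately show ?thesis unfolding m_def by blast
qed

end

section \<open>Additive functionals of the walk\<close>

lemma orbit_case_nat: "orbit f (case_nat i \<omega>) (Suc n) x = orbit f \<omega> n (f i x)"
  by (induction n) auto

lemma orbit_comb_seq: "orbit f (comb_seq n \<omega> \<omega>') n x = orbit f \<omega> n x"
proof -
  have "k \<le> n \<Longrightarrow> orbit f (comb_seq n \<omega> \<omega>') k x = orbit f \<omega> k x" for k
    by (induction k) (auto simp: comb_seq_less)
  then show ?thesis by simp
qed

lemma orbit_add: "orbit f \<omega> (n + k) x = orbit f (\<lambda>j. \<omega> (n + j)) k (orbit f \<omega> n x)"
  by (induction k) auto

context contracting_walk
begin

text \<open>The weight sees the current point and the letter about to be applied, which covers
  martingale increments. The values may be real or complex, the latter for characteristic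
  functions.\<close>

definition addfun :: "(circle \<Rightarrow> nat \<Rightarrow> 'b::comm_monoid_add) \<Rightarrow> nat \<Rightarrow> circle \<Rightarrow> (nat \<Rightarrow> nat) \<Rightarrow> 'b" where
  "addfun w n x \<omega> = (\<Sum>k<n. w (orbit f \<omega> k x) (\<omega> k))"

lemma addfun_0 [simp]: "addfun w 0 x \<omega> = 0"
  by (simp add: addfun_def)

text \<open>First-step decomposition; inductions based on it keep the starting point
  arbitrary.\<close>

lemma addfun_case_nat: "addfun w (Suc n) x (case_nat i \<omega>) = w x i + addfun w n (f i x) \<omega>"
  unfolding addfun_def by (subst sum.lessThan_Suc_shift) (simp add: orbit_case_nat del: orbit.simps(2))

lemma addfun_add: "addfun w (n + m) x \<omega> = addfun w n x \<omega> + addfun w m (orbit f \<omega> n x) (\<lambda>j. \<omega> (n + j))"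
  by (induction m) (simp_all add: addfun_def orbit_add add.assoc)

lemma addfun_comb_seq_prefix:
  assumes "m \<le> n"
  shows "addfun w m x (comb_seq n \<omega> \<omega>') = addfun w m x \<omega>" "orbit f (comb_seq n \<omega> \<omega>') m x = orbit f \<omega> m x"
proof -
  have *: "k \<le> n \<Longrightarrow> orbit f (comb_seq n \<omega> \<omega>') k x = orbit f \<omega> k x" for k
    by (induction k) (auto simp: comb_seq_less)
  show "addfun w m x (comb_seq n \<omega> \<omega>') = addfun w m x \<omega>"
    unfolding addfun_def using assms by (intro sum.cong refl) (simp add: * comb_seq_less)
  show "orbit f (comb_seq n \<omega> \<omega>') m x = orbit f \<omega> m x" by (rule *[OF assms])
qed

abbreviation \<Omega> :: "(nat \<Rightarrow> nat) measure" where "\<Omega> \<equiv> bernoulli \<mu>"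

lemma space_Omega: "\<omega> \<in> space \<Omega> \<longleftrightarrow> (\<forall>k. \<omega> k < N)"
  by (auto simp: space_PiM PiE_iff)

lemma case_nat_space: "i < N \<Longrightarrow> \<omega> \<in> space \<Omega> \<Longrightarrow> case_nat i \<omega> \<in> space \<Omega>"
  by (auto simp: space_Omega split: nat.split)

lemma coord_measurable [measurable]: "(\<lambda>\<omega>. \<omega> k) \<in> \<Omega> \<rightarrow>\<^sub>M \<mu>"
  by (rule measurable_component_singleton) simp

lemma measurable_orbit_pair: "(\<lambda>z. orbit f (snd z) n (fst z)) \<in> borel \<Otimes>\<^sub>M \<Omega> \<rightarrow>\<^sub>M borel"
proof (induction n)
  case (Suc n)
  have "(\<lambda>z. f (snd z n) (orbit f (snd z) n (fst z))) \<in> borel \<Otimes>\<^sub>M \<Omega> \<rightarrow>\<^sub>M borel"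
    by (rule measurable_select[where h="\<lambda>i z. f i (orbit f (snd z) n (fst z))"])
       (auto intro: measurable_compose[OF measurable_snd coord_measurable] measurable_compose[OF Suc f_measurable])
  then show ?case by simp
qed simp

text \<open>The bound is uniform in point and letter, so sums of \<open>n\<close> terms are bounded
  by \<open>n * b\<close> and integrability is immediate.\<close>

definition admissible_weight :: "(circle \<Rightarrow> nat \<Rightarrow> 'b::real_normed_vector) \<Rightarrow> real \<Rightarrow> bool" where
  "admissible_weight w b \<longleftrightarrow> (\<forall>i<N. (\<lambda>x. w x i) \<in> borel_measurable borel \<and> (\<forall>x. norm (w x i) \<le> b))"

lemma admissible_weight_nonneg: "admissible_weight w b \<Longrightarrow> 0 \<le> b"
  using N_pos unfolding admissible_weight_def by (meson norm_ge_zero order_trans)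

text \<open>Joint measurability in start and sequence is required because the Markov property
  restarts the walk at a random point.\<close>

lemma measurable_addfun_pair:
  fixes w :: "circle \<Rightarrow> nat \<Rightarrow> 'b::{real_normed_vector, second_countable_topology}"
  assumes w: "admissible_weight w b"
  shows "(\<lambda>z. addfun w n (fst z) (snd z)) \<in> borel_measurable (borel \<Otimes>\<^sub>M \<Omega>)"
  unfolding addfun_def
proof (intro borel_measurable_sum)
  fix k
  have 1: "(\<lambda>z. snd z k) \<in> borel \<Otimes>\<^sub>M \<Omega> \<rightarrow>\<^sub>M \<mu>"
    by (rule measurable_compose[OF measurable_snd coord_measurable])
  have 2: "(\<lambda>z. w (orbit f (snd z) k (fst z)) i) \<in> borel_measurable (borel \<Otimes>\<^sub>M \<Omega>)" if "i < N" for i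
    by (rule measurable_compose[OF measurable_orbit_pair, of "\<lambda>x. w x i"])
       (use w that in \<open>simp add: admissible_weight_def\<close>)
  show "(\<lambda>z. w (orbit f (snd z) k (fst z)) (snd z k)) \<in> borel_measurable (borel \<Otimes>\<^sub>M \<Omega>)"
    by (rule measurable_select[where h="\<lambda>i z. w (orbit f (snd z) k (fst z)) i", OF 1 2])
qed

lemma measurable_addfun:
  fixes w :: "circle \<Rightarrow> nat \<Rightarrow> 'b::{real_normed_vector, second_countable_topology}"
  assumes w: "admissible_weight w b"
  shows "addfun w n x \<in> borel_measurable \<Omega>"
proof -
  have "(\<lambda>\<omega>. (x, \<omega>)) \<in> \<Omega> \<rightarrow>\<^sub>M borel \<Otimes>\<^sub>M \<Omega>" by (rule measurable_Pair1') simp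
  from measurable_compose[OF this measurable_addfun_pair[OF w]] show ?thesis by simp
qed

lemma measurable_orbit [measurable]: "(\<lambda>\<omega>. orbit f \<omega> n x) \<in> \<Omega> \<rightarrow>\<^sub>M borel"
proof -
  have "(\<lambda>\<omega>. (x, \<omega>)) \<in> \<Omega> \<rightarrow>\<^sub>M borel \<Otimes>\<^sub>M \<Omega>" by (rule measurable_Pair1') simp
  from measurable_compose[OF this measurable_orbit_pair] show ?thesis by simp
qed

lemma norm_addfun_le:
  assumes w: "admissible_weight w b" and \<omega>: "\<omega> \<in> space \<Omega>"
  shows "norm (addfun w n x \<omega>) \<le> real n * b"
proof -
  have "norm (addfun w n x \<omega>) \<le> (\<Sum>k<n. b)"
    unfolding addfun_def using w \<omega>
    by (intro sum_norm_le) (auto simp: admissible_weight_def space_Omega)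
  then show ?thesis by simp
qed

text \<open>An independent letter put in front of a Bernoulli sequence gives a Bernoulli sequence.
  With Fubini this is the conditioning on the first step that takes the place of conditional
  expectations.\<close>

lemma integral_front:
  fixes F :: "(nat \<Rightarrow> nat) \<Rightarrow> 'b::{banach,second_countable_topology}"
  assumes F [measurable]: "F \<in> borel_measurable \<Omega>" and b: "\<And>\<omega>. \<omega> \<in> space \<Omega> \<Longrightarrow> norm (F \<omega>) \<le> b"
  shows "integral\<^sup>L \<Omega> F = (\<Sum>i<N. p i *\<^sub>R (\<integral>\<omega>. F (case_nat i \<omega>) \<partial>\<Omega>))"
proof -
  interpret pr: pair_prob_space \<mu> \<Omega> ..
  have m: "(\<lambda>(s, \<omega>). case_nat s \<omega>) \<in> \<mu> \<Otimes>\<^sub>M \<Omega> \<rightarrow>\<^sub>M \<Omega>"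
    by measurable
  have "integral\<^sup>L \<Omega> F = integral\<^sup>L (distr (\<mu> \<Otimes>\<^sub>M \<Omega>) \<Omega> (\<lambda>(s, \<omega>). case_nat s \<omega>)) F"
    by (simp only: seq.PiM_iter)
  also have "\<dots> = (\<integral>z. F (case_nat (fst z) (snd z)) \<partial>(\<mu> \<Otimes>\<^sub>M \<Omega>))"
    using integral_distr[OF m F] by (simp add: case_prod_beta')
  also have "\<dots> = (\<integral>i. (\<integral>\<omega>. F (case_nat i \<omega>) \<partial>\<Omega>) \<partial>\<mu>)"
  proof (subst pr.integral_fst'[symmetric])
    show "integrable (\<mu> \<Otimes>\<^sub>M \<Omega>) (\<lambda>z. F (case_nat (fst z) (snd z)))"
    proof (rule pr.P.integrable_const_bound[where B=b])
      show "AE z in \<mu> \<Otimes>\<^sub>M \<Omega>. norm (F (case_nat (fst z) (snd z))) \<le> b"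
        using b case_nat_space by (intro AE_I2) (auto simp: space_pair_measure)
      show "(\<lambda>z. F (case_nat (fst z) (snd z))) \<in> borel_measurable (\<mu> \<Otimes>\<^sub>M \<Omega>)"
        using measurable_compose[OF m F] by (simp add: case_prod_beta')
    qed
  qed simp
  finally show ?thesis by (simp add: integral_mu)
qed

lemma case_nat_measurable: "i < N \<Longrightarrow> (\<lambda>\<omega>. case_nat i \<omega>) \<in> \<Omega> \<rightarrow>\<^sub>M \<Omega>"
  by (rule measurable_case_nat'[where f="\<lambda>_. i"]) auto

lemma prob_front:
  assumes Q: "{\<omega> \<in> space \<Omega>. Q \<omega>} \<in> sets \<Omega>"
  shows "measure \<Omega> {\<omega> \<in> space \<Omega>. Q \<omega>} = (\<Sum>i<N. p i * measure \<Omega> {\<omega> \<in> space \<Omega>. Q (case_nat i \<omega>)})"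
proof -
  let ?A = "{\<omega> \<in> space \<Omega>. Q \<omega>}"
  have "measure \<Omega> ?A = integral\<^sup>L \<Omega> (indicator ?A)"
    using Q sets.sets_into_space[OF Q] by (simp add: Int_absorb2)
  also have "\<dots> = (\<Sum>i<N. p i *\<^sub>R (\<integral>\<omega>. indicator ?A (case_nat i \<omega>) \<partial>\<Omega>))"
    by (rule integral_front[where b=1]) (use Q in \<open>auto simp: indicator_def\<close>)
  also have "\<dots> = (\<Sum>i<N. p i * measure \<Omega> {\<omega> \<in> space \<Omega>. Q (case_nat i \<omega>)})"
  proof (intro sum.cong refl)
    fix i assume "i \<in> {..<N}"
    then have i: "i < N" by simp
    have eq: "{\<omega> \<in> space \<Omega>. Q (case_nat i \<omega>)} = case_nat i -` ?A \<inter> space \<Omega>"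
      using case_nat_space[OF i] by auto
    then have s: "{\<omega> \<in> space \<Omega>. Q (case_nat i \<omega>)} \<in> sets \<Omega>"
      using measurable_sets[OF case_nat_measurable[OF i] Q] by simp
    have "(\<integral>\<omega>. indicator ?A (case_nat i \<omega>) \<partial>\<Omega>)
        = (\<integral>\<omega>. indicator {\<omega> \<in> space \<Omega>. Q (case_nat i \<omega>)} \<omega> \<partial>\<Omega> :: real)"
      by (rule Bochner_Integration.integral_cong) (use case_nat_space[OF i] in \<open>auto simp: indicator_def\<close>)
    then show "p i *\<^sub>R (\<integral>\<omega>. indicator ?A (case_nat i \<omega>) \<partial>\<Omega>)
        = p i * measure \<Omega> {\<omega> \<in> space \<Omega>. Q (case_nat i \<omega>)}"
      using s sets.sets_into_space[OF s] by (simp add: Int_absorb2)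
  qed
  finally show ?thesis .
qed

lemma integral_exp_addfun_Suc:
  fixes w :: "circle \<Rightarrow> nat \<Rightarrow> 'b::{real_normed_field,banach,second_countable_topology}"
  assumes w: "admissible_weight w b"
  shows "(\<integral>\<omega>. exp (addfun w (Suc n) x \<omega>) \<partial>\<Omega>)
    = (\<Sum>i<N. p i *\<^sub>R (exp (w x i) * (\<integral>\<omega>. exp (addfun w n (f i x) \<omega>) \<partial>\<Omega>)))"
proof -
  have m: "(\<lambda>\<omega>. exp (addfun w n x \<omega>)) \<in> borel_measurable \<Omega>" for n x
    by (rule measurable_compose[OF measurable_addfun[OF w]])
       (auto intro!: borel_measurable_continuous_onI continuous_on_exp continuous_on_id)
  have nb: "norm (exp (addfun w n x \<omega>)) \<le> exp (real n * b)" if "\<omega> \<in> space \<Omega>" for n x \<omega>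
    using norm_exp[of "addfun w n x \<omega>"] norm_addfun_le[OF w that, of n x]
    by (meson exp_le_cancel_iff order_trans)
  have "(\<integral>\<omega>. exp (addfun w (Suc n) x \<omega>) \<partial>\<Omega>) = (\<Sum>i<N. p i *\<^sub>R (\<integral>\<omega>. exp (addfun w (Suc n) x (case_nat i \<omega>)) \<partial>\<Omega>))"
    by (rule integral_front[OF m nb])
  also have "\<dots> = (\<Sum>i<N. p i *\<^sub>R (exp (w x i) * (\<integral>\<omega>. exp (addfun w n (f i x) \<omega>) \<partial>\<Omega>)))"
    by (intro sum.cong refl) (simp add: addfun_case_nat exp_add)
  finally show ?thesis .
qed

text \<open>Doob's maximal inequality for the nonnegative supermartingale
  \<open>exp (addfun w k x \<omega>)\<close>. Conditioning on the first letter rescales the level by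
  \<open>exp (w x i)\<close>, so the induction on the horizon keeps both \<open>a\<close> and
  \<open>x\<close> arbitrary.\<close>

lemma addfun_maximal_inequality:
  fixes w :: "circle \<Rightarrow> nat \<Rightarrow> real"
  assumes w: "admissible_weight w b" and le: "\<And>x. (\<Sum>i<N. p i * exp (w x i)) \<le> 1" and a: "0 < a"
  shows "measure \<Omega> {\<omega> \<in> space \<Omega>. \<exists>k\<le>n. a \<le> exp (addfun w k x \<omega>)} \<le> 1 / a"
  using a
proof (induction n arbitrary: x a)
  case 0
  show ?case
  proof (cases "a \<le> 1")
    case True
    then have "1 \<le> 1 / a" using 0 by (simp add: field_simps)
    then show ?thesis using seq.P.prob_le_1 order_trans by blast
  qed (use 0 in auto)
next
  case (Suc n)
  have meas: "{\<omega> \<in> space \<Omega>. \<exists>k\<le>n. a \<le> exp (addfun w k x \<omega>)} \<in> sets \<Omega>" for n x a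
    using measurable_addfun[OF w] by measurable
  show ?case
  proof (cases "a \<le> 1")
    case True
    then have "1 \<le> 1 / a" using Suc.prems by (simp add: field_simps)
    then show ?thesis using seq.P.prob_le_1 order_trans by blast
  next
    \<comment> \<open>Now \<open>a > 1\<close>, so the value \<open>exp 0 = 1\<close> at time 0
      cannot reach the level and the first letter can be split off.\<close>
    case False
    have "measure \<Omega> {\<omega> \<in> space \<Omega>. \<exists>k\<le>Suc n. a \<le> exp (addfun w k x \<omega>)}
        = (\<Sum>i<N. p i * measure \<Omega> {\<omega> \<in> space \<Omega>. \<exists>k\<le>Suc n. a \<le> exp (addfun w k x (case_nat i \<omega>))})"
      by (rule prob_front[OF meas])
    also have "\<dots> = (\<Sum>i<N. p i * measure \<Omega> {\<omega> \<in> space \<Omega>. \<exists>k\<le>n. a / exp (w x i) \<le> exp (addfun w k (f i x) \<omega>)})"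
    proof (intro sum.cong refl arg_cong2[where f="(*)"] arg_cong[where f="measure \<Omega>"] Collect_cong conj_cong)
      fix i \<omega>
      have "(\<exists>k\<le>Suc n. a \<le> exp (addfun w k x (case_nat i \<omega>)))
          \<longleftrightarrow> (\<exists>k\<le>n. a \<le> exp (addfun w (Suc k) x (case_nat i \<omega>)))"
      proof
        assume "\<exists>k\<le>Suc n. a \<le> exp (addfun w k x (case_nat i \<omega>))"
        then obtain k where k: "k \<le> Suc n" "a \<le> exp (addfun w k x (case_nat i \<omega>))" by auto
        then obtain j where "k = Suc j" using False by (cases k) auto
        then show "\<exists>k\<le>n. a \<le> exp (addfun w (Suc k) x (case_nat i \<omega>))" using k by auto
      qed auto
      also have "\<dots> \<longleftrightarrow> (\<exists>k\<le>n. a / exp (w x i) \<le> exp (addfun w k (f i x) \<omega>))"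
        by (simp add: addfun_case_nat exp_add field_simps)
      finally show "(\<exists>k\<le>Suc n. a \<le> exp (addfun w k x (case_nat i \<omega>)))
          \<longleftrightarrow> (\<exists>k\<le>n. a / exp (w x i) \<le> exp (addfun w k (f i x) \<omega>))" .
    qed
    also have "\<dots> \<le> (\<Sum>i<N. p i * (1 / (a / exp (w x i))))"
      using Suc.prems by (intro sum_mono mult_left_mono Suc.IH) (auto simp: less_imp_le[OF p_pos])
    also have "\<dots> = (\<Sum>i<N. p i * exp (w x i)) / a"
      by (simp add: sum_divide_distrib)
    also have "\<dots> \<le> 1 / a" using le Suc.prems by (intro divide_right_mono) auto
    finally show ?thesis .
  qed
qed

subsection \<open>The martingale of a solution of the Poisson equation\<close>

definition mg :: "(circle \<Rightarrow> real) \<Rightarrow> circle \<Rightarrow> nat \<Rightarrow> real" where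
  "mg u x i = u (f i x) - P u x"

text \<open>Conditional variance of the next increment given the current point; its
  \<open>\<nu>\<close>-mean will be the asymptotic variance.\<close>

definition qv :: "(circle \<Rightarrow> real) \<Rightarrow> circle \<Rightarrow> real" where
  "qv u x = (\<Sum>i<N. p i * (mg u x i)\<^sup>2)"

lemma sum_mg: "(\<Sum>i<N. p i * mg u x i) = 0"
  by (simp add: mg_def right_diff_distrib sum_subtractf P_def p_sum flip: sum_distrib_right)

lemma qv_nonneg: "0 \<le> qv u x"
  unfolding qv_def by (intro sum_nonneg mult_nonneg_nonneg) (auto simp: less_imp_le[OF p_pos])

text \<open>Variance is the mean of the square minus the square of the mean, and regular functions
  are stable under products and \<open>P\<close>. Hence the Poisson equation and the strong law
  apply to \<open>qv u\<close> as well.\<close>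

lemma regular_qv:
  assumes "regular u"
  shows "regular (qv u)"
proof -
  have "qv u x = P (\<lambda>x. u x * u x) x - P u x * P u x" for x
  proof -
    have "p i * (mg u x i)\<^sup>2 = p i * (u (f i x) * u (f i x)) - 2 * P u x * (p i * u (f i x)) + P u x * P u x * p i" for i
      by (simp add: mg_def power2_eq_square algebra_simps)
    then have "qv u x = P (\<lambda>x. u x * u x) x - 2 * P u x * P u x + P u x * P u x * 1"
      unfolding qv_def by (simp add: sum.distrib sum_subtractf P_def p_sum flip: sum_distrib_left)
    then show ?thesis by simp
  qed
  then have "qv u = (\<lambda>x. P (\<lambda>x. u x * u x) x - P u x * P u x)" by auto
  then show ?thesis using assms by (simp add: regular_diff regular_mult regular_P)
qed

lemma P_bound:
  assumes "\<And>x. \<bar>\<phi> x\<bar> \<le> b"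
  shows "\<bar>P \<phi> x\<bar> \<le> b"
proof -
  have "\<bar>P \<phi> x\<bar> \<le> (\<Sum>i<N. \<bar>p i * \<phi> (f i x)\<bar>)" unfolding P_def by (rule sum_abs)
  also have "\<dots> \<le> (\<Sum>i<N. p i * b)"
    using assms by (intro sum_mono) (auto simp: abs_mult less_imp_le[OF p_pos] intro!: mult_left_mono)
  also have "\<dots> = b" by (simp add: p_sum flip: sum_distrib_right)
  finally show ?thesis .
qed

lemma admissible_mg:
  assumes "continuous_on UNIV u" "\<And>x. \<bar>u x\<bar> \<le> b"
  shows "admissible_weight (mg u) (2 * b)"
  unfolding admissible_weight_def
proof (intro allI impI conjI)
  fix i assume i: "i < N"
  have "continuous_on UNIV (\<lambda>x. mg u x i)"
    unfolding mg_def by (intro continuous_intros continuous_P continuous_comp_f assms i)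
  then show "(\<lambda>x. mg u x i) \<in> borel_measurable borel" by (rule continuous_measurable)
  show "norm (mg u x i) \<le> 2 * b" for x
    using assms(2)[of "f i x"] P_bound[where \<phi>=u and b=b and x=x, OF assms(2)] unfolding mg_def by simp
qed

text \<open>By the equation each increment is \<open>\<phi> - c\<close> at the current point plus
  the change of \<open>u\<close> along the step; the changes telescope to boundary terms.\<close>

lemma addfun_mg:
  assumes "\<And>x. u x - P u x = \<phi> x - c"
  shows "addfun (mg u) n x \<omega> = (\<Sum>k<n. \<phi> (orbit f \<omega> k x)) - real n * c + u (orbit f \<omega> n x) - u x"
proof (induction n)
  case (Suc n)
  have "addfun (mg u) (Suc n) x \<omega> = addfun (mg u) n x \<omega> + mg u (orbit f \<omega> n x) (\<omega> n)"
    by (simp add: addfun_def)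
  moreover have "mg u (orbit f \<omega> n x) (\<omega> n) = u (orbit f \<omega> (Suc n) x) - P u (orbit f \<omega> n x)"
    by (simp add: mg_def)
  ultimately show ?case using Suc assms[of "orbit f \<omega> n x"] by (simp add: algebra_simps)
qed simp

lemma integral_mg:
  assumes w: "admissible_weight (mg u) b"
  shows "(\<integral>\<omega>. addfun (mg u) n x \<omega> \<partial>\<Omega>) = 0"
proof (induction n arbitrary: x)
  case (Suc n)
  have int: "integrable \<Omega> (addfun (mg u) n y)" for y
    using norm_addfun_le[OF w, of _ n y] measurable_addfun[OF w]
    by (intro seq.P.integrable_const_bound[where B="real n * b"]) auto
  have "(\<integral>\<omega>. addfun (mg u) (Suc n) x \<omega> \<partial>\<Omega>)
      = (\<Sum>i<N. p i *\<^sub>R (\<integral>\<omega>. addfun (mg u) (Suc n) x (case_nat i \<omega>) \<partial>\<Omega>))"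
    using norm_addfun_le[OF w, of _ "Suc n" x] measurable_addfun[OF w]
    by (intro integral_front[where b="real (Suc n) * b"]) auto
  also have "\<dots> = (\<Sum>i<N. p i * mg u x i)"
    using int by (simp add: addfun_case_nat Suc seq.P.prob_space)
  finally show ?case by (simp add: sum_mg)
qed (simp add: addfun_def[abs_def])

text \<open>The cross term between the first increment and the rest contains the mean of a
  martingale started afresh, which is 0.\<close>

lemma integral_mg_square_Suc:
  assumes w: "admissible_weight (mg u) b"
  shows "(\<integral>\<omega>. (addfun (mg u) (Suc n) x \<omega>)\<^sup>2 \<partial>\<Omega>) = qv u x + P (\<lambda>y. \<integral>\<omega>. (addfun (mg u) n y \<omega>)\<^sup>2 \<partial>\<Omega>) x"
proof -
  have bd: "(addfun (mg u) n y \<omega>)\<^sup>2 \<le> (real n * b)\<^sup>2" if "\<omega> \<in> space \<Omega>" for n y \<omega>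
    using norm_addfun_le[OF w that, of n y] by (simp add: abs_le_square_iff[symmetric])
  have int: "integrable \<Omega> (addfun (mg u) n y)" for y
    using norm_addfun_le[OF w, of _ n y] measurable_addfun[OF w]
    by (intro seq.P.integrable_const_bound[where B="real n * b"]) auto
  have int2: "integrable \<Omega> (\<lambda>\<omega>. (addfun (mg u) n y \<omega>)\<^sup>2)" for y
    using bd[of _ n y] measurable_addfun[OF w]
    by (intro seq.P.integrable_const_bound[where B="(real n * b)\<^sup>2"]) auto
  have "(\<integral>\<omega>. (addfun (mg u) (Suc n) x \<omega>)\<^sup>2 \<partial>\<Omega>)
      = (\<Sum>i<N. p i *\<^sub>R (\<integral>\<omega>. (addfun (mg u) (Suc n) x (case_nat i \<omega>))\<^sup>2 \<partial>\<Omega>))"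
    using bd[of _ "Suc n" x] measurable_addfun[OF w]
    by (intro integral_front[where b="(real (Suc n) * b)\<^sup>2"]) auto
  also have "\<dots> = (\<Sum>i<N. p i * ((mg u x i)\<^sup>2 + (\<integral>\<omega>. (addfun (mg u) n (f i x) \<omega>)\<^sup>2 \<partial>\<Omega>)))"
  proof (intro sum.cong refl)
    fix i
    have "(\<integral>\<omega>. (addfun (mg u) (Suc n) x (case_nat i \<omega>))\<^sup>2 \<partial>\<Omega>)
        = (\<integral>\<omega>. (mg u x i)\<^sup>2 + 2 * mg u x i * addfun (mg u) n (f i x) \<omega> + (addfun (mg u) n (f i x) \<omega>)\<^sup>2 \<partial>\<Omega>)"
      by (simp add: addfun_case_nat power2_sum add_ac mult_ac)
    also have "\<dots> = (mg u x i)\<^sup>2 + (\<integral>\<omega>. (addfun (mg u) n (f i x) \<omega>)\<^sup>2 \<partial>\<Omega>)"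
      using int[of "f i x"] int2[of "f i x"] integral_mg[OF w, of n "f i x"] by (simp add: seq.P.prob_space)
    finally show "p i *\<^sub>R (\<integral>\<omega>. (addfun (mg u) (Suc n) x (case_nat i \<omega>))\<^sup>2 \<partial>\<Omega>)
        = p i * ((mg u x i)\<^sup>2 + (\<integral>\<omega>. (addfun (mg u) n (f i x) \<omega>)\<^sup>2 \<partial>\<Omega>))" by simp
  qed
  finally show ?thesis by (simp add: qv_def P_def distrib_left sum.distrib)
qed

text \<open>With \<open>v\<close> solving the Poisson equation for \<open>qv u\<close>, the second
  moment is exactly \<open>n\<close> times the mean of \<open>qv u\<close> plus
  \<open>v x - (P ^^ n) v x\<close>. The error is thus bounded uniformly in \<open>n\<close> and
  \<open>x\<close>.\<close>

lemma mg_second_moment: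
  assumes u: "regular u"
  shows "\<exists>K\<ge>0. \<forall>n x. \<bar>(\<integral>\<omega>. (addfun (mg u) n x \<omega>)\<^sup>2 \<partial>\<Omega>) - real n * integral\<^sup>L \<nu> (qv u)\<bar> \<le> K"
proof -
  obtain v where v: "regular v" "\<And>x. v x - P v x = qv u x - integral\<^sup>L \<nu> (qv u)"
    using poisson_equation[OF regular_qv[OF u]] by auto
  obtain b where w: "admissible_weight (mg u) b"
    using admissible_mg continuous_bounded[OF regular_continuous[OF u]] regular_continuous[OF u] by blast
  obtain B where B: "0 \<le> B" "\<And>x. \<bar>v x\<bar> \<le> B"
    using continuous_bounded[OF regular_continuous[OF v(1)]] by auto
  let ?c = "integral\<^sup>L \<nu> (qv u)"
  have eq: "(\<integral>\<omega>. (addfun (mg u) n x \<omega>)\<^sup>2 \<partial>\<Omega>) = real n * ?c + v x - (P ^^ n) v x" for n x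
  proof (induction n arbitrary: x)
    case (Suc n)
    have "P (\<lambda>y. real n * ?c + v y - (P ^^ n) v y) x = real n * ?c + P v x - P ((P ^^ n) v) x"
      by (simp add: P_def right_diff_distrib distrib_left sum.distrib sum_subtractf p_sum flip: sum_distrib_right)
    then show ?case
      unfolding integral_mg_square_Suc[OF w] Suc using v(2)[of x] by (simp add: algebra_simps)
  qed simp
  have Pn: "\<bar>(P ^^ n) v x\<bar> \<le> B" for n x
    by (induction n arbitrary: x) (auto intro: B P_bound)
  have "\<bar>(\<integral>\<omega>. (addfun (mg u) n x \<omega>)\<^sup>2 \<partial>\<Omega>) - real n * ?c\<bar> \<le> 2 * B" for n x
    unfolding eq using B(2)[of x] Pn[of n x] by linarith
  then show ?thesis using B(1) by (intro exI[of _ "2 * B"]) simp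
qed

end

section \<open>Exponential inequalities and the strong law\<close>

lemma exp_le_quadratic_cubic:
  fixes y :: real
  assumes "\<bar>y\<bar> \<le> 1"
  shows "exp y \<le> 1 + y + y\<^sup>2 / 2 + \<bar>y\<bar> ^ 3"
proof -
  obtain t where t: "\<bar>t\<bar> \<le> \<bar>y\<bar>" "exp y = (\<Sum>m<3. y ^ m / fact m) + exp t / fact 3 * y ^ 3"
    using Maclaurin_exp_le[of y 3] by blast
  have "exp t \<le> exp 1" using t(1) assms by simp
  then have et: "exp t \<le> 3" using exp_le by linarith
  have "exp t / fact 3 * y ^ 3 \<le> \<bar>exp t / fact 3 * y ^ 3\<bar>" by (rule abs_ge_self)
  also have "\<dots> = exp t / 6 * \<bar>y\<bar> ^ 3" by (simp add: abs_mult power_abs fact_numeral)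
  also have "\<dots> \<le> 1 * \<bar>y\<bar> ^ 3" using et by (intro mult_right_mono) auto
  finally show ?thesis unfolding t(2) by (simp add: numeral_eq_Suc fact_numeral)
qed

lemma abs_exp_diff_le:
  fixes a b c :: real
  assumes "a \<le> c" "b \<le> c"
  shows "\<bar>exp a - exp b\<bar> \<le> exp c * \<bar>a - b\<bar>"
proof -
  have *: "exp b - exp a \<le> exp c * (b - a)" if "a \<le> b" "b \<le> c" for a b :: real
  proof -
    have "1 + (a - b) \<le> exp (a - b)" by (rule exp_ge_add_one_self)
    then have "exp b * (1 + (a - b)) \<le> exp b * exp (a - b)" by (intro mult_left_mono) auto
    also have "\<dots> = exp a" by (simp flip: exp_add)
    finally have "exp b - exp a \<le> exp b * (b - a)" by (simp add: algebra_simps)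
    also have "\<dots> \<le> exp c * (b - a)" using that by (intro mult_right_mono) auto
    finally show ?thesis .
  qed
  show ?thesis
  proof (cases "a \<le> b")
    case True
    then show ?thesis using *[OF True assms(2)] by simp
  next
    case False
    then show ?thesis using *[of b a] assms(1) by simp
  qed
qed

context contracting_walk
begin

lemma mg_weight:
  assumes "regular u"
  shows "\<exists>K\<ge>1. admissible_weight (mg u) K"
proof -
  obtain b where b: "0 \<le> b" "\<And>x. \<bar>u x\<bar> \<le> b"
    using continuous_bounded[OF regular_continuous[OF assms]] by auto
  have "admissible_weight (mg u) (2 * b)" by (rule admissible_mg[OF regular_continuous[OF assms] b(2)])
  then have "admissible_weight (mg u) (2 * b + 1)"
    unfolding admissible_weight_def
  proof (intro allI impI conjI)
    fix i x assume *: "\<forall>i<N. (\<lambda>x. mg u x i) \<in> borel_measurable borel \<and> (\<forall>x. norm (mg u x i) \<le> 2 * b)" and i: "i < N"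
    show "(\<lambda>x. mg u x i) \<in> borel_measurable borel" using * i by simp
    have "norm (mg u x i) \<le> 2 * b" using * i by simp
    then show "norm (mg u x i) \<le> 2 * b + 1" by simp
  qed
  then show ?thesis using b(1) by (intro exI[of _ "2 * b + 1"]) simp
qed

lemma mg_le: "admissible_weight (mg u) K \<Longrightarrow> i < N \<Longrightarrow> \<bar>mg u x i\<bar> \<le> K"
  by (simp add: admissible_weight_def)

lemma qv_le:
  assumes "admissible_weight (mg u) K"
  shows "qv u x \<le> K\<^sup>2"
proof -
  have "qv u x \<le> (\<Sum>i<N. p i * K\<^sup>2)"
    unfolding qv_def using order_trans[OF mg_le[OF assms] abs_ge_self]
    by (intro sum_mono mult_left_mono) (auto simp: less_imp_le[OF p_pos] abs_le_square_iff[symmetric])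
  then show ?thesis by (simp add: p_sum flip: sum_distrib_right)
qed

lemma measurable_qv:
  assumes "regular u"
  shows "qv u \<in> borel_measurable borel"
  by (rule continuous_measurable[OF regular_continuous[OF regular_qv[OF assms]]])

text \<open>One step of an exponential supermartingale. For \<open>y = l * mg u x i\<close> the
  cubic Taylor remainder is at most \<open>l * K * y\<^sup>2\<close>, which inflates the Gaussian
  compensator by the factor \<open>1 + 2 * K * l\<close>.\<close>

lemma sum_exp_mg_le_1:
  assumes w: "admissible_weight (mg u) K" and l: "0 \<le> l" "l * K \<le> 1"
  shows "(\<Sum>i<N. p i * exp (l * mg u x i - l\<^sup>2 / 2 * (1 + 2 * K * l) * qv u x)) \<le> 1"
proof -
  let ?q = "l\<^sup>2 / 2 * (1 + 2 * K * l) * qv u x"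
  have K: "0 \<le> K" by (rule admissible_weight_nonneg[OF w])
  have "(\<Sum>i<N. p i * exp (l * mg u x i)) \<le> (\<Sum>i<N. p i * (1 + l * mg u x i + l\<^sup>2 / 2 * (1 + 2 * K * l) * (mg u x i)\<^sup>2))"
  proof (intro sum_mono mult_left_mono)
    fix i assume "i \<in> {..<N}"
    then have i: "i < N" by simp
    let ?y = "l * mg u x i"
    have y: "\<bar>?y\<bar> \<le> l * K" using mg_le[OF w i, of x] l(1) by (simp add: abs_mult mult_left_mono)
    have "exp ?y \<le> 1 + ?y + ?y\<^sup>2 / 2 + \<bar>?y\<bar> ^ 3"
      using y l by (intro exp_le_quadratic_cubic) auto
    also have "\<bar>?y\<bar> ^ 3 = \<bar>?y\<bar> * ?y\<^sup>2"
      by (simp add: numeral_eq_Suc)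
    also have "\<dots> \<le> (l * K) * ?y\<^sup>2" using y by (intro mult_right_mono) auto
    finally show "exp ?y \<le> 1 + ?y + l\<^sup>2 / 2 * (1 + 2 * K * l) * (mg u x i)\<^sup>2"
      by (simp add: power2_eq_square algebra_simps)
    show "0 \<le> p i" using p_pos[OF i] by simp
  qed
  also have "\<dots> = 1 + l * (\<Sum>i<N. p i * mg u x i) + ?q"
  proof -
    have "(\<Sum>i<N. p i * (1 + l * mg u x i + c * (mg u x i)\<^sup>2)) = 1 + l * (\<Sum>i<N. p i * mg u x i) + c * qv u x" for c
      by (simp add: distrib_left sum.distrib p_sum qv_def sum_distrib_left mult.left_commute)
    then show ?thesis .
  qed
  also have "\<dots> = 1 + ?q" by (simp add: sum_mg)
  also have "\<dots> \<le> exp ?q" by (rule exp_ge_add_one_self)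
  finally have le: "(\<Sum>i<N. p i * exp (l * mg u x i)) * exp (- ?q) \<le> exp ?q * exp (- ?q)"
    by (intro mult_right_mono) auto
  have eq: "(\<Sum>i<N. p i * exp (l * mg u x i - ?q)) = (\<Sum>i<N. p i * exp (l * mg u x i)) * exp (- ?q)"
  proof -
    have "(\<Sum>i<N. p i * exp (l * mg u x i - q)) = (\<Sum>i<N. p i * exp (l * mg u x i)) * exp (- q)" for q
      by (simp add: sum_distrib_right exp_diff exp_minus divide_inverse mult.assoc)
    then show ?thesis .
  qed
  have "exp ?q * exp (- ?q) = 1" by (simp flip: exp_add)
  then show ?thesis unfolding eq using le by (rule subst)
qed

text \<open>An inequality of Freedman type. The compensator stays random, so that the strong law for
  \<open>qv u\<close> can be inserted later.\<close>

lemma mg_maximal_inequality: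
  assumes u: "regular u" and w: "admissible_weight (mg u) K" and l: "0 \<le> l" "l * K \<le> 1"
  shows "measure \<Omega> {\<omega> \<in> space \<Omega>. \<exists>k\<le>n. a \<le> l * addfun (mg u) k x \<omega>
      - l\<^sup>2 / 2 * (1 + 2 * K * l) * addfun (\<lambda>y _. qv u y) k x \<omega>} \<le> exp (- a)"
proof -
  let ?c = "l\<^sup>2 / 2 * (1 + 2 * K * l)"
  let ?w = "\<lambda>x i. l * mg u x i - ?c * qv u x"
  have K: "0 \<le> K" by (rule admissible_weight_nonneg[OF w])
  have c: "0 \<le> ?c" using l K by simp
  have "admissible_weight ?w (l * K + ?c * K\<^sup>2)"
    unfolding admissible_weight_def
  proof (intro allI impI conjI)
    fix i x assume i: "i < N"
    have "(\<lambda>x. mg u x i) \<in> borel_measurable borel" using w i by (simp add: admissible_weight_def)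
    then show "(\<lambda>x. ?w x i) \<in> borel_measurable borel" using measurable_qv[OF u] by simp
    have "\<bar>l * mg u x i\<bar> \<le> l * K" using mg_le[OF w i, of x] l(1) by (simp add: abs_mult mult_left_mono)
    moreover have "0 \<le> ?c * qv u x" "?c * qv u x \<le> ?c * K\<^sup>2"
      by (rule mult_nonneg_nonneg[OF c qv_nonneg], rule mult_left_mono[OF qv_le[OF w] c])
    ultimately show "norm (?w x i) \<le> l * K + ?c * K\<^sup>2" unfolding real_norm_def by linarith
  qed
  from addfun_maximal_inequality[OF this sum_exp_mg_le_1[OF w l], of "exp a" n x]
  have "measure \<Omega> {\<omega> \<in> space \<Omega>. \<exists>k\<le>n. exp a \<le> exp (addfun ?w k x \<omega>)} \<le> exp (- a)"
    by (simp add: exp_minus inverse_eq_divide)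
  moreover have "addfun ?w k x \<omega> = l * addfun (mg u) k x \<omega> - ?c * addfun (\<lambda>y _. qv u y) k x \<omega>" for k \<omega>
    by (simp add: addfun_def sum_subtractf sum_distrib_left)
  ultimately show ?thesis by simp
qed

lemma addfun_qv_le:
  assumes w: "admissible_weight (mg u) K"
  shows "addfun (\<lambda>y _. qv u y) k x \<omega> \<le> real k * K\<^sup>2" "0 \<le> addfun (\<lambda>y _. qv u y) k x \<omega>"
  unfolding addfun_def using sum_mono[of "{..<k}" "\<lambda>j. qv u (orbit f \<omega> j x)" "\<lambda>_. K\<^sup>2"] qv_le[OF w]
  by (auto intro: sum_nonneg qv_nonneg)

text \<open>A Chernoff bound with fixed parameter \<open>l\<close> makes the probabilities of large
  values decay geometrically, and Borel-Cantelli applies.\<close>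

lemma mg_eventually_le:
  assumes u: "regular u" and e: "0 < e"
  shows "AE \<omega> in \<Omega>. eventually (\<lambda>n. addfun (mg u) n x \<omega> < e * real n) sequentially"
proof -
  obtain K where K: "1 \<le> K" and w: "admissible_weight (mg u) K" using mg_weight[OF u] by auto
  \<comment> \<open>The first bound permits the exponential inequality and gives
    \<open>1 + 2 * K * l \<le> 3\<close>; by the second the compensator is at most half of
    \<open>l * e * n\<close>.\<close>
  define l where "l = min (1 / K) (e / (3 * K\<^sup>2))"
  have l: "0 < l" "l * K \<le> 1" "3 * l * K\<^sup>2 \<le> e"
  proof -
    show "0 < l" using K e by (simp add: l_def)
    have "l \<le> 1 / K" "l \<le> e / (3 * K\<^sup>2)" by (auto simp: l_def)
    then show "l * K \<le> 1" "3 * l * K\<^sup>2 \<le> e"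
      using K by (simp_all add: pos_le_divide_eq mult_ac)
  qed
  define A where "A n = {\<omega> \<in> space \<Omega>. e * real n \<le> addfun (mg u) n x \<omega>}" for n
  have A: "A n \<in> sets \<Omega>" for n unfolding A_def using measurable_addfun[OF w] by measurable
  have pA: "measure \<Omega> (A n) \<le> exp (- (l * e / 2)) ^ n" for n
  proof -
    define c where "c = l\<^sup>2 / 2 * (1 + 2 * K * l)"
    let ?B = "{\<omega> \<in> space \<Omega>. \<exists>k\<le>n. l * e / 2 * real n \<le> l * addfun (mg u) k x \<omega>
      - c * addfun (\<lambda>y _. qv u y) k x \<omega>}"
    have lower: "l * e / 2 * real n \<le> l * addfun (mg u) n x \<omega> - c * addfun (\<lambda>y _. qv u y) n x \<omega>"
      if "\<omega> \<in> A n" for \<omega>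
    proof -
      have "l * (e * real n) \<le> l * addfun (mg u) n x \<omega>" using that l by (simp add: A_def)
      moreover have "c * addfun (\<lambda>y _. qv u y) n x \<omega> \<le> l\<^sup>2 / 2 * 3 * (real n * K\<^sup>2)"
        unfolding c_def
      proof (intro mult_mono)
        show "1 + 2 * K * l \<le> 3" using l(2) by (simp add: mult_ac)
        show "0 \<le> 1 + 2 * K * l" using l(1) K by simp
      qed (use l addfun_qv_le[OF w, of n x \<omega>] in auto)
      moreover have "l\<^sup>2 / 2 * 3 * (real n * K\<^sup>2) = l * (3 * l * K\<^sup>2) * real n / 2"
        by (simp add: power2_eq_square)
      moreover have "l * (3 * l * K\<^sup>2) * real n / 2 \<le> l * e * real n / 2"
        using l by (intro divide_right_mono mult_right_mono mult_left_mono) auto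
      moreover have "l * e / 2 * real n = l * e * real n / 2" "l * (e * real n) = l * e * real n" by simp_all
      ultimately show ?thesis by linarith
    qed
    have "A n \<subseteq> ?B"
    proof
      fix \<omega> assume a: "\<omega> \<in> A n"
      then have "\<omega> \<in> space \<Omega>" by (simp add: A_def)
      then show "\<omega> \<in> ?B" using lower[OF a] by (intro CollectI conjI exI[of _ n]) auto
    qed
    moreover have "?B \<in> sets \<Omega>"
    proof -
      have "admissible_weight (\<lambda>y (_::nat). qv u y) (K\<^sup>2)"
        unfolding admissible_weight_def using measurable_qv[OF u] qv_le[OF w] qv_nonneg by simp
      note [measurable] = measurable_addfun[OF this, of _ x] measurable_addfun[OF w, of _ x]
      show ?thesis by measurable
    qed
    ultimately have "measure \<Omega> (A n) \<le> measure \<Omega> ?B"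
      by (rule seq.P.finite_measure_mono)
    also have "\<dots> \<le> exp (- (l * e / 2 * real n))"
      unfolding c_def by (rule mg_maximal_inequality[OF u w]) (use l in auto)
    also have "\<dots> = exp (- (l * e / 2)) ^ n" by (subst exp_of_nat_mult[symmetric]) (simp add: mult_ac)
    finally show ?thesis .
  qed
  have "summable (\<lambda>n. exp (- (l * e / 2)) ^ n)"
    using l e by (intro summable_geometric) auto
  then have "summable (\<lambda>n. measure \<Omega> (A n))"
    by (rule summable_comparison_test'[where N=0]) (use pA in simp)
  then have "AE \<omega> in \<Omega>. eventually (\<lambda>n. \<omega> \<in> space \<Omega> - A n) sequentially"
    by (intro borel_cantelli_AE1 A) (simp add: seq.P.emeasure_eq_measure)
  then show ?thesis
  proof eventually_elim
    case (elim \<omega>)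
    then show ?case by (rule eventually_mono) (auto simp: A_def not_le)
  qed
qed

lemma mg_uminus: "mg (\<lambda>x. - u x) x i = - mg u x i"
  by (simp add: mg_def P_def sum_negf)

lemma addfun_mg_uminus: "addfun (mg (\<lambda>x. - u x)) n x \<omega> = - addfun (mg u) n x \<omega>"
  by (simp add: addfun_def mg_uminus sum_negf)

lemma regular_uminus: "regular u \<Longrightarrow> regular (\<lambda>x. - u x)"
  using regular_diff[OF regular_const[of 0]] by simp

lemma mg_strong_law:
  assumes u: "regular u"
  shows "AE \<omega> in \<Omega>. (\<lambda>n. addfun (mg u) n x \<omega> / real n) \<longlonglongrightarrow> 0"
proof -
  have "AE \<omega> in \<Omega>. \<forall>m::nat. eventually (\<lambda>n. addfun (mg u) n x \<omega> < 1 / (real m + 1) * real n) sequentially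
      \<and> eventually (\<lambda>n. - addfun (mg u) n x \<omega> < 1 / (real m + 1) * real n) sequentially"
    unfolding AE_all_countable addfun_mg_uminus[symmetric]
    by (intro allI AE_conjI mg_eventually_le u regular_uminus) auto
  then show ?thesis
  proof eventually_elim
    case (elim \<omega>)
    show ?case
    proof (rule LIMSEQ_I)
      fix r :: real assume "0 < r"
      then obtain m :: nat where m: "1 / (real m + 1) < r"
        using reals_Archimedean[of r] by (auto simp: inverse_eq_divide add.commute)
      from elim have "eventually (\<lambda>n. addfun (mg u) n x \<omega> < 1 / (real m + 1) * real n) sequentially"
        "eventually (\<lambda>n. - addfun (mg u) n x \<omega> < 1 / (real m + 1) * real n) sequentially" by blast+
      then have "eventually (\<lambda>n. norm (addfun (mg u) n x \<omega> / real n - 0) < r) sequentially"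
        using eventually_gt_at_top[of "0::nat"]
      proof eventually_elim
        case (elim n)
        then have "\<bar>addfun (mg u) n x \<omega>\<bar> < 1 / (real m + 1) * real n" by linarith
        also have "\<dots> \<le> r * real n" using m by (intro mult_right_mono) auto
        finally show ?case using elim by (simp add: field_simps abs_divide)
      qed
      then show "\<exists>no. \<forall>n\<ge>no. norm (addfun (mg u) n x \<omega> / real n - 0) < r"
        by (simp add: eventually_sequentially)
    qed
  qed
qed

theorem strong_law:
  assumes "regular \<phi>"
  shows "AE \<omega> in \<Omega>. (\<lambda>n. (\<Sum>k<n. \<phi> (orbit f \<omega> k x)) / real n) \<longlonglongrightarrow> integral\<^sup>L \<nu> \<phi>"
proof -
  obtain u where u: "regular u" "\<And>x. u x - P u x = \<phi> x - integral\<^sup>L \<nu> \<phi>"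
    using poisson_equation[OF assms] by auto
  obtain b where b: "\<And>x. \<bar>u x\<bar> \<le> b"
    using continuous_bounded[OF regular_continuous[OF u(1)]] by auto
  show ?thesis
    using mg_strong_law[OF u(1), of x]
  proof eventually_elim
    case (elim \<omega>)
    have "(\<lambda>n. (u x - u (orbit f \<omega> n x)) / real n) \<longlonglongrightarrow> 0"
    proof (rule Lim_null_comparison)
      have "\<bar>u x - u (orbit f \<omega> n x)\<bar> \<le> 2 * b" for n
        using b[of x] b[of "orbit f \<omega> n x"] by linarith
      then show "eventually (\<lambda>n. norm ((u x - u (orbit f \<omega> n x)) / real n) \<le> 2 * b / real n) sequentially"
        by (intro always_eventually allI) (simp add: abs_divide divide_right_mono)
    qed (rule lim_const_over_n)
    then have "(\<lambda>n. addfun (mg u) n x \<omega> / real n + (u x - u (orbit f \<omega> n x)) / real n + integral\<^sup>L \<nu> \<phi>)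
        \<longlonglongrightarrow> 0 + 0 + integral\<^sup>L \<nu> \<phi>"
      by (intro tendsto_add elim tendsto_const)
    moreover have "eventually (\<lambda>n. addfun (mg u) n x \<omega> / real n + (u x - u (orbit f \<omega> n x)) / real n
        + integral\<^sup>L \<nu> \<phi> = (\<Sum>k<n. \<phi> (orbit f \<omega> k x)) / real n) sequentially"
      using eventually_gt_at_top[of "0::nat"]
      by eventually_elim (simp add: addfun_mg[OF u(2)] field_simps)
    ultimately show ?case by (simp add: tendsto_cong)
  qed
qed

section \<open>Asymptotic variance of the centred sums\<close>

lemma mg_square_integrable:
  assumes w: "admissible_weight (mg u) K"
  shows "integrable \<Omega> (\<lambda>\<omega>. (addfun (mg u) n x \<omega>)\<^sup>2)" "integrable \<Omega> (\<lambda>\<omega>. \<bar>addfun (mg u) n x \<omega>\<bar>)"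
proof -
  have bd: "\<bar>addfun (mg u) n x \<omega>\<bar> \<le> real n * K" if "\<omega> \<in> space \<Omega>" for \<omega>
    using norm_addfun_le[OF w that, of n x] by simp
  have bd2: "(addfun (mg u) n x \<omega>)\<^sup>2 \<le> (real n * K)\<^sup>2" if "\<omega> \<in> space \<Omega>" for \<omega>
    using bd[OF that] by (metis abs_ge_zero power2_abs power_mono)
  show "integrable \<Omega> (\<lambda>\<omega>. (addfun (mg u) n x \<omega>)\<^sup>2)"
    using bd2 measurable_addfun[OF w] by (intro seq.P.integrable_const_bound[where B="(real n * K)\<^sup>2"]) auto
  show "integrable \<Omega> (\<lambda>\<omega>. \<bar>addfun (mg u) n x \<omega>\<bar>)"
    using bd measurable_addfun[OF w] by (intro seq.P.integrable_const_bound[where B="real n * K"]) auto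
qed

lemma centered_sum_eq:
  assumes "\<And>x. u x - P u x = \<phi> x - integral\<^sup>L \<nu> \<phi>"
  shows "centered_sum f \<nu> \<phi> n x \<omega> = addfun (mg u) n x \<omega> + (u x - u (orbit f \<omega> n x))"
  unfolding centered_sum_def addfun_mg[OF assms] by simp

text \<open>Arithmetic-geometric mean with a free scale. With \<open>s\<close> equal to
  \<open>sqrt n\<close>, second moments of order \<open>n\<close> yield first absolute moments of
  order \<open>sqrt n\<close>.\<close>

lemma abs_le_half_square: "0 < s \<Longrightarrow> \<bar>y\<bar> \<le> (y\<^sup>2 / s + s) / 2" for y s :: real
proof -
  assume s: "0 < s"
  have "0 \<le> (\<bar>y\<bar> - s)\<^sup>2" by simp
  then have "2 * (\<bar>y\<bar> * s) \<le> y\<^sup>2 + s\<^sup>2" by (simp add: power2_diff)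
  then show ?thesis using s by (simp add: field_simps power2_eq_square)
qed

text \<open>Passing from the martingale to the centred sum costs a cross term with a bounded factor,
  of order \<open>sqrt n\<close>. The bound does not depend on \<open>x\<close>.\<close>

lemma centered_second_moment:
  assumes u: "regular u" "\<And>x. u x - P u x = \<phi> x - integral\<^sup>L \<nu> \<phi>" and \<phi>: "regular \<phi>"
  shows "\<exists>K\<ge>0. \<forall>n>0. \<forall>x. \<bar>(\<integral>\<omega>. (centered_sum f \<nu> \<phi> n x \<omega>)\<^sup>2 \<partial>\<Omega>) / real n - integral\<^sup>L \<nu> (qv u)\<bar> \<le> K / sqrt (real n)"
proof -
  let ?c = "integral\<^sup>L \<nu> (qv u)"
  obtain K where K: "1 \<le> K" and w: "admissible_weight (mg u) K" using mg_weight[OF u(1)] by auto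
  obtain b where b: "0 \<le> b" "\<And>x. \<bar>u x\<bar> \<le> b"
    using continuous_bounded[OF regular_continuous[OF u(1)]] by auto
  obtain A where A: "0 \<le> A" "\<And>n x. \<bar>(\<integral>\<omega>. (addfun (mg u) n x \<omega>)\<^sup>2 \<partial>\<Omega>) - real n * ?c\<bar> \<le> A"
    using mg_second_moment[OF u(1)] by auto
  have c0: "0 \<le> ?c" by (intro integral_nonneg_AE) (simp add: qv_nonneg)
  \<comment> \<open>In order: the second moment error of the martingale, the cross term with the
    boundary part, and the square of the boundary part.\<close>
  define Q where "Q = A + 2 * b * (?c + A + 1) + 4 * b\<^sup>2"
  have "\<bar>(\<integral>\<omega>. (centered_sum f \<nu> \<phi> n x \<omega>)\<^sup>2 \<partial>\<Omega>) / real n - ?c\<bar> \<le> Q / sqrt (real n)" if n: "0 < n" for n x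
  proof -
    define M where "M = addfun (mg u) n x"
    define s where "s = sqrt (real n)"
    have s: "1 \<le> s" "s * s = real n" using n by (auto simp: s_def)
    note int = mg_square_integrable[OF w, of n x, folded M_def]
    have Sm: "centered_sum f \<nu> \<phi> n x \<in> borel_measurable \<Omega>"
      unfolding centered_sum_def
      by (intro borel_measurable_diff borel_measurable_sum borel_measurable_const
          measurable_compose[OF measurable_orbit continuous_measurable[OF regular_continuous[OF \<phi>]]])
    have pt: "\<bar>(centered_sum f \<nu> \<phi> n x \<omega>)\<^sup>2 - (M \<omega>)\<^sup>2\<bar> \<le> 4 * b * \<bar>M \<omega>\<bar> + 4 * b\<^sup>2" for \<omega>
    proof -
      define r where "r = u x - u (orbit f \<omega> n x)"
      have r: "\<bar>r\<bar> \<le> 2 * b" using b(2)[of x] b(2)[of "orbit f \<omega> n x"] by (simp add: r_def)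
      have "(centered_sum f \<nu> \<phi> n x \<omega>)\<^sup>2 - (M \<omega>)\<^sup>2 = 2 * (M \<omega> * r) + r\<^sup>2"
        unfolding centered_sum_eq[OF u(2)] M_def r_def by (simp add: power2_sum)
      also have "\<bar>\<dots>\<bar> \<le> 2 * (\<bar>M \<omega>\<bar> * \<bar>r\<bar>) + \<bar>r\<bar>\<^sup>2"
        using abs_triangle_ineq[of "2 * (M \<omega> * r)" "r\<^sup>2"] by (simp add: abs_mult)
      also have "\<dots> \<le> 2 * (\<bar>M \<omega>\<bar> * (2 * b)) + (2 * b)\<^sup>2"
        using r by (intro add_mono mult_left_mono power_mono) auto
      finally show ?thesis by (simp add: power_mult_distrib mult_ac)
    qed
    have iS: "integrable \<Omega> (\<lambda>\<omega>. (centered_sum f \<nu> \<phi> n x \<omega>)\<^sup>2)"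
    proof (rule Bochner_Integration.integrable_bound)
      show "integrable \<Omega> (\<lambda>\<omega>. (M \<omega>)\<^sup>2 + (4 * b * \<bar>M \<omega>\<bar> + 4 * b\<^sup>2))" using int by simp
      show "AE \<omega> in \<Omega>. norm ((centered_sum f \<nu> \<phi> n x \<omega>)\<^sup>2) \<le> norm ((M \<omega>)\<^sup>2 + (4 * b * \<bar>M \<omega>\<bar> + 4 * b\<^sup>2))"
      proof (rule AE_I2)
        fix \<omega>
        show "norm ((centered_sum f \<nu> \<phi> n x \<omega>)\<^sup>2) \<le> norm ((M \<omega>)\<^sup>2 + (4 * b * \<bar>M \<omega>\<bar> + 4 * b\<^sup>2))"
          using pt[of \<omega>] b(1) by simp
      qed
    qed (use Sm in simp)
    have absM: "(\<integral>\<omega>. \<bar>M \<omega>\<bar> \<partial>\<Omega>) \<le> s * (?c + A + 1) / 2"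
    proof -
      have "(\<integral>\<omega>. \<bar>M \<omega>\<bar> \<partial>\<Omega>) \<le> (\<integral>\<omega>. ((M \<omega>)\<^sup>2 / s + s) / 2 \<partial>\<Omega>)"
        using s int by (intro integral_mono abs_le_half_square) auto
      also have "\<dots> = ((\<integral>\<omega>. (M \<omega>)\<^sup>2 \<partial>\<Omega>) / s + s) / 2"
        using int by (simp add: seq.P.prob_space)
      also have "\<dots> \<le> (s * s * (?c + A) / s + s) / 2"
      proof -
        have "A \<le> s * s * A" using A(1) s n mult_right_mono[of 1 "s * s" A] by simp
        then have "(\<integral>\<omega>. (M \<omega>)\<^sup>2 \<partial>\<Omega>) \<le> s * s * ?c + s * s * A"
          using A(2)[of n x] unfolding M_def s(2) by linarith
        then show ?thesis
          using s(1) by (intro divide_right_mono add_right_mono) (auto simp: distrib_left)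
      qed
      also have "\<dots> = s * (?c + A + 1) / 2" using s(1) by (simp add: field_simps)
      finally show ?thesis .
    qed
    have "\<bar>(\<integral>\<omega>. (centered_sum f \<nu> \<phi> n x \<omega>)\<^sup>2 \<partial>\<Omega>) - (\<integral>\<omega>. (M \<omega>)\<^sup>2 \<partial>\<Omega>)\<bar>
        = \<bar>\<integral>\<omega>. (centered_sum f \<nu> \<phi> n x \<omega>)\<^sup>2 - (M \<omega>)\<^sup>2 \<partial>\<Omega>\<bar>"
      using iS int by simp
    also have "\<dots> \<le> (\<integral>\<omega>. \<bar>(centered_sum f \<nu> \<phi> n x \<omega>)\<^sup>2 - (M \<omega>)\<^sup>2\<bar> \<partial>\<Omega>)" by (rule integral_abs_bound)
    also have "\<dots> \<le> (\<integral>\<omega>. 4 * b * \<bar>M \<omega>\<bar> + 4 * b\<^sup>2 \<partial>\<Omega>)"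
      using iS int by (intro integral_mono pt) auto
    also have "\<dots> = 4 * b * (\<integral>\<omega>. \<bar>M \<omega>\<bar> \<partial>\<Omega>) + 4 * b\<^sup>2"
      using int by (simp add: seq.P.prob_space)
    also have "\<dots> \<le> 4 * b * (s * (?c + A + 1) / 2) + 4 * b\<^sup>2"
      using absM b by (intro add_right_mono mult_left_mono) auto
    also have "\<dots> = 2 * b * (?c + A + 1) * s + 4 * b\<^sup>2" by simp
    finally have "\<bar>(\<integral>\<omega>. (centered_sum f \<nu> \<phi> n x \<omega>)\<^sup>2 \<partial>\<Omega>) - real n * ?c\<bar>
        \<le> A + 2 * b * (?c + A + 1) * s + 4 * b\<^sup>2"
      using A(2)[of n x] unfolding M_def by linarith
    also have "\<dots> \<le> A * s + 2 * b * (?c + A + 1) * s + 4 * b\<^sup>2 * s"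
      using mult_left_mono[OF s(1), of A] mult_left_mono[OF s(1), of "4 * b\<^sup>2"] A(1) by simp
    also have "\<dots> = Q * s" by (simp add: Q_def algebra_simps)
    finally have fin: "\<bar>(\<integral>\<omega>. (centered_sum f \<nu> \<phi> n x \<omega>)\<^sup>2 \<partial>\<Omega>) - real n * ?c\<bar> \<le> Q * s" .
    have "(\<integral>\<omega>. (centered_sum f \<nu> \<phi> n x \<omega>)\<^sup>2 \<partial>\<Omega>) / real n - ?c
        = ((\<integral>\<omega>. (centered_sum f \<nu> \<phi> n x \<omega>)\<^sup>2 \<partial>\<Omega>) - real n * ?c) / real n"
      using n by (simp add: field_simps)
    also have "\<bar>\<dots>\<bar> \<le> Q * s / real n"
      using fin by (simp add: abs_divide divide_right_mono)
    also have "\<dots> = Q / s" using s n by (simp flip: s(2))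
    finally show ?thesis by (simp add: s_def)
  qed
  moreover have "0 \<le> Q" using A b c0 by (simp add: Q_def)
  ultimately show ?thesis by blast
qed

lemma measurable_centered_sum_pair:
  assumes \<phi>: "regular \<phi>"
  shows "(\<lambda>z. centered_sum f \<nu> \<phi> n (snd z) (fst z)) \<in> borel_measurable (\<Omega> \<Otimes>\<^sub>M \<nu>)"
proof -
  have "(\<lambda>z. (snd z, fst z)) \<in> \<Omega> \<Otimes>\<^sub>M \<nu> \<rightarrow>\<^sub>M borel \<Otimes>\<^sub>M \<Omega>"
    by (intro measurable_Pair measurable_fst)
       (use measurable_snd[of \<Omega> \<nu>] in \<open>simp cong: measurable_cong_sets\<close>)
  from measurable_compose[OF this measurable_orbit_pair]
  have "(\<lambda>z. orbit f (fst z) k (snd z)) \<in> \<Omega> \<Otimes>\<^sub>M \<nu> \<rightarrow>\<^sub>M borel" for k by simp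
  from measurable_compose[OF this continuous_measurable[OF regular_continuous[OF \<phi>]]]
  show ?thesis unfolding centered_sum_def by measurable
qed

text \<open>After Fubini, the error bound survives integration over \<open>\<nu>\<close> because it
  is uniform in the starting point.\<close>

theorem variance_limit:
  assumes u: "regular u" "\<And>x. u x - P u x = \<phi> x - integral\<^sup>L \<nu> \<phi>" and \<phi>: "regular \<phi>"
  shows "(\<lambda>n. 1 / real n * (\<integral>z. (centered_sum f \<nu> \<phi> n (snd z) (fst z))\<^sup>2 \<partial>(\<Omega> \<Otimes>\<^sub>M \<nu>)))
    \<longlonglongrightarrow> integral\<^sup>L \<nu> (qv u)"
proof -
  interpret pr: pair_prob_space \<Omega> \<nu> ..
  let ?c = "integral\<^sup>L \<nu> (qv u)"
  let ?S = "\<lambda>n x \<omega>. centered_sum f \<nu> \<phi> n x \<omega>"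
  obtain K where K: "0 \<le> K"
    "\<And>n x. 0 < n \<Longrightarrow> \<bar>(\<integral>\<omega>. (?S n x \<omega>)\<^sup>2 \<partial>\<Omega>) / real n - ?c\<bar> \<le> K / sqrt (real n)"
    using centered_second_moment[OF u \<phi>] by auto
  obtain B where B: "0 \<le> B" "\<And>x. \<bar>\<phi> x\<bar> \<le> B"
    using continuous_bounded[OF regular_continuous[OF \<phi>]] by auto
  have bd: "(?S n x \<omega>)\<^sup>2 \<le> (2 * real n * B)\<^sup>2" for n x \<omega>
  proof -
    have "\<bar>\<Sum>k<n. \<phi> (orbit f \<omega> k x)\<bar> \<le> (\<Sum>k<n. B)"
      by (intro order_trans[OF sum_abs] sum_mono B)
    moreover have "\<bar>integral\<^sup>L \<nu> \<phi>\<bar> \<le> B"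
    proof -
      have "\<bar>integral\<^sup>L \<nu> \<phi>\<bar> \<le> (\<integral>x. \<bar>\<phi> x\<bar> \<partial>\<nu>)" by (rule integral_abs_bound)
      also have "\<dots> \<le> (\<integral>x. B \<partial>\<nu>)"
        using continuous_integrable_nu[OF regular_continuous[OF \<phi>]] B by (intro integral_mono) auto
      finally show ?thesis by simp
    qed
    then have "\<bar>real n * integral\<^sup>L \<nu> \<phi>\<bar> \<le> real n * B" by (simp add: abs_mult mult_left_mono)
    ultimately have "\<bar>?S n x \<omega>\<bar> \<le> 2 * real n * B" unfolding centered_sum_def by simp
    then show ?thesis by (metis abs_ge_zero power2_abs power_mono)
  qed
  have *: "\<bar>1 / real n * (\<integral>z. (?S n (snd z) (fst z))\<^sup>2 \<partial>(\<Omega> \<Otimes>\<^sub>M \<nu>)) - ?c\<bar> \<le> K / sqrt (real n)" if n: "0 < n" for n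
  proof -
    have int: "integrable (\<Omega> \<Otimes>\<^sub>M \<nu>) (\<lambda>(\<omega>, x). (?S n x \<omega>)\<^sup>2)"
      using measurable_centered_sum_pair[OF \<phi>, of n] bd
      by (intro pr.P.integrable_const_bound[where B="(2 * real n * B)\<^sup>2"]) (auto simp: case_prod_beta')
    have eq: "(\<integral>z. (?S n (snd z) (fst z))\<^sup>2 \<partial>(\<Omega> \<Otimes>\<^sub>M \<nu>)) = (\<integral>x. (\<integral>\<omega>. (?S n x \<omega>)\<^sup>2 \<partial>\<Omega>) \<partial>\<nu>)"
      using pr.integral_snd[OF int] by (simp add: case_prod_beta')
    have i2: "integrable \<nu> (\<lambda>x. \<integral>\<omega>. (?S n x \<omega>)\<^sup>2 \<partial>\<Omega>)"
      by (rule pr.integrable_snd[OF int])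
    have "1 / real n * (\<integral>z. (?S n (snd z) (fst z))\<^sup>2 \<partial>(\<Omega> \<Otimes>\<^sub>M \<nu>)) - ?c
        = (\<integral>x. (\<integral>\<omega>. (?S n x \<omega>)\<^sup>2 \<partial>\<Omega>) / real n - ?c \<partial>\<nu>)"
      unfolding eq using i2 by simp
    also have "\<bar>\<dots>\<bar> \<le> (\<integral>x. \<bar>(\<integral>\<omega>. (?S n x \<omega>)\<^sup>2 \<partial>\<Omega>) / real n - ?c\<bar> \<partial>\<nu>)" by (rule integral_abs_bound)
    also have "\<dots> \<le> (\<integral>x. K / sqrt (real n) \<partial>\<nu>)"
      using i2 K(2)[OF n] by (intro integral_mono) auto
    finally show ?thesis by simp
  qed
  have "eventually (\<lambda>n. norm (1 / real n * (\<integral>z. (?S n (snd z) (fst z))\<^sup>2 \<partial>(\<Omega> \<Otimes>\<^sub>M \<nu>)) - ?c) \<le> K / sqrt (real n)) sequentially"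
    by (rule eventually_mono[OF eventually_gt_at_top[of "0::nat"]]) (use * in simp)
  moreover have "(\<lambda>n. K / sqrt (real n)) \<longlonglongrightarrow> 0" by real_asymp
  ultimately have "(\<lambda>n. 1 / real n * (\<integral>z. (?S n (snd z) (fst z))\<^sup>2 \<partial>(\<Omega> \<Otimes>\<^sub>M \<nu>)) - ?c) \<longlonglongrightarrow> 0"
    by (rule Lim_null_comparison)
  then show ?thesis by (rule LIM_zero_cancel)
qed

end

section \<open>The central limit theorem\<close>

lemma real_distribution_normal_law: "0 \<le> v \<Longrightarrow> real_distribution (normal_law v)"
  unfolding normal_law_def
  by (auto simp: real_distribution_def real_distribution_axioms_def intro!: prob_space_return prob_space_normal_density)

lemma char_normal_law:
  assumes "0 \<le> v"
  shows "char (normal_law v) t = complex_of_real (exp (- (v * t\<^sup>2 / 2)))"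
proof (cases "v = 0")
  case True
  then show ?thesis by (simp add: normal_law_def char_def integral_return)
next
  case False
  define s where "s = sqrt v"
  have s: "0 < s" "s\<^sup>2 = v" "sqrt v = s" "v \<noteq> 0" using False assms by (auto simp: s_def)
  have d: "s * normal_density 0 s (s * y) = std_normal_density y" for y
    using s by (simp add: normal_density_def std_normal_density_def power_mult_distrib real_sqrt_mult)
  have "char (normal_law v) t = (CLBINT y. normal_density 0 s y *\<^sub>R iexp (t * y))"
    using False unfolding normal_law_def char_def s_def
    by (simp add: integral_density)
  also have "\<dots> = s *\<^sub>R (CLBINT y. normal_density 0 s (s * y) *\<^sub>R iexp (t * (s * y)))"
    using s lborel_integral_real_affine[of s "\<lambda>y. normal_density 0 s y *\<^sub>R iexp (t * y)" 0] by simp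
  also have "\<dots> = (CLBINT y. s *\<^sub>R (normal_density 0 s (s * y) *\<^sub>R iexp (t * (s * y))))"
    by (rule integral_scaleR_right[symmetric])
  also have "\<dots> = (CLBINT y. std_normal_density y *\<^sub>R iexp ((t * s) * y))"
    by (simp add: d[symmetric] mult_ac)
  also have "\<dots> = char std_normal_distribution (t * s)"
    unfolding char_def by (simp add: integral_density)
  also have "\<dots> = complex_of_real (exp (- (v * t\<^sup>2 / 2)))"
    using s by (simp add: char_std_normal_distribution power_mult_distrib mult_ac)
  finally show ?thesis .
qed

context contracting_walk
begin

lemma centered_sum_measurable:
  assumes "regular \<phi>"
  shows "centered_sum f \<nu> \<phi> n x \<in> borel_measurable \<Omega>"
  unfolding centered_sum_def
  by (intro borel_measurable_diff borel_measurable_sum borel_measurable_const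
      measurable_compose[OF measurable_orbit continuous_measurable[OF regular_continuous[OF assms]]])

lemma centered_sum_bound:
  assumes "regular \<phi>"
  shows "\<exists>B\<ge>0. \<forall>n x \<omega>. \<bar>centered_sum f \<nu> \<phi> n x \<omega>\<bar> \<le> real n * B"
proof -
  obtain B where B: "0 \<le> B" "\<And>x. \<bar>\<phi> x\<bar> \<le> B"
    using continuous_bounded[OF regular_continuous[OF assms]] by auto
  have "\<bar>centered_sum f \<nu> \<phi> n x \<omega>\<bar> \<le> real n * (B + \<bar>integral\<^sup>L \<nu> \<phi>\<bar>)" for n x \<omega>
  proof -
    have "\<bar>\<Sum>k<n. \<phi> (orbit f \<omega> k x)\<bar> \<le> (\<Sum>k<n. B)"
      by (intro order_trans[OF sum_abs] sum_mono B)
    moreover have "\<bar>real n * integral\<^sup>L \<nu> \<phi>\<bar> = real n * \<bar>integral\<^sup>L \<nu> \<phi>\<bar>" by (simp add: abs_mult)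
    ultimately show ?thesis unfolding centered_sum_def distrib_left
      by simp
  qed
  then show ?thesis using B(1) by (intro exI[of _ "B + \<bar>integral\<^sup>L \<nu> \<phi>\<bar>"]) simp
qed

text \<open>Intended for the function \<open>qv u\<close>: the sum of conditional variances differs
  from \<open>n\<close> times its mean by order \<open>sqrt n\<close> on average, which makes the
  random compensator nearly deterministic.\<close>

lemma centered_first_moment:
  assumes \<phi>: "regular \<phi>"
  shows "\<exists>G\<ge>0. \<forall>n>0. \<forall>x. integrable \<Omega> (\<lambda>\<omega>. \<bar>centered_sum f \<nu> \<phi> n x \<omega>\<bar>) \<and>
    (\<integral>\<omega>. \<bar>centered_sum f \<nu> \<phi> n x \<omega>\<bar> \<partial>\<Omega>) \<le> G * sqrt (real n)"
proof -
  obtain v where v: "regular v" "\<And>x. v x - P v x = \<phi> x - integral\<^sup>L \<nu> \<phi>"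
    using poisson_equation[OF \<phi>] by auto
  let ?c = "integral\<^sup>L \<nu> (qv v)"
  let ?S = "centered_sum f \<nu> \<phi>"
  have c0: "0 \<le> ?c" by (intro integral_nonneg_AE) (simp add: qv_nonneg)
  obtain K where K: "0 \<le> K"
    "\<And>n x. 0 < n \<Longrightarrow> \<bar>(\<integral>\<omega>. (?S n x \<omega>)\<^sup>2 \<partial>\<Omega>) / real n - ?c\<bar> \<le> K / sqrt (real n)"
    using centered_second_moment[OF v \<phi>] by auto
  obtain B where B: "0 \<le> B" "\<And>n x \<omega>. \<bar>?S n x \<omega>\<bar> \<le> real n * B"
    using centered_sum_bound[OF \<phi>] by auto
  have "integrable \<Omega> (\<lambda>\<omega>. \<bar>?S n x \<omega>\<bar>) \<and> (\<integral>\<omega>. \<bar>?S n x \<omega>\<bar> \<partial>\<Omega>) \<le> (?c + K + 1) / 2 * sqrt (real n)"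
    if n: "0 < n" for n x
  proof
    define s where "s = sqrt (real n)"
    have s: "1 \<le> s" "s * s = real n" using n by (auto simp: s_def)
    show int1: "integrable \<Omega> (\<lambda>\<omega>. \<bar>?S n x \<omega>\<bar>)"
      using B centered_sum_measurable[OF \<phi>] by (intro seq.P.integrable_const_bound[where B="real n * B"]) auto
    have int2: "integrable \<Omega> (\<lambda>\<omega>. (?S n x \<omega>)\<^sup>2)"
    proof (rule seq.P.integrable_const_bound[where B="(real n * B)\<^sup>2"])
      have "(?S n x \<omega>)\<^sup>2 \<le> (real n * B)\<^sup>2" for \<omega>
        using B(2)[of n x \<omega>] by (metis abs_ge_zero power2_abs power_mono)
      then show "AE \<omega> in \<Omega>. norm ((?S n x \<omega>)\<^sup>2) \<le> (real n * B)\<^sup>2" by simp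
    qed (use centered_sum_measurable[OF \<phi>] in simp)
    have "K / s \<le> K" using s K(1) by (simp add: field_simps mult_left_mono[of 1 s K, simplified])
    then have "(\<integral>\<omega>. (?S n x \<omega>)\<^sup>2 \<partial>\<Omega>) / real n \<le> ?c + K"
      using K(2)[OF n, of x] unfolding s_def by linarith
    then have m2: "(\<integral>\<omega>. (?S n x \<omega>)\<^sup>2 \<partial>\<Omega>) \<le> s * s * (?c + K)"
      using n unfolding s(2) by (simp add: field_simps)
    have "(\<integral>\<omega>. \<bar>?S n x \<omega>\<bar> \<partial>\<Omega>) \<le> (\<integral>\<omega>. ((?S n x \<omega>)\<^sup>2 / s + s) / 2 \<partial>\<Omega>)"
      using s int1 int2 by (intro integral_mono abs_le_half_square) auto
    also have "\<dots> = ((\<integral>\<omega>. (?S n x \<omega>)\<^sup>2 \<partial>\<Omega>) / s + s) / 2"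
      using int2 by (simp add: seq.P.prob_space)
    also have "\<dots> \<le> (s * s * (?c + K) / s + s) / 2"
      using s(1) m2 by (intro divide_right_mono add_right_mono) auto
    also have "\<dots> = (?c + K + 1) / 2 * s" using s(1) by (simp add: field_simps)
    finally show "(\<integral>\<omega>. \<bar>?S n x \<omega>\<bar> \<partial>\<Omega>) \<le> (?c + K + 1) / 2 * sqrt (real n)" by (simp add: s_def)
  qed
  then show ?thesis using c0 K(1) by (intro exI[of _ "(?c + K + 1) / 2"]) simp
qed

text \<open>One step of a compensated Fourier exponential. The compensator cancels the second order
  term of the expansion and the first order term has mean 0, so the error has order \<open>n\<close>
  to the power -3/2, small enough to be summed over \<open>n\<close> steps.\<close>

lemma weighted_char_step:
  fixes t :: real
  assumes w: "admissible_weight (mg u) K" and K: "0 \<le> K" and n: "1 \<le> real n" "t\<^sup>2 * K\<^sup>2 / 2 \<le> real n"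
  shows "cmod ((\<Sum>i<N. p i *\<^sub>R exp (\<i> * complex_of_real (t * mg u x i / sqrt (real n))
      + complex_of_real (t\<^sup>2 * qv u x / (2 * real n)))) - 1)
    \<le> (\<bar>t\<bar> ^ 3 * K ^ 3 + (t\<^sup>2 * K\<^sup>2 / 2)\<^sup>2) / (real n * sqrt (real n))"
proof -
  define c where "c = t\<^sup>2 * K\<^sup>2 / 2"
  define s where "s = sqrt (real n)"
  have s: "1 \<le> s" "s * s = real n" "s \<le> real n"
  proof -
    show s1: "1 \<le> s" using n by (simp add: s_def)
    show s2: "s * s = real n" by (simp add: s_def)
    show "s \<le> real n" using s1 mult_left_mono[OF s1, of s] by (simp add: s2)
  qed
  define z where "z = t\<^sup>2 * qv u x / (2 * real n)"
  define y where "y i = t * mg u x i / s" for i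
  have z: "0 \<le> z" "z \<le> c / real n" "z \<le> 1"
  proof -
    show "0 \<le> z" using qv_nonneg by (simp add: z_def)
    have "t\<^sup>2 * qv u x \<le> t\<^sup>2 * K\<^sup>2" by (intro mult_left_mono qv_le[OF w]) simp
    then show zc: "z \<le> c / real n" using n by (simp add: z_def c_def field_simps)
    show "z \<le> 1" using zc n by (simp add: c_def[symmetric] order_trans[OF zc])
  qed
  have sum_y: "(\<Sum>i<N. p i * y i) = 0"
    using sum_mg[of u x] by (simp add: y_def mult.left_commute flip: sum_distrib_left sum_divide_distrib)
  have sum_y2: "(\<Sum>i<N. p i * (y i)\<^sup>2) = 2 * z"
  proof -
    have "p i * (y i)\<^sup>2 = t\<^sup>2 / real n * (p i * (mg u x i)\<^sup>2)" for i
      using s by (simp add: y_def power_divide power_mult_distrib power2_eq_square)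
    then have "(\<Sum>i<N. p i * (y i)\<^sup>2) = t\<^sup>2 / real n * qv u x"
      by (simp add: qv_def sum_distrib_left)
    then show ?thesis by (simp add: z_def)
  qed
  define R where "R = \<bar>t\<bar> ^ 3 * K ^ 3 / (6 * (real n * s))"
  have approx: "cmod (iexp (y i) - (1 + \<i> * y i - (y i)\<^sup>2 / 2)) \<le> R" if i: "i < N" for i
  proof -
    have "cmod (iexp (y i) - (\<Sum>k\<le>2. (\<i> * y i) ^ k / fact k)) \<le> \<bar>y i\<bar> ^ Suc 2 / fact (Suc 2)"
      by (rule iexp_approx1)
    moreover have "(\<Sum>k\<le>2. (\<i> * complex_of_real (y i)) ^ k / fact k) = 1 + \<i> * y i - (y i)\<^sup>2 / 2"
      by (simp add: numeral_eq_Suc power_mult_distrib)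
    moreover have "\<bar>y i\<bar> ^ Suc 2 / fact (Suc 2) \<le> R"
    proof -
      have "\<bar>y i\<bar> \<le> \<bar>t\<bar> * K / s"
        using mg_le[OF w i, of x] s by (simp add: y_def abs_mult abs_divide divide_right_mono mult_left_mono)
      then have "\<bar>y i\<bar> ^ 3 \<le> (\<bar>t\<bar> * K / s) ^ 3" by (rule power_mono) simp
      also have "\<dots> = \<bar>t\<bar> ^ 3 * K ^ 3 / (real n * s)"
        using s by (simp add: power_divide power_mult_distrib power3_eq_cube)
      finally have "\<bar>y i\<bar> ^ 3 / 6 \<le> \<bar>t\<bar> ^ 3 * K ^ 3 / (real n * s) / 6" by (rule divide_right_mono) simp
      moreover have "(Suc 2 :: nat) = 3" "(fact 3 :: real) = 6" by (simp_all add: fact_numeral)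
      ultimately show ?thesis by (simp add: R_def mult_ac)
    qed
    ultimately show ?thesis by simp
  qed
  have e1: "cmod ((\<Sum>i<N. p i *\<^sub>R iexp (y i)) - (1 - z)) \<le> R"
  proof -
    have "(\<Sum>i<N. p i *\<^sub>R (1 + \<i> * y i - (y i)\<^sup>2 / 2)) = complex_of_real (1 - z)"
    proof -
      have "(\<Sum>i<N. p i *\<^sub>R (1 + \<i> * y i - (y i)\<^sup>2 / 2))
          = complex_of_real (\<Sum>i<N. p i) + \<i> * complex_of_real (\<Sum>i<N. p i * y i) - complex_of_real (\<Sum>i<N. p i * (y i)\<^sup>2) / 2"
        by (simp add: scaleR_conv_of_real algebra_simps sum.distrib sum_subtractf sum_distrib_left sum_divide_distrib)
      then show ?thesis by (simp add: p_sum sum_y sum_y2)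
    qed
    then have "(\<Sum>i<N. p i *\<^sub>R iexp (y i)) - (1 - z) = (\<Sum>i<N. p i *\<^sub>R (iexp (y i) - (1 + \<i> * y i - (y i)\<^sup>2 / 2)))"
      by (simp add: scaleR_diff_right sum_subtractf)
    also have "cmod \<dots> \<le> (\<Sum>i<N. p i * R)"
    proof (rule sum_norm_le)
      fix i assume "i \<in> {..<N}"
      then show "norm (p i *\<^sub>R (iexp (y i) - (1 + \<i> * y i - (y i)\<^sup>2 / 2))) \<le> p i * R"
        using mult_left_mono[OF approx, of i "p i"] p_pos[of i] by simp
    qed
    also have "\<dots> = R"
      by (simp add: p_sum flip: sum_distrib_right)
    finally show ?thesis .
  qed
  \<comment> \<open>\<open>1 - z\<close> and \<open>exp (- z)\<close> agree to first order, so their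
    quotient differs from 1 only quadratically.\<close>
  have e2: "\<bar>(1 - z) * exp z - 1\<bar> \<le> z\<^sup>2"
  proof -
    have "(1 - z) * exp z \<le> exp (- z) * exp z"
      using exp_ge_add_one_self[of "- z"] by (intro mult_right_mono) auto
    moreover have "exp (- z) * exp z = 1" by (simp flip: exp_add)
    moreover have "(1 - z) * (1 + z) \<le> (1 - z) * exp z"
      using z exp_ge_add_one_self[of z] by (intro mult_left_mono) auto
    moreover have "(1 - z) * (1 + z) = 1 - z\<^sup>2" by (simp add: power2_eq_square algebra_simps)
    ultimately show ?thesis by linarith
  qed
  have "exp z \<le> exp 1" using z(3) by simp
  then have ez: "exp z \<le> 3" using exp_le by linarith
  define Y where "Y = (\<Sum>i<N. p i *\<^sub>R iexp (y i))"
  have "(\<Sum>i<N. p i *\<^sub>R exp (\<i> * complex_of_real (t * mg u x i / sqrt (real n)) + complex_of_real (t\<^sup>2 * qv u x / (2 * real n))))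
      = Y * exp z"
    unfolding z_def[symmetric] s_def[symmetric] y_def[symmetric] Y_def
    by (simp add: exp_add sum_distrib_right exp_of_real)
  also have "Y * exp z - 1 = (Y - (1 - z)) * exp z + complex_of_real ((1 - z) * exp z - 1)"
    by (simp add: algebra_simps)
  also have "cmod \<dots> \<le> cmod ((Y - (1 - z)) * exp z) + cmod (complex_of_real ((1 - z) * exp z - 1))"
    by (rule norm_triangle_ineq)
  also have "\<dots> = cmod (Y - (1 - z)) * exp z + \<bar>(1 - z) * exp z - 1\<bar>"
    by (simp only: norm_mult norm_of_real abs_exp_cancel)
  also have "\<dots> \<le> R * 3 + z\<^sup>2"
    using e1 e2 ez order_trans[OF norm_ge_zero e1] unfolding Y_def[symmetric] by (intro add_mono mult_mono) auto
  also have "\<dots> \<le> \<bar>t\<bar> ^ 3 * K ^ 3 / (real n * s) + c\<^sup>2 / (real n * s)"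
  proof (rule add_mono)
    have "0 \<le> \<bar>t\<bar> ^ 3 * K ^ 3 / (real n * s)" using K s by simp
    moreover have "R * 3 = \<bar>t\<bar> ^ 3 * K ^ 3 / (real n * s) / 2"
      by (simp add: R_def mult_ac)
    moreover have "b / 2 \<le> b" if "0 \<le> b" for b :: real using that by simp
    ultimately show "R * 3 \<le> \<bar>t\<bar> ^ 3 * K ^ 3 / (real n * s)"
      by (simp only:)
    have "z\<^sup>2 \<le> (c / real n)\<^sup>2" using z by (intro power_mono) auto
    also have "\<dots> = c\<^sup>2 / (real n * real n)" by (simp add: power2_eq_square)
    also have "\<dots> \<le> c\<^sup>2 / (real n * s)" using s n by (intro divide_left_mono mult_left_mono mult_pos_pos) auto
    finally show "z\<^sup>2 \<le> c\<^sup>2 / (real n * s)" .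
  qed
  finally show ?thesis by (simp add: c_def s_def add_divide_distrib)
qed

text \<open>First the mean of the compensated exponential is shown to be near 1 by a recursion over
  steps; then the random compensator is replaced by its mean. Both errors have order
  \<open>1 / sqrt n\<close>, uniformly in the starting point.\<close>

lemma char_mg_estimate:
  fixes t :: real
  assumes u: "regular u"
  shows "\<exists>C n0. \<forall>n\<ge>n0. \<forall>x. cmod ((\<integral>\<omega>. iexp (t / sqrt (real n) * addfun (mg u) n x \<omega>) \<partial>\<Omega>)
      - complex_of_real (exp (- (t\<^sup>2 * integral\<^sup>L \<nu> (qv u) / 2)))) \<le> C / sqrt (real n)"
proof -
  obtain K where K: "1 \<le> K" and w: "admissible_weight (mg u) K" using mg_weight[OF u] by auto
  let ?\<sigma> = "integral\<^sup>L \<nu> (qv u)"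
  define c where "c = t\<^sup>2 * K\<^sup>2 / 2"
  define d where "d = \<bar>t\<bar> ^ 3 * K ^ 3 + c\<^sup>2"
  have c: "0 \<le> c" "0 \<le> d" using K by (auto simp: c_def d_def)
  obtain G where G: "0 \<le> G" "\<And>n x. 0 < n \<Longrightarrow> integrable \<Omega> (\<lambda>\<omega>. \<bar>centered_sum f \<nu> (qv u) n x \<omega>\<bar>)"
    "\<And>n x. 0 < n \<Longrightarrow> (\<integral>\<omega>. \<bar>centered_sum f \<nu> (qv u) n x \<omega>\<bar> \<partial>\<Omega>) \<le> G * sqrt (real n)"
    using centered_first_moment[OF regular_qv[OF u]] by auto
  have \<sigma>: "0 \<le> ?\<sigma>" "?\<sigma> \<le> K\<^sup>2"
  proof -
    show "0 \<le> ?\<sigma>" by (intro integral_nonneg_AE) (simp add: qv_nonneg)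
    have "?\<sigma> \<le> (\<integral>x. K\<^sup>2 \<partial>\<nu>)"
      using continuous_integrable_nu[OF regular_continuous[OF regular_qv[OF u]]] qv_le[OF w]
      by (intro integral_mono) auto
    then show "?\<sigma> \<le> K\<^sup>2" by simp
  qed
  have "cmod ((\<integral>\<omega>. iexp (t / sqrt (real n) * addfun (mg u) n x \<omega>) \<partial>\<Omega>)
      - complex_of_real (exp (- (t\<^sup>2 * ?\<sigma> / 2)))) \<le> (d * exp c + exp c * (t\<^sup>2 / 2) * G) / sqrt (real n)"
    if n: "nat \<lceil>c\<rceil> + 1 \<le> n" for n x
  proof -
    have nc: "1 \<le> real n" "c \<le> real n"
      using n by linarith+
    define s where "s = sqrt (real n)"
    have s: "1 \<le> s" "s * s = real n" using nc by (auto simp: s_def)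
    define W where "W x i = \<i> * complex_of_real (t * mg u x i / s) + complex_of_real (t\<^sup>2 * qv u x / (2 * real n))" for x i
    have ReW: "Re (W x i) \<le> c / real n" for x i
    proof -
      have "t\<^sup>2 * qv u x \<le> t\<^sup>2 * K\<^sup>2" by (intro mult_left_mono qv_le[OF w]) simp
      then show ?thesis using nc by (simp add: W_def c_def field_simps)
    qed
    have admW: "admissible_weight W (\<bar>t\<bar> * K / s + c / real n)"
      unfolding admissible_weight_def
    proof (intro allI impI conjI)
      fix i y assume i: "i < N"
      have [measurable]: "(\<lambda>x. mg u x i) \<in> borel_measurable borel" "qv u \<in> borel_measurable borel"
        using w i measurable_qv[OF u] by (simp_all add: admissible_weight_def)
      show "(\<lambda>x. W x i) \<in> borel_measurable borel" unfolding W_def by measurable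
      have "cmod (W y i) \<le> \<bar>t * mg u y i / s\<bar> + \<bar>t\<^sup>2 * qv u y / (2 * real n)\<bar>"
        unfolding W_def by (rule order_trans[OF norm_triangle_ineq])
          (simp only: norm_mult norm_ii norm_of_real mult_1 order_refl)
      also have "\<bar>t * mg u y i / s\<bar> \<le> \<bar>t\<bar> * K / s"
        using mg_le[OF w i, of y] s by (simp add: abs_mult abs_divide divide_right_mono mult_left_mono)
      also have "\<bar>t\<^sup>2 * qv u y / (2 * real n)\<bar> \<le> c / real n"
      proof -
        have "t\<^sup>2 * qv u y \<le> t\<^sup>2 * K\<^sup>2" by (intro mult_left_mono qv_le[OF w]) simp
        then show ?thesis using nc qv_nonneg[of u y] by (simp add: c_def field_simps)
      qed
      finally show "cmod (W y i) \<le> \<bar>t\<bar> * K / s + c / real n" by simp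
    qed
    define D where "D = d / (real n * s)"
    define a where "a = exp (c / real n)"
    have D: "0 \<le> D" "1 \<le> a" using c nc s by (auto simp: D_def a_def)
    define e where "e k y = (\<integral>\<omega>. exp (addfun W k y \<omega>) \<partial>\<Omega>)" for k y
    have step: "cmod ((\<Sum>i<N. p i *\<^sub>R exp (W y i)) - 1) \<le> D" for y
      using weighted_char_step[OF w _ nc(1), of t y] K nc(2) unfolding W_def D_def d_def c_def s_def by simp
    \<comment> \<open>Each step adds an error \<open>D\<close> and multiplies the previous one by at
      most \<open>a\<close>; over \<open>n\<close> steps the factors amount to
      \<open>a ^ n = exp c\<close>.\<close>
    have "cmod (e k y - 1) \<le> real k * D * a ^ k" for k y
    proof (induction k arbitrary: y)
      case 0
      then show ?case by (simp add: e_def seq.P.prob_space)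
    next
      case (Suc k)
      have "e (Suc k) y - 1 = (\<Sum>i<N. p i *\<^sub>R (exp (W y i) * (e k (f i y) - 1))) + ((\<Sum>i<N. p i *\<^sub>R exp (W y i)) - 1)"
        unfolding e_def integral_exp_addfun_Suc[OF admW]
        by (simp add: right_diff_distrib scaleR_diff_right sum_subtractf)
      also have "cmod \<dots> \<le> cmod (\<Sum>i<N. p i *\<^sub>R (exp (W y i) * (e k (f i y) - 1))) + D"
        using step[of y] by (intro order_trans[OF norm_triangle_ineq] add_left_mono)
      also have "cmod (\<Sum>i<N. p i *\<^sub>R (exp (W y i) * (e k (f i y) - 1))) \<le> (\<Sum>i<N. p i * (a * (real k * D * a ^ k)))"
      proof (rule sum_norm_le)
        fix i assume "i \<in> {..<N}"
        then have pi: "0 \<le> p i" using p_pos[of i] by simp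
        have "cmod (exp (W y i)) \<le> a" using ReW[of y i] by (simp add: a_def)
        then have "cmod (exp (W y i)) * cmod (e k (f i y) - 1) \<le> a * (real k * D * a ^ k)"
          using D by (intro mult_mono Suc.IH) auto
        then show "cmod (p i *\<^sub>R (exp (W y i) * (e k (f i y) - 1))) \<le> p i * (a * (real k * D * a ^ k))"
          using pi by (simp add: norm_mult mult_left_mono)
      qed
      also have "\<dots> = real k * D * a ^ Suc k" by (simp add: p_sum flip: sum_distrib_right)
      also have "real k * D * a ^ Suc k + D \<le> real k * D * a ^ Suc k + D * a ^ Suc k"
        using D mult_left_mono[OF one_le_power[OF D(2), of "Suc k"] D(1)] by simp
      finally show ?case by (simp add: algebra_simps)
    qed
    then have "cmod (e n x - 1) \<le> real n * D * a ^ n" .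
    also have "\<dots> = d * exp c / s"
    proof -
      have "a ^ n = exp c" unfolding a_def by (subst exp_of_nat_mult[symmetric]) (use nc in simp)
      then show ?thesis using nc by (simp add: D_def)
    qed
    finally have e_n: "cmod (e n x - 1) \<le> d * exp c / s" .
    define A where "A \<omega> = addfun (\<lambda>y _. qv u y) n x \<omega>" for \<omega>
    define M where "M \<omega> = addfun (mg u) n x \<omega>" for \<omega>
    define X where "X = (\<integral>\<omega>. iexp (t / s * M \<omega>) \<partial>\<Omega>)"
    have expW: "exp (addfun W n x \<omega>) = iexp (t / s * M \<omega>) * complex_of_real (exp (t\<^sup>2 / (2 * real n) * A \<omega>))" for \<omega>
    proof -
      have "addfun W n x \<omega> = \<i> * complex_of_real (t / s * M \<omega>) + complex_of_real (t\<^sup>2 / (2 * real n) * A \<omega>)"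
        by (simp add: addfun_def W_def M_def A_def sum.distrib sum_distrib_left)
      then show ?thesis by (simp only: exp_add exp_of_real)
    qed
    have Mm [measurable]: "M \<in> borel_measurable \<Omega>" unfolding M_def by (rule measurable_addfun[OF w])
    have admq: "admissible_weight (\<lambda>y (_::nat). qv u y) (K\<^sup>2)"
      unfolding admissible_weight_def using measurable_qv[OF u] qv_le[OF w] qv_nonneg by simp
    have Am [measurable]: "A \<in> borel_measurable \<Omega>" unfolding A_def by (rule measurable_addfun[OF admq])
    have Ab: "0 \<le> A \<omega>" "A \<omega> \<le> real n * K\<^sup>2" for \<omega>
      unfolding A_def using addfun_qv_le[OF w] by auto
    have cA: "t\<^sup>2 / (2 * real n) * A \<omega> \<le> c" for \<omega>
    proof -
      have "t\<^sup>2 / (2 * real n) * A \<omega> \<le> t\<^sup>2 / (2 * real n) * (real n * K\<^sup>2)" by (intro mult_left_mono Ab) simp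
      then show ?thesis using nc by (simp add: c_def)
    qed
    have c\<sigma>: "t\<^sup>2 * ?\<sigma> / 2 \<le> c" using \<sigma> by (simp add: c_def mult_left_mono)
    have iX: "integrable \<Omega> (\<lambda>\<omega>. iexp (t / s * M \<omega>))"
      by (intro seq.P.integrable_const_bound[where B=1]) auto
    have iE: "integrable \<Omega> (\<lambda>\<omega>. exp (addfun W n x \<omega>))"
      unfolding expW
      by (intro seq.P.integrable_const_bound[where B="exp c"]) (use cA in \<open>auto simp: norm_mult\<close>)
    \<comment> \<open>Deterministic counterpart of the compensator. Both exponents are at most
      \<open>c\<close>, and they differ by \<open>t\<^sup>2 / 2\<close> times the centred sum of
      \<open>qv u\<close> divided by \<open>n\<close>.\<close>
    let ?E = "exp (t\<^sup>2 * ?\<sigma> / 2)"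
    have "cmod (X * ?E - e n x) = cmod (\<integral>\<omega>. iexp (t / s * M \<omega>) * ?E - exp (addfun W n x \<omega>) \<partial>\<Omega>)"
      using iX iE by (simp add: X_def e_def)
    also have "\<dots> \<le> (\<integral>\<omega>. exp c * (t\<^sup>2 / 2) * (\<bar>centered_sum f \<nu> (qv u) n x \<omega>\<bar> / real n) \<partial>\<Omega>)"
    proof (rule order_trans[OF integral_norm_bound integral_mono])
      show "integrable \<Omega> (\<lambda>\<omega>. cmod (iexp (t / s * M \<omega>) * ?E - exp (addfun W n x \<omega>)))"
        using iX iE by simp
      show "integrable \<Omega> (\<lambda>\<omega>. exp c * (t\<^sup>2 / 2) * (\<bar>centered_sum f \<nu> (qv u) n x \<omega>\<bar> / real n))"
        using G(2)[of n x] nc by simp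
      fix \<omega>
      have "iexp (t / s * M \<omega>) * ?E - exp (addfun W n x \<omega>)
          = iexp (t / s * M \<omega>) * complex_of_real (?E - exp (t\<^sup>2 / (2 * real n) * A \<omega>))"
        by (simp add: expW right_diff_distrib)
      also have "cmod \<dots> = \<bar>?E - exp (t\<^sup>2 / (2 * real n) * A \<omega>)\<bar>"
        by (simp only: norm_mult norm_exp_i_times norm_of_real mult_1)
      also have "\<dots> \<le> exp c * \<bar>t\<^sup>2 * ?\<sigma> / 2 - t\<^sup>2 / (2 * real n) * A \<omega>\<bar>"
        by (rule abs_exp_diff_le[OF c\<sigma> cA])
      also have "t\<^sup>2 * ?\<sigma> / 2 - t\<^sup>2 / (2 * real n) * A \<omega> = - (t\<^sup>2 / 2) * (centered_sum f \<nu> (qv u) n x \<omega> / real n)"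
        using nc by (simp add: centered_sum_def A_def addfun_def field_simps)
      also have "\<bar>\<dots>\<bar> = t\<^sup>2 / 2 * (\<bar>centered_sum f \<nu> (qv u) n x \<omega>\<bar> / real n)"
        by (simp add: abs_mult)
      finally show "cmod (iexp (t / s * M \<omega>) * ?E - exp (addfun W n x \<omega>))
          \<le> exp c * (t\<^sup>2 / 2) * (\<bar>centered_sum f \<nu> (qv u) n x \<omega>\<bar> / real n)" by (simp add: mult_ac)
    qed
    also have "\<dots> = exp c * (t\<^sup>2 / 2) * ((\<integral>\<omega>. \<bar>centered_sum f \<nu> (qv u) n x \<omega>\<bar> \<partial>\<Omega>) / real n)"
      by simp
    also have "\<dots> \<le> exp c * (t\<^sup>2 / 2) * (G * s / real n)"
      using G(3)[of n x] nc unfolding s_def by (intro mult_left_mono divide_right_mono) auto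
    also have "G * s / real n = G / s" using s by (simp flip: s(2))
    finally have XE: "cmod (X * ?E - e n x) \<le> exp c * (t\<^sup>2 / 2) * G / s" by simp
    have "cmod (X * ?E - 1) \<le> cmod (X * ?E - e n x) + cmod (e n x - 1)"
      using norm_triangle_ineq[of "X * ?E - e n x" "e n x - 1"] by simp
    also have "\<dots> \<le> (d * exp c + exp c * (t\<^sup>2 / 2) * G) / s"
      using XE e_n by (simp add: add_divide_distrib)
    finally have fin: "cmod (X * ?E - 1) \<le> (d * exp c + exp c * (t\<^sup>2 / 2) * G) / s" .
    have "X - complex_of_real (exp (- (t\<^sup>2 * ?\<sigma> / 2))) = (X * ?E - 1) * complex_of_real (exp (- (t\<^sup>2 * ?\<sigma> / 2)))"
    proof -
      have "complex_of_real ?E * complex_of_real (exp (- (t\<^sup>2 * ?\<sigma> / 2))) = 1"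
        by (simp flip: of_real_mult exp_add)
      then show ?thesis by (simp add: left_diff_distrib mult.assoc)
    qed
    also have "cmod \<dots> = cmod (X * ?E - 1) * exp (- (t\<^sup>2 * ?\<sigma> / 2))"
      by (simp only: norm_mult norm_of_real abs_exp_cancel)
    also have "\<dots> \<le> cmod (X * ?E - 1) * 1"
      using \<sigma> by (intro mult_left_mono) auto
    finally show ?thesis using fin by (simp add: X_def M_def s_def)
  qed
  then show ?thesis by blast
qed

text \<open>The starting point may vary with \<open>n\<close>, which later gives tail bounds uniform
  in the start by contradiction. The bounded discrepancy \<open>c\<close> admits the centred sums in
  place of the martingale.\<close>

theorem central_limit_mg:
  assumes u: "regular u" and Y: "\<And>n. Y n \<in> borel_measurable \<Omega>"
    and close: "\<And>n \<omega>. \<bar>Y n \<omega> - addfun (mg u) n (x n) \<omega>\<bar> \<le> c"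
  shows "weak_conv_m (\<lambda>n. distr \<Omega> borel (\<lambda>\<omega>. 1 / sqrt (real n) * Y n \<omega>)) (normal_law (integral\<^sup>L \<nu> (qv u)))"
proof (rule levy_continuity)
  let ?\<sigma> = "integral\<^sup>L \<nu> (qv u)"
  have \<sigma>: "0 \<le> ?\<sigma>" by (intro integral_nonneg_AE) (simp add: qv_nonneg)
  note [measurable] = Y
  obtain K where K: "1 \<le> K" and w: "admissible_weight (mg u) K" using mg_weight[OF u] by auto
  show "real_distribution (distr \<Omega> borel (\<lambda>\<omega>. 1 / sqrt (real n) * Y n \<omega>))" for n
  proof (rule seq.P.real_distribution_distr)
    show "(\<lambda>\<omega>. 1 / sqrt (real n) * Y n \<omega>) \<in> borel_measurable \<Omega>"
      by (intro borel_measurable_times borel_measurable_const Y)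
  qed
  show "real_distribution (normal_law ?\<sigma>)" by (rule real_distribution_normal_law[OF \<sigma>])
  fix t :: real
  from char_mg_estimate[OF u, of t] obtain C where
    "\<exists>n0. \<forall>n\<ge>n0. \<forall>y. cmod ((\<integral>\<omega>. iexp (t / sqrt (real n) * addfun (mg u) n y \<omega>) \<partial>\<Omega>)
      - complex_of_real (exp (- (t\<^sup>2 * ?\<sigma> / 2)))) \<le> C / sqrt (real n)" ..
  then obtain n0 where
    C: "\<forall>n\<ge>n0. \<forall>y. cmod ((\<integral>\<omega>. iexp (t / sqrt (real n) * addfun (mg u) n y \<omega>) \<partial>\<Omega>)
      - complex_of_real (exp (- (t\<^sup>2 * ?\<sigma> / 2)))) \<le> C / sqrt (real n)"
    ..
  let ?char = "\<lambda>n. char (distr \<Omega> borel (\<lambda>\<omega>. 1 / sqrt (real n) * Y n \<omega>)) t"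
  let ?L = "complex_of_real (exp (- (?\<sigma> * t\<^sup>2 / 2)))"
  have "eventually (\<lambda>n. norm (?char n - ?L) \<le> (\<bar>t\<bar> * c + C) / sqrt (real n)) sequentially"
    using eventually_ge_at_top[of n0]
  proof eventually_elim
    case (elim n)
    define M where "M = addfun (mg u) n (x n)"
    define r where "r = t / sqrt (real n)"
    have [measurable]: "M \<in> borel_measurable \<Omega>" unfolding M_def by (rule measurable_addfun[OF w])
    have ch: "?char n = (\<integral>\<omega>. iexp (r * Y n \<omega>) \<partial>\<Omega>)"
    proof -
      have "?char n = (\<integral>\<omega>. iexp (t * (1 / sqrt (real n) * Y n \<omega>)) \<partial>\<Omega>)"
        unfolding char_def by (rule integral_distr) measurable
      then show ?thesis by (simp add: r_def)
    qed
    have iY: "integrable \<Omega> (\<lambda>\<omega>. iexp (r * Y n \<omega>))"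
      by (intro seq.P.integrable_const_bound[where B=1]) auto
    have iM: "integrable \<Omega> (\<lambda>\<omega>. iexp (r * M \<omega>))"
      by (intro seq.P.integrable_const_bound[where B=1]) auto
    have "cmod (?char n - (\<integral>\<omega>. iexp (r * M \<omega>) \<partial>\<Omega>)) = cmod (\<integral>\<omega>. iexp (r * Y n \<omega>) - iexp (r * M \<omega>) \<partial>\<Omega>)"
      unfolding ch using iY iM by simp
    also have "\<dots> \<le> (\<integral>\<omega>. \<bar>r\<bar> * c \<partial>\<Omega>)"
    proof (rule order_trans[OF integral_norm_bound integral_mono])
      show "integrable \<Omega> (\<lambda>\<omega>. cmod (iexp (r * Y n \<omega>) - iexp (r * M \<omega>)))" using iY iM by simp
      fix \<omega>
      have "iexp (r * Y n \<omega>) - iexp (r * M \<omega>) = iexp (r * M \<omega>) * (iexp (r * (Y n \<omega> - M \<omega>)) - 1)"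
      proof -
        have "iexp (r * Y n \<omega>) = iexp (r * M \<omega>) * iexp (r * (Y n \<omega> - M \<omega>))"
          by (subst exp_add[symmetric]) (simp add: algebra_simps)
        then show ?thesis by (simp add: right_diff_distrib)
      qed
      also have "cmod \<dots> = cmod (iexp (r * (Y n \<omega> - M \<omega>)) - 1)"
        by (simp only: norm_mult norm_exp_i_times mult_1)
      also have "\<dots> \<le> \<bar>r * (Y n \<omega> - M \<omega>)\<bar>"
        using iexp_approx1[of "r * (Y n \<omega> - M \<omega>)" 0] by simp
      also have "\<dots> \<le> \<bar>r\<bar> * c" using close[of n \<omega>] unfolding M_def by (simp add: abs_mult mult_left_mono)
      finally show "cmod (iexp (r * Y n \<omega>) - iexp (r * M \<omega>)) \<le> \<bar>r\<bar> * c" .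
    qed simp
    also have "\<dots> = \<bar>t\<bar> * c / sqrt (real n)" by (simp add: r_def seq.P.prob_space)
    finally have 1: "cmod (?char n - (\<integral>\<omega>. iexp (r * M \<omega>) \<partial>\<Omega>)) \<le> \<bar>t\<bar> * c / sqrt (real n)" .
    have 2: "cmod ((\<integral>\<omega>. iexp (r * M \<omega>) \<partial>\<Omega>) - ?L) \<le> C / sqrt (real n)"
      using C[rule_format, OF elim, of "x n"] unfolding r_def M_def by (simp only: mult.commute[of ?\<sigma> "t\<^sup>2"])
    show ?case
      using norm_triangle_le[OF add_mono[OF 1 2]] by (simp add: add_divide_distrib)
  qed
  moreover have "(\<lambda>n. (\<bar>t\<bar> * c + C) / sqrt (real n)) \<longlonglongrightarrow> 0" by real_asymp
  ultimately have "(\<lambda>n. ?char n - ?L) \<longlonglongrightarrow> 0" by (rule Lim_null_comparison)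
  then show "?char \<longlonglongrightarrow> char (normal_law ?\<sigma>) t"
    unfolding char_normal_law[OF \<sigma>] by (rule LIM_zero_cancel)
qed

end

section \<open>The law of the iterated logarithm: upper bound\<close>

text \<open>The parameter \<open>h\<close> is optimal at the left end \<open>t\<close> of a block.
  At a time \<open>n\<close> exceeding \<open>t\<close> by at most the factor
  \<open>r\<^sup>2\<close> it is too large by at most the factor \<open>r\<close>.\<close>

lemma block_parameter_bound:
  fixes h v n t r q :: real
  assumes h: "h\<^sup>2 * v * t = 2 * q" and n: "n \<le> r\<^sup>2 * t" "0 \<le> n" and v: "0 \<le> v" and r: "0 \<le> r"
  shows "h * v * n \<le> r * sqrt (v * (2 * n * q))"
proof -
  have "(h * v * n)\<^sup>2 = (h\<^sup>2 * v) * n * (v * n)"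
    unfolding power2_eq_square by (simp only: mult_ac)
  also have "\<dots> \<le> (h\<^sup>2 * v) * (r\<^sup>2 * t) * (v * n)"
  proof (rule mult_right_mono)
    show "(h\<^sup>2 * v) * n \<le> (h\<^sup>2 * v) * (r\<^sup>2 * t)" by (rule mult_left_mono[OF n(1)]) (simp add: v)
    show "0 \<le> v * n" using v n by simp
  qed
  also have "\<dots> = r\<^sup>2 * (h\<^sup>2 * v * t) * (v * n)" by (simp only: mult_ac)
  also have "\<dots> = r\<^sup>2 * (v * (2 * n * q))" unfolding h by (simp only: mult_ac)
  finally have "h * v * n \<le> sqrt (r\<^sup>2 * (v * (2 * n * q)))" by (rule real_le_rsqrt)
  then show ?thesis using r by (simp only: real_sqrt_mult[of "r\<^sup>2"] real_sqrt_abs abs_of_nonneg)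
qed

context contracting_walk
begin

lemma integral_qv_nonneg: "0 \<le> integral\<^sup>L \<nu> (qv u)"
  by (intro integral_nonneg_AE) (simp add: qv_nonneg)

lemma addfun_qv_eventually_le:
  assumes u: "regular u" and v: "integral\<^sup>L \<nu> (qv u) < v"
  shows "AE \<omega> in \<Omega>. eventually (\<lambda>n. addfun (\<lambda>y _. qv u y) n x \<omega> \<le> v * real n) sequentially"
  using strong_law[OF regular_qv[OF u], of x]
proof eventually_elim
  case (elim \<omega>)
  have "eventually (\<lambda>n. (\<Sum>k<n. qv u (orbit f \<omega> k x)) / real n < v) sequentially"
    using elim v by (rule order_tendstoD)
  moreover have "eventually (\<lambda>n. 0 < n) sequentially" by (rule eventually_gt_at_top)
  ultimately show ?case
  proof eventually_elim
    case (elim n)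
    then show ?case by (simp add: addfun_def pos_divide_less_eq)
  qed
qed

text \<open>
  On the block \<open>\<theta> ^ k \<le> n \<le> \<theta> ^ (k + 1)\<close> the maximal inequality is used with the parameter \<open>l\<close>
  for which \<open>l\<^sup>2 * v * \<theta> ^ k = 2 * ln k\<close>.
\<close>

lemma lil_upper:
  assumes u: "regular u" and c: "sqrt (integral\<^sup>L \<nu> (qv u)) < c"
  shows "AE \<omega> in \<Omega>. eventually (\<lambda>n. addfun (mg u) n x \<omega> \<le> c * sqrt (2 * real n * ln (ln (real n)))) sequentially"
proof -
  let ?\<sigma> = "integral\<^sup>L \<nu> (qv u)"
  note \<sigma> = integral_qv_nonneg[of u]
  obtain K where K: "1 \<le> K" and w: "admissible_weight (mg u) K" using mg_weight[OF u] by auto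
  have c0: "0 < c" using c real_sqrt_ge_zero[OF \<sigma>] by linarith
  have "(sqrt ?\<sigma>)\<^sup>2 < c\<^sup>2" using c \<sigma> by (intro power_strict_mono) auto
  then have \<sigma>c: "?\<sigma> < c\<^sup>2" using \<sigma> by simp
  \<comment> \<open>Strictly above the mean of \<open>qv u\<close>, so the strong law bounds the
    compensator by \<open>v * n\<close> eventually; strictly below \<open>c\<^sup>2\<close>, which
    leaves room for \<open>r > 1\<close>.\<close>
  define v where "v = (?\<sigma> + c\<^sup>2) / 2"
  have v: "0 < v" "?\<sigma> < v" "v < c\<^sup>2" using \<sigma>c \<sigma> by (auto simp: v_def)
  have "sqrt v < sqrt (c\<^sup>2)" using v(3) by (rule real_sqrt_less_mono)
  then have sv: "0 < sqrt v" "sqrt v < c" using v(1) c0 by auto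
  \<comment> \<open>A cube root because a factor \<open>r\<close> is lost three times: through
    threshold and compensator, through the block length \<open>\<theta> = r\<^sup>2\<close>, and
    through comparing \<open>ln k\<close> with \<open>ln (ln n)\<close>.\<close>
  define r where "r = root 3 (c / sqrt v)"
  have r: "1 < r" "c = r ^ 3 * sqrt v"
  proof -
    show "1 < r" unfolding r_def using sv by (subst real_root_gt_1_iff) auto
    have "r ^ 3 = c / sqrt v" unfolding r_def using sv c0 by (intro real_root_pow_pos2) auto
    then show "c = r ^ 3 * sqrt v" using sv by simp
  qed
  define \<theta> where "\<theta> = r\<^sup>2"
  have \<theta>: "1 < \<theta>" "0 < ln \<theta>" using r(1) by (auto simp: \<theta>_def one_less_power)
  define l where "l k = sqrt (2 * ln (real k) / (v * \<theta> ^ k))" for k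
  have l0: "0 \<le> l k" for k
    using v \<theta> by (cases "k = 0") (auto simp: l_def)
  have llim: "l \<longlonglongrightarrow> 0"
  proof -
    have "(\<lambda>k. 2 * ln (real k) / (v * \<theta> ^ k)) \<longlonglongrightarrow> 0" using v(1) \<theta>(1) by real_asymp
    then have "(\<lambda>k. sqrt (2 * ln (real k) / (v * \<theta> ^ k))) \<longlonglongrightarrow> sqrt 0" by (rule tendsto_real_sqrt)
    then show ?thesis by (simp add: l_def[abs_def])
  qed
  have ev_l: "eventually (\<lambda>k. l k * K \<le> 1 \<and> 2 * K * l k \<le> r - 1) sequentially"
  proof -
    have "0 < min (1 / K) ((r - 1) / (2 * K))" using K r by auto
    from order_tendstoD(2)[OF llim this] show ?thesis
    proof eventually_elim
      case (elim k)
      then show ?case using K by (simp add: pos_less_divide_eq mult_ac less_imp_le)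
    qed
  qed
  \<comment> \<open>The threshold \<open>r * ln k\<close> gives probability at most
    \<open>k powr (- r)\<close>, which is summable as \<open>r > 1\<close>.\<close>
  define E' where "E' k = {\<omega> \<in> space \<Omega>. \<exists>j\<le>nat \<lfloor>\<theta> ^ (k + 1)\<rfloor>. r * ln (real k) \<le> l k * addfun (mg u) j x \<omega>
    - (l k)\<^sup>2 / 2 * (1 + 2 * K * l k) * addfun (\<lambda>y _. qv u y) j x \<omega>}" for k
  have admq: "admissible_weight (\<lambda>y (_::nat). qv u y) (K\<^sup>2)"
    unfolding admissible_weight_def using measurable_qv[OF u] qv_le[OF w] qv_nonneg by simp
  have E': "E' k \<in> sets \<Omega>" for k
  proof -
    note [measurable] = measurable_addfun[OF admq, of _ x] measurable_addfun[OF w, of _ x]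
    show ?thesis unfolding E'_def by measurable
  qed
  have "eventually (\<lambda>k. norm (measure \<Omega> (E' k)) \<le> real k powr (- r)) sequentially"
    using ev_l eventually_ge_at_top[of 1]
  proof eventually_elim
    case (elim k)
    have "measure \<Omega> (E' k) \<le> exp (- (r * ln (real k)))"
      unfolding E'_def by (rule mg_maximal_inequality[OF u w l0]) (use elim in simp)
    also have "\<dots> = real k powr (- r)" using elim by (simp add: powr_def)
    finally show ?case by simp
  qed
  then have "summable (\<lambda>k. measure \<Omega> (E' k))"
    by (rule summable_comparison_test_ev) (use r in \<open>simp add: summable_real_powr_iff\<close>)
  then have bc: "AE \<omega> in \<Omega>. eventually (\<lambda>k. \<omega> \<in> space \<Omega> - E' k) sequentially"
    by (intro borel_cantelli_AE1 E') (simp add: seq.P.emeasure_eq_measure)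
  \<comment> \<open>Index of the block containing \<open>n\<close>.\<close>
  define \<kappa>' where "\<kappa>' n = nat \<lfloor>ln (real n) / ln \<theta>\<rfloor>" for n :: nat
  have k_lim: "filterlim \<kappa>' sequentially sequentially"
  proof -
    have "filterlim (\<lambda>n. ln (real n) / ln \<theta>) at_top sequentially" using \<theta>(2) by real_asymp
    then show ?thesis unfolding \<kappa>'_def
      by (rule filterlim_compose[OF filterlim_nat_sequentially filterlim_compose[OF filterlim_floor_sequentially]])
  qed
  have k_bounds: "\<theta> ^ \<kappa>' n \<le> real n \<and> real n \<le> \<theta> ^ (\<kappa>' n + 1) \<and> real (\<kappa>' n) \<le> ln (real n) / ln \<theta>" if n: "1 \<le> n" for n
  proof -
    have q: "0 \<le> ln (real n) / ln \<theta>" using n \<theta> by simp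
    then have k: "real (\<kappa>' n) \<le> ln (real n) / ln \<theta>" "ln (real n) / ln \<theta> \<le> real (\<kappa>' n + 1)"
      unfolding \<kappa>'_def by linarith+
    have "\<theta> ^ \<kappa>' n = exp (real (\<kappa>' n) * ln \<theta>)" using \<theta> by (simp add: exp_of_nat_mult)
    also have "\<dots> \<le> exp (ln (real n))" using k(1) \<theta> by (simp add: pos_le_divide_eq)
    finally have 1: "\<theta> ^ \<kappa>' n \<le> real n" using n by simp
    have "real n = exp (ln (real n))" using n by simp
    also have "\<dots> \<le> exp (real (\<kappa>' n + 1) * ln \<theta>)" using k(2) \<theta> by (simp add: pos_divide_le_eq)
    also have "\<dots> = \<theta> ^ (\<kappa>' n + 1)" using \<theta> exp_of_nat_mult[of "\<kappa>' n + 1" "ln \<theta>"] by simp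
    finally show ?thesis using 1 k(1) by simp
  qed
  \<comment> \<open>\<open>ln (\<kappa>' n)\<close> exceeds \<open>ln (ln n)\<close> by at most the
    constant \<open>- ln (ln \<theta>)\<close>, which the factor \<open>r\<^sup>2 > 1\<close>
    absorbs.\<close>
  have ln_k: "eventually (\<lambda>n. ln (real (\<kappa>' n)) \<le> r\<^sup>2 * ln (ln (real n))) sequentially"
  proof -
    have "1 < r\<^sup>2" using r(1) by (simp add: one_less_power)
    then have "eventually (\<lambda>n. - ln (ln \<theta>) \<le> (r\<^sup>2 - 1) * ln (ln (real n))) sequentially" by real_asymp
    moreover have "eventually (\<lambda>n::nat. 2 \<le> n) sequentially" by (rule eventually_ge_at_top)
    moreover have "eventually (\<lambda>n. 1 \<le> \<kappa>' n) sequentially"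
      using k_lim by (auto simp: filterlim_at_top)
    ultimately show ?thesis
    proof eventually_elim
      case (elim n)
      then have ln0: "0 < ln (real n)" by simp
      have "ln (real (\<kappa>' n)) \<le> ln (ln (real n) / ln \<theta>)"
        using k_bounds[of n] elim by simp
      also have "\<dots> = ln (ln (real n)) - ln (ln \<theta>)" using ln0 \<theta> by (simp add: ln_div)
      also have "\<dots> \<le> r\<^sup>2 * ln (ln (real n))" using elim(1) by (simp add: algebra_simps)
      finally show ?case .
    qed
  qed
  show ?thesis
    using bc addfun_qv_eventually_le[OF u v(2), of x]
  proof eventually_elim
    case (elim \<omega>)
    have "eventually (\<lambda>k. \<omega> \<in> space \<Omega> - E' k \<and> (l k * K \<le> 1 \<and> 2 * K * l k \<le> r - 1) \<and> 2 \<le> k) sequentially"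
      by (intro eventually_conj elim(1) ev_l eventually_ge_at_top)
    then have "eventually (\<lambda>n. \<omega> \<in> space \<Omega> - E' (\<kappa>' n) \<and> (l (\<kappa>' n) * K \<le> 1 \<and> 2 * K * l (\<kappa>' n) \<le> r - 1) \<and> 2 \<le> \<kappa>' n) sequentially"
      using k_lim by (rule eventually_compose_filterlim)
    moreover have "eventually (\<lambda>n::nat. 2 \<le> n) sequentially" by (rule eventually_ge_at_top)
    ultimately show ?case
      using elim(2) ln_k
    proof eventually_elim
      case (elim n)
      define k where "k = \<kappa>' n"
      define t where "t = \<theta> ^ k"
      define A where "A = addfun (\<lambda>y _. qv u y) n x \<omega>"
      define M where "M = addfun (mg u) n x \<omega>"
      define h where "h = l k"
      have kb: "t \<le> real n" "real n \<le> \<theta> * t" "real n \<le> \<theta> ^ (k + 1)"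
        using k_bounds[of n] elim by (auto simp: k_def t_def)
      have t: "0 < t" using \<theta> by (simp add: t_def)
      have lnk: "0 < ln (real k)" using elim by (simp add: k_def)
      have h: "0 < h" "h\<^sup>2 * v * t = 2 * ln (real k)" "2 * K * h \<le> r - 1"
      proof -
        have pos: "0 < 2 * ln (real k) / (v * t)" using lnk v t by simp
        then show "0 < h" by (simp add: h_def l_def t_def)
        have "h\<^sup>2 = 2 * ln (real k) / (v * t)" using pos by (simp add: h_def l_def t_def)
        then show "h\<^sup>2 * v * t = 2 * ln (real k)" using v t by simp
        show "2 * K * h \<le> r - 1" using elim by (simp add: h_def k_def)
      qed
      have nk: "n \<le> nat \<lfloor>\<theta> ^ (k + 1)\<rfloor>" using kb(3) by linarith
      have \<omega>: "\<omega> \<in> space \<Omega>" "\<omega> \<notin> E' k" using elim by (auto simp: k_def)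
      have 1: "h * M - h\<^sup>2 / 2 * (1 + 2 * K * h) * A < r * ln (real k)"
      proof (rule ccontr)
        assume "\<not> ?thesis"
        then have "r * ln (real k) \<le> h * M - h\<^sup>2 / 2 * (1 + 2 * K * h) * A" by (simp only: not_less)
        then have "\<omega> \<in> E' k"
          unfolding E'_def M_def A_def h_def using nk \<omega>(1) by (intro CollectI conjI exI[of _ n])
        then show False using \<omega>(2) by simp
      qed
      have 2: "h\<^sup>2 / 2 * (1 + 2 * K * h) * A \<le> h\<^sup>2 / 2 * r * (v * real n)"
      proof (intro mult_mono)
        show "1 + 2 * K * h \<le> r" using h(3) by simp
        show "A \<le> v * real n" using elim by (simp add: A_def)
        show "0 \<le> A" unfolding A_def by (rule addfun_qv_le[OF w])
      qed (use h K r in auto)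
      have "r * ln (real k) = h\<^sup>2 / 2 * r * (v * t)"
      proof -
        have "h\<^sup>2 / 2 * r * (v * t) = r * (h\<^sup>2 * v * t) / 2" by simp
        also have "\<dots> = r * ln (real k)" unfolding h(2) by simp
        finally show ?thesis by (rule sym)
      qed
      also have "\<dots> \<le> h\<^sup>2 / 2 * r * (v * real n)"
        using kb(1) v r by (intro mult_left_mono) auto
      finally have 3: "r * ln (real k) \<le> h\<^sup>2 / 2 * r * (v * real n)" .
      have "a \<le> W + W" if "a - b < d" "b \<le> W" "d \<le> W" for a b d W :: real
        using that by linarith
      note le = this[OF 1 2 3]
      have "W / 2 * r * (v * y) + W / 2 * r * (v * y) = W * (r * v * y)" for W y by (simp add: field_simps)
      from le[unfolded this] have "h * M \<le> h * (h * r * v * real n)"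
        unfolding power2_eq_square by (simp only: mult.assoc)
      then have M1: "M \<le> h * r * v * real n" using h(1) by (rule mult_left_le_imp_le)
      have "h * v * real n \<le> r * sqrt (v * (2 * real n * ln (real k)))"
        by (rule block_parameter_bound[OF h(2)]) (use kb(2) v r in \<open>auto simp: \<theta>_def\<close>)
      also have "\<dots> \<le> r * sqrt (v * (2 * real n * (r\<^sup>2 * ln (ln (real n)))))"
      proof (intro mult_left_mono real_sqrt_le_mono)
        show "ln (real k) \<le> r\<^sup>2 * ln (ln (real n))" using elim(4) by (simp only: k_def)
      qed (use v r in auto)
      also have "v * (2 * real n * (r\<^sup>2 * ln (ln (real n)))) = r\<^sup>2 * (v * (2 * real n * ln (ln (real n))))" by simp
      also have "sqrt \<dots> = r * (sqrt v * sqrt (2 * real n * ln (ln (real n))))"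
        unfolding real_sqrt_mult[of "r\<^sup>2"] real_sqrt_mult[of v] using r by simp
      finally have hv: "h * v * real n \<le> r * (r * (sqrt v * sqrt (2 * real n * ln (ln (real n)))))" .
      have "h * r * v * real n = r * (h * v * real n)" by simp
      with M1 have "M \<le> r * (h * v * real n)" by (simp only:)
      also have "\<dots> \<le> r * (r * (r * (sqrt v * sqrt (2 * real n * ln (ln (real n))))))"
        using hv r by (intro mult_left_mono) auto
      also have "\<dots> = c * sqrt (2 * real n * ln (ln (real n)))"
        unfolding r(2) by (simp add: power3_eq_cube)
      finally show ?case by (simp add: M_def)
    qed
  qed
qed

subsection \<open>The Markov property at a fixed time\<close>

lemma shift_measurable: "(\<lambda>\<omega> j. \<omega> (n + j)) \<in> \<Omega> \<rightarrow>\<^sub>M \<Omega>"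
  by (rule measurable_abs_UNIV) (rule coord_measurable)

text \<open>Splicing the first \<open>n\<close> letters of one Bernoulli sequence to an independent
  second one gives a Bernoulli sequence, and Fubini separates the two. The condition
  \<open>pre\<close> says that \<open>Q\<close> depends on the first \<open>n\<close> letters
  only.\<close>

lemma markov_property:
  fixes R :: "circle \<Rightarrow> (nat \<Rightarrow> nat) \<Rightarrow> bool"
  assumes Q: "{\<omega> \<in> space \<Omega>. Q \<omega>} \<in> sets \<Omega>" and pre: "\<And>\<omega> \<omega>'. Q (comb_seq n \<omega> \<omega>') \<longleftrightarrow> Q \<omega>"
    and R: "{z \<in> space (borel \<Otimes>\<^sub>M \<Omega>). R (fst z) (snd z)} \<in> sets (borel \<Otimes>\<^sub>M \<Omega>)"
  shows "measure \<Omega> {\<omega> \<in> space \<Omega>. Q \<omega> \<and> R (orbit f \<omega> n x) (\<lambda>j. \<omega> (n + j))}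
    = (\<integral>\<omega>. indicator {\<omega> \<in> space \<Omega>. Q \<omega>} \<omega> * measure \<Omega> {\<omega>' \<in> space \<Omega>. R (orbit f \<omega> n x) \<omega>'} \<partial>\<Omega>)"
    and "{\<omega> \<in> space \<Omega>. Q \<omega> \<and> R (orbit f \<omega> n x) (\<lambda>j. \<omega> (n + j))} \<in> sets \<Omega>"
    and "{\<omega>' \<in> space \<Omega>. R y \<omega>'} \<in> sets \<Omega>"
proof -
  interpret pr: pair_prob_space \<Omega> \<Omega> ..
  let ?Z = "{\<omega> \<in> space \<Omega>. Q \<omega> \<and> R (orbit f \<omega> n x) (\<lambda>j. \<omega> (n + j))}"
  let ?Q = "{\<omega> \<in> space \<Omega>. Q \<omega>}"
  have shift_space: "(\<lambda>j. \<omega> (n + j)) \<in> space \<Omega>" if "\<omega> \<in> space \<Omega>" for \<omega>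
    using that by (simp add: space_Omega)
  have m: "(\<lambda>\<omega>. (orbit f \<omega> n x, \<lambda>j. \<omega> (n + j))) \<in> \<Omega> \<rightarrow>\<^sub>M borel \<Otimes>\<^sub>M \<Omega>"
    by (rule measurable_Pair[OF measurable_orbit shift_measurable])
  have "?Z = ?Q \<inter> ((\<lambda>\<omega>. (orbit f \<omega> n x, \<lambda>j. \<omega> (n + j))) -` {z \<in> space (borel \<Otimes>\<^sub>M \<Omega>). R (fst z) (snd z)} \<inter> space \<Omega>)"
    using shift_space by (auto simp: space_pair_measure)
  then show Z: "?Z \<in> sets \<Omega>" using Q measurable_sets[OF m R] by auto
  have Ry: "{\<omega>' \<in> space \<Omega>. R y \<omega>'} \<in> sets \<Omega>" for y
  proof -
    have "(\<lambda>\<omega>. (y, \<omega>)) \<in> \<Omega> \<rightarrow>\<^sub>M borel \<Otimes>\<^sub>M \<Omega>" by (rule measurable_Pair1') simp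
    from measurable_sets[OF this R]
    show ?thesis by (simp add: vimage_def space_pair_measure Int_def conj_commute cong: conj_cong)
  qed
  then show "{\<omega>' \<in> space \<Omega>. R y \<omega>'} \<in> sets \<Omega>" .
  have mc: "(\<lambda>(\<omega>, \<omega>'). comb_seq n \<omega> \<omega>') \<in> \<Omega> \<Otimes>\<^sub>M \<Omega> \<rightarrow>\<^sub>M \<Omega>" by (rule measurable_comb_seq)
  have iZ: "(indicator ?Z :: _ \<Rightarrow> real) \<in> borel_measurable \<Omega>" using Z by simp
  have "measure \<Omega> ?Z = integral\<^sup>L \<Omega> (indicator ?Z)"
    using sets.sets_into_space[OF Z] Z by (simp add: Int_absorb2)
  also have "\<dots> = integral\<^sup>L (distr (\<Omega> \<Otimes>\<^sub>M \<Omega>) \<Omega> (\<lambda>(\<omega>, \<omega>'). comb_seq n \<omega> \<omega>')) (indicator ?Z)"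
    by (simp only: seq.PiM_comb_seq)
  also have "\<dots> = (\<integral>z. indicator ?Z (comb_seq n (fst z) (snd z)) \<partial>(\<Omega> \<Otimes>\<^sub>M \<Omega>))"
    using integral_distr[OF mc iZ] by (simp add: case_prod_beta')
  also have "\<dots> = (\<integral>\<omega>. (\<integral>\<omega>'. indicator ?Z (comb_seq n \<omega> \<omega>') \<partial>\<Omega>) \<partial>\<Omega>)"
  proof (subst pr.integral_fst'[symmetric])
    have "(\<lambda>z. indicator ?Z (comb_seq n (fst z) (snd z)) :: real) \<in> borel_measurable (\<Omega> \<Otimes>\<^sub>M \<Omega>)"
      using measurable_compose[OF mc iZ] by (simp add: case_prod_beta')
    then show "integrable (\<Omega> \<Otimes>\<^sub>M \<Omega>) (\<lambda>z. indicator ?Z (comb_seq n (fst z) (snd z)) :: real)"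
      by (intro pr.P.integrable_const_bound[where B=1]) (auto simp: indicator_def)
  qed simp
  also have "\<dots> = (\<integral>\<omega>. indicator ?Q \<omega> * measure \<Omega> {\<omega>' \<in> space \<Omega>. R (orbit f \<omega> n x) \<omega>'} \<partial>\<Omega>)"
  proof (rule Bochner_Integration.integral_cong[OF refl])
    fix \<omega> assume \<omega>: "\<omega> \<in> space \<Omega>"
    have "(\<integral>\<omega>'. indicator ?Z (comb_seq n \<omega> \<omega>') \<partial>\<Omega>)
        = (\<integral>\<omega>'. indicator ?Q \<omega> * indicator {\<omega>' \<in> space \<Omega>. R (orbit f \<omega> n x) \<omega>'} \<omega>' \<partial>\<Omega> :: real)"
    proof (rule Bochner_Integration.integral_cong[OF refl])
      fix \<omega>' assume \<omega>': "\<omega>' \<in> space \<Omega>"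
      have "comb_seq n \<omega> \<omega>' \<in> space \<Omega>" using \<omega> \<omega>' by (auto simp: space_Omega comb_seq_def)
      moreover have "(\<lambda>j. comb_seq n \<omega> \<omega>' (n + j)) = \<omega>'" by (auto simp: comb_seq_def)
      ultimately have "comb_seq n \<omega> \<omega>' \<in> ?Z \<longleftrightarrow> \<omega> \<in> ?Q \<and> \<omega>' \<in> {\<omega>' \<in> space \<Omega>. R (orbit f \<omega> n x) \<omega>'}"
        using \<omega> \<omega>' pre[of \<omega> \<omega>'] by (simp add: orbit_comb_seq)
      then show "indicator ?Z (comb_seq n \<omega> \<omega>') = (indicator ?Q \<omega> * indicator {\<omega>' \<in> space \<Omega>. R (orbit f \<omega> n x) \<omega>'} \<omega>' :: real)"
        by (simp only: indicator_def) simp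
    qed
    also have "\<dots> = indicator ?Q \<omega> * measure \<Omega> {\<omega>' \<in> space \<Omega>. R (orbit f \<omega> n x) \<omega>'}"
      using sets.sets_into_space[OF Ry] Ry by (simp add: Int_absorb2)
    finally show "(\<integral>\<omega>'. indicator ?Z (comb_seq n \<omega> \<omega>') \<partial>\<Omega>)
        = indicator ?Q \<omega> * measure \<Omega> {\<omega>' \<in> space \<Omega>. R (orbit f \<omega> n x) \<omega>'}" .
  qed
  finally show "measure \<Omega> ?Z = (\<integral>\<omega>. indicator ?Q \<omega> * measure \<Omega> {\<omega>' \<in> space \<Omega>. R (orbit f \<omega> n x) \<omega>'} \<partial>\<Omega>)" .
qed

lemma markov_section_measurable:
  fixes R :: "circle \<Rightarrow> (nat \<Rightarrow> nat) \<Rightarrow> bool"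
  assumes R: "{z \<in> space (borel \<Otimes>\<^sub>M \<Omega>). R (fst z) (snd z)} \<in> sets (borel \<Otimes>\<^sub>M \<Omega>)"
  shows "(\<lambda>y. measure \<Omega> {\<omega>' \<in> space \<Omega>. R y \<omega>'}) \<in> borel_measurable borel"
proof -
  have "(\<lambda>y. emeasure \<Omega> (Pair y -` {z \<in> space ((borel :: circle measure) \<Otimes>\<^sub>M \<Omega>). R (fst z) (snd z)})) \<in> borel_measurable borel"
    by (rule seq.P.measurable_emeasure_Pair[OF R])
  moreover have "Pair y -` {z \<in> space ((borel :: circle measure) \<Otimes>\<^sub>M \<Omega>). R (fst z) (snd z)} = {\<omega>' \<in> space \<Omega>. R y \<omega>'}" for y :: circle
    by (auto simp: space_pair_measure)
  ultimately show ?thesis by (simp add: measure_def)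
qed

text \<open>A bound for the future that is uniform in the starting point multiplies the probability
  of the past, whatever the state at time \<open>n\<close>.\<close>

lemma markov_bounds:
  fixes R :: "circle \<Rightarrow> (nat \<Rightarrow> nat) \<Rightarrow> bool"
  assumes Q: "{\<omega> \<in> space \<Omega>. Q \<omega>} \<in> sets \<Omega>" and pre: "\<And>\<omega> \<omega>'. Q (comb_seq n \<omega> \<omega>') \<longleftrightarrow> Q \<omega>"
    and R: "{z \<in> space (borel \<Otimes>\<^sub>M \<Omega>). R (fst z) (snd z)} \<in> sets (borel \<Otimes>\<^sub>M \<Omega>)"
  shows "(\<And>y. a \<le> measure \<Omega> {\<omega>' \<in> space \<Omega>. R y \<omega>'}) \<Longrightarrow>
      a * measure \<Omega> {\<omega> \<in> space \<Omega>. Q \<omega>} \<le> measure \<Omega> {\<omega> \<in> space \<Omega>. Q \<omega> \<and> R (orbit f \<omega> n x) (\<lambda>j. \<omega> (n + j))}"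
    and "(\<And>y. measure \<Omega> {\<omega>' \<in> space \<Omega>. R y \<omega>'} \<le> a) \<Longrightarrow>
      measure \<Omega> {\<omega> \<in> space \<Omega>. Q \<omega> \<and> R (orbit f \<omega> n x) (\<lambda>j. \<omega> (n + j))} \<le> a * measure \<Omega> {\<omega> \<in> space \<Omega>. Q \<omega>}"
proof -
  let ?Q = "{\<omega> \<in> space \<Omega>. Q \<omega>}"
  let ?g = "\<lambda>\<omega>. indicator ?Q \<omega> * measure \<Omega> {\<omega>' \<in> space \<Omega>. R (orbit f \<omega> n x) \<omega>'}"
  note eq = markov_property(1)[where Q=Q and R=R, OF Q pre R, of x]
  have "(\<lambda>\<omega>. measure \<Omega> {\<omega>' \<in> space \<Omega>. R (orbit f \<omega> n x) \<omega>'}) \<in> borel_measurable \<Omega>"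
    by (rule measurable_compose[OF measurable_orbit markov_section_measurable[OF R]])
  then have int: "integrable \<Omega> ?g"
    using Q by (intro seq.P.integrable_const_bound[where B=1])
      (auto simp: indicator_def intro!: borel_measurable_times)
  have intQ: "integrable \<Omega> (\<lambda>\<omega>. a * indicator ?Q \<omega>)" "(\<integral>\<omega>. a * indicator ?Q \<omega> \<partial>\<Omega>) = a * measure \<Omega> ?Q"
    using Q sets.sets_into_space[OF Q] by (auto simp: Int_absorb2 seq.P.emeasure_eq_measure)
  show "a * measure \<Omega> ?Q \<le> measure \<Omega> {\<omega> \<in> space \<Omega>. Q \<omega> \<and> R (orbit f \<omega> n x) (\<lambda>j. \<omega> (n + j))}"
    if "\<And>y. a \<le> measure \<Omega> {\<omega>' \<in> space \<Omega>. R y \<omega>'}"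
    unfolding eq intQ(2)[symmetric] by (rule integral_mono[OF intQ(1) int]) (use that in \<open>auto simp: indicator_def\<close>)
  show "measure \<Omega> {\<omega> \<in> space \<Omega>. Q \<omega> \<and> R (orbit f \<omega> n x) (\<lambda>j. \<omega> (n + j))} \<le> a * measure \<Omega> ?Q"
    if "\<And>y. measure \<Omega> {\<omega>' \<in> space \<Omega>. R y \<omega>'} \<le> a"
    unfolding eq intQ(2)[symmetric] by (rule integral_mono[OF int intQ(1)]) (use that in \<open>auto simp: indicator_def\<close>)
qed

end

section \<open>The law of the iterated logarithm: lower bound\<close>

text \<open>Only the interval from \<open>z * s\<close> to \<open>(z + 1) * s\<close> is used: its
  length is \<open>s\<close>, and the density there is at least its value at the right end.\<close>

lemma normal_law_tail:
  assumes s: "0 < s" and z: "0 \<le> z"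
  shows "exp (- ((z + 1) * s)\<^sup>2 / (2 * s\<^sup>2)) / sqrt (2 * pi) \<le> measure (normal_law (s\<^sup>2)) {z * s<..}"
proof -
  let ?d = "\<lambda>t. normal_density 0 s t"
  define m where "m = exp (- ((z + 1) * s)\<^sup>2 / (2 * s\<^sup>2)) / (sqrt (2 * pi) * s)"
  have m0: "0 \<le> m" using s by (simp add: m_def)
  have nl: "normal_law (s\<^sup>2) = density lborel (\<lambda>t. ennreal (?d t))"
    using s by (simp add: normal_law_def)
  interpret prob_space "normal_law (s\<^sup>2)"
    using real_distribution_normal_law[of "s\<^sup>2"] by (simp add: real_distribution_def)
  have low: "m \<le> ?d t" if "z * s < t" "t \<le> (z + 1) * s" for t
  proof -
    have "0 \<le> z * s" using z s by simp
    then have "t\<^sup>2 \<le> ((z + 1) * s)\<^sup>2" using that by (intro power_mono) auto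
    then have "- ((z + 1) * s)\<^sup>2 / (2 * s\<^sup>2) \<le> - t\<^sup>2 / (2 * s\<^sup>2)"
      by (intro divide_right_mono) auto
    then have "exp (- ((z + 1) * s)\<^sup>2 / (2 * s\<^sup>2)) / (sqrt (2 * pi) * s) \<le> exp (- t\<^sup>2 / (2 * s\<^sup>2)) / (sqrt (2 * pi) * s)"
      using s by (intro divide_right_mono) auto
    then show ?thesis using s by (simp add: m_def normal_density_def real_sqrt_mult)
  qed
  have "ennreal (m * s) = ennreal m * emeasure lborel {z * s<..(z + 1) * s}"
    using s m0 by (simp add: ennreal_mult' distrib_right)
  also have "\<dots> = (\<integral>\<^sup>+t. ennreal m * indicator {z * s<..(z + 1) * s} t \<partial>lborel)"
    by (simp add: nn_integral_cmult_indicator)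
  also have "\<dots> \<le> (\<integral>\<^sup>+t. ennreal (?d t) * indicator {z * s<..} t \<partial>lborel)"
  proof (intro nn_integral_mono)
    fix t
    show "ennreal m * indicator {z * s<..(z + 1) * s} t \<le> ennreal (?d t) * indicator {z * s<..} t"
      using low[of t] by (auto simp: indicator_def intro: ennreal_leI)
  qed
  also have "\<dots> = emeasure (normal_law (s\<^sup>2)) {z * s<..}"
    unfolding nl by (subst emeasure_density) auto
  finally have "m * s \<le> measure (normal_law (s\<^sup>2)) {z * s<..}"
    by (simp add: emeasure_eq_measure)
  then show ?thesis using s by (simp add: m_def)
qed

context contracting_walk
begin

lemma mg_event_measurable:
  assumes w: "admissible_weight (mg u) K"
  shows "{\<omega> \<in> space \<Omega>. a \<le> addfun (mg u) n x \<omega>} \<in> sets \<Omega>"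
    and "{z \<in> space (borel \<Otimes>\<^sub>M \<Omega>). a \<le> addfun (mg u) n (fst z) (snd z)} \<in> sets (borel \<Otimes>\<^sub>M \<Omega>)"
    and "{z \<in> space (borel \<Otimes>\<^sub>M \<Omega>). \<not> a \<le> addfun (mg u) n (fst z) (snd z)} \<in> sets (borel \<Otimes>\<^sub>M \<Omega>)"
proof -
  note [measurable] = measurable_addfun[OF w, of n x] measurable_addfun_pair[OF w, of n]
  show "{\<omega> \<in> space \<Omega>. a \<le> addfun (mg u) n x \<omega>} \<in> sets \<Omega>" by measurable
  show "{z \<in> space (borel \<Otimes>\<^sub>M \<Omega>). a \<le> addfun (mg u) n (fst z) (snd z)} \<in> sets (borel \<Otimes>\<^sub>M \<Omega>)" by measurable
  show "{z \<in> space (borel \<Otimes>\<^sub>M \<Omega>). \<not> a \<le> addfun (mg u) n (fst z) (snd z)} \<in> sets (borel \<Otimes>\<^sub>M \<Omega>)" by measurable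
qed

text \<open>If uniformity failed, violating starting points could be chosen for infinitely many
  \<open>n\<close>; the central limit theorem along these moving points contradicts the strict
  inequality for the limit law.\<close>

lemma uniform_tail:
  assumes u: "regular u" and s: "0 < s" "integral\<^sup>L \<nu> (qv u) = s\<^sup>2" and \<delta>: "\<delta> < measure (normal_law (s\<^sup>2)) {z<..}"
  shows "\<exists>m. \<forall>n\<ge>m. \<forall>x. \<delta> \<le> measure \<Omega> {\<omega> \<in> space \<Omega>. z * sqrt (real n) \<le> addfun (mg u) n x \<omega>}"
proof (rule ccontr)
  assume neg: "\<not> ?thesis"
  obtain K where w: "admissible_weight (mg u) K" using mg_weight[OF u] by auto
  define pr where "pr n x = measure \<Omega> {\<omega> \<in> space \<Omega>. z * sqrt (real n) \<le> addfun (mg u) n x \<omega>}" for n x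
  \<comment> \<open>An arbitrary point for those \<open>n\<close> that have no violating one; the
    central limit theorem is indifferent to it.\<close>
  define x where "x n = (SOME x. pr n x < \<delta>)" for n
  let ?D = "\<lambda>n. distr \<Omega> borel (\<lambda>\<omega>. 1 / sqrt (real n) * addfun (mg u) n (x n) \<omega>)"
  interpret nl: real_distribution "normal_law (s\<^sup>2)" by (rule real_distribution_normal_law) simp
  have mM: "addfun (mg u) n (x n) \<in> borel_measurable \<Omega>" for n by (rule measurable_addfun[OF w])
  have wc: "weak_conv_m ?D (normal_law (s\<^sup>2))"
    using central_limit_mg[where Y="\<lambda>n. addfun (mg u) n (x n)" and x=x and c=0, OF u mM] s by simp
  have cont: "isCont (cdf (normal_law (s\<^sup>2))) z"
  proof -
    have "emeasure (normal_law (s\<^sup>2)) {z} = 0"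
      using s unfolding normal_law_def by (simp add: emeasure_density)
    then show ?thesis unfolding nl.isCont_cdf by (simp add: measure_def)
  qed
  have "(\<lambda>n. cdf (?D n) z) \<longlonglongrightarrow> cdf (normal_law (s\<^sup>2)) z"
    by (rule wc[unfolded weak_conv_m_def weak_conv_def, rule_format, OF cont])
  moreover have "cdf (normal_law (s\<^sup>2)) z < 1 - \<delta>"
  proof -
    have "{z<..} = UNIV - {..z}" by auto
    then have "measure (normal_law (s\<^sup>2)) {z<..} = 1 - cdf (normal_law (s\<^sup>2)) z"
      using nl.prob_compl[of "{..z}"] by (simp add: cdf_def)
    then show ?thesis using \<delta> by simp
  qed
  ultimately have "eventually (\<lambda>n. cdf (?D n) z < 1 - \<delta>) sequentially" by (rule order_tendstoD)
  then obtain m where m: "\<forall>n\<ge>m. cdf (?D n) z < 1 - \<delta>" unfolding eventually_sequentially ..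
  have "\<forall>m. \<exists>n\<ge>m. \<exists>x. pr n x < \<delta>" using neg by (simp add: pr_def not_le)
  \<comment> \<open>\<open>Suc m\<close> rules out \<open>n = 0\<close>, so that division by
    \<open>sqrt n\<close> is harmless.\<close>
  then have "\<exists>n\<ge>Suc m. \<exists>x. pr n x < \<delta>" by (rule spec)
  then obtain n where n: "Suc m \<le> n" "\<exists>x. pr n x < \<delta>" by blast
  have small: "pr n (x n) < \<delta>" unfolding x_def by (rule someI_ex[OF n(2)])
  have sq: "0 < sqrt (real n)" using n by simp
  have "1 - cdf (?D n) z \<le> pr n (x n)"
  proof -
    let ?A = "{\<omega> \<in> space \<Omega>. 1 / sqrt (real n) * addfun (mg u) n (x n) \<omega> \<le> z}"
    have mS: "(\<lambda>\<omega>. 1 / sqrt (real n) * addfun (mg u) n (x n) \<omega>) \<in> borel_measurable \<Omega>"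
      by (intro borel_measurable_times borel_measurable_const mM)
    have A: "?A \<in> sets \<Omega>" using mS by (rule borel_measurable_le) simp
    have "cdf (?D n) z = measure \<Omega> ((\<lambda>\<omega>. 1 / sqrt (real n) * addfun (mg u) n (x n) \<omega>) -` {..z} \<inter> space \<Omega>)"
      unfolding cdf_def by (rule measure_distr[OF mS]) simp
    also have "(\<lambda>\<omega>. 1 / sqrt (real n) * addfun (mg u) n (x n) \<omega>) -` {..z} \<inter> space \<Omega> = ?A" by auto
    finally have "cdf (?D n) z = measure \<Omega> ?A" .
    then have "1 - cdf (?D n) z = measure \<Omega> (space \<Omega> - ?A)"
      using seq.P.prob_compl[OF A] by simp
    also have "\<dots> \<le> pr n (x n)"
      unfolding pr_def
    proof (rule seq.P.finite_measure_mono[OF _ mg_event_measurable(1)[OF w]])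
      show "space \<Omega> - ?A \<subseteq> {\<omega> \<in> space \<Omega>. z * sqrt (real n) \<le> addfun (mg u) n (x n) \<omega>}"
      proof
        fix \<omega> assume "\<omega> \<in> space \<Omega> - ?A"
        then have \<omega>: "\<omega> \<in> space \<Omega>" and "z < 1 / sqrt (real n) * addfun (mg u) n (x n) \<omega>" by auto
        then have "z * sqrt (real n) < 1 / sqrt (real n) * addfun (mg u) n (x n) \<omega> * sqrt (real n)"
          using sq by (intro mult_strict_right_mono)
        then show "\<omega> \<in> {\<omega> \<in> space \<Omega>. z * sqrt (real n) \<le> addfun (mg u) n (x n) \<omega>}" using sq \<omega> by simp
      qed
    qed
    finally show ?thesis .
  qed
  moreover have "cdf (?D n) z < 1 - \<delta>" using m[rule_format, of n] n(1) by simp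
  ultimately show False using small by simp
qed

text \<open>It suffices to rise by \<open>y\<close> on each of \<open>r\<close> consecutive blocks;
  by the Markov property the uniform one-block bounds multiply.\<close>

lemma block_tail:
  assumes w: "admissible_weight (mg u) K" and a: "0 \<le> a"
    and le: "\<And>x. a \<le> measure \<Omega> {\<omega> \<in> space \<Omega>. y \<le> addfun (mg u) n x \<omega>}"
  shows "a ^ r \<le> measure \<Omega> {\<omega> \<in> space \<Omega>. real r * y \<le> addfun (mg u) (r * n) x \<omega>}"
proof (induction r arbitrary: x)
  case 0
  then show ?case using seq.P.prob_space by simp
next
  case (Suc r)
  let ?Q = "\<lambda>\<omega>. y \<le> addfun (mg u) n x \<omega>"
  let ?R = "\<lambda>z \<omega>. real r * y \<le> addfun (mg u) (r * n) z \<omega>"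
  have "a ^ Suc r = a ^ r * a" by (rule power_Suc2)
  also have "\<dots> \<le> a ^ r * measure \<Omega> {\<omega> \<in> space \<Omega>. ?Q \<omega>}"
    by (rule mult_left_mono[OF le[of x]]) (simp add: a)
  also have "\<dots> \<le> measure \<Omega> {\<omega> \<in> space \<Omega>. ?Q \<omega> \<and> ?R (orbit f \<omega> n x) (\<lambda>j. \<omega> (n + j))}"
    by (rule markov_bounds(1)[where Q="?Q" and R="?R", OF mg_event_measurable(1)[OF w] _ mg_event_measurable(2)[OF w] Suc.IH])
       (simp add: addfun_comb_seq_prefix)
  also have "\<dots> \<le> measure \<Omega> {\<omega> \<in> space \<Omega>. real (Suc r) * y \<le> addfun (mg u) (Suc r * n) x \<omega>}"
  proof (rule seq.P.finite_measure_mono[OF _ mg_event_measurable(1)[OF w]])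
    show "{\<omega> \<in> space \<Omega>. ?Q \<omega> \<and> ?R (orbit f \<omega> n x) (\<lambda>j. \<omega> (n + j))}
        \<subseteq> {\<omega> \<in> space \<Omega>. real (Suc r) * y \<le> addfun (mg u) (Suc r * n) x \<omega>}"
      by (auto simp: addfun_add distrib_right)
  qed
  finally show ?case .
qed

lemma addfun_mg_lower:
  assumes w: "admissible_weight (mg u) K" and \<omega>: "\<omega> \<in> space \<Omega>"
  shows "addfun (mg u) n x \<omega> - real m * K \<le> addfun (mg u) (n + m) x \<omega>"
proof -
  have "(\<lambda>j. \<omega> (n + j)) \<in> space \<Omega>" using \<omega> by (simp add: space_Omega)
  from norm_addfun_le[OF w this, of m "orbit f \<omega> n x"]
  show ?thesis by (simp add: addfun_add)
qed

text \<open>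
  A deviation of size \<open>c * sqrt (n * T)\<close> is enforced by cutting the time interval into about \<open>T / Z\<^sup>2\<close>
  blocks and asking for a deviation of \<open>Z\<close> standard deviations on each of them; as \<open>Z\<close> grows, the cost of
  a block is asymptotically the Gaussian one.
\<close>

lemma moderate_deviation_lower:
  assumes u: "regular u" and s: "0 < s" "integral\<^sup>L \<nu> (qv u) = s\<^sup>2" and c: "0 \<le> c" "c < s"
  shows "\<exists>a>0. \<exists>\<gamma>. 0 < \<gamma> \<and> \<gamma> < 1 \<and> (\<exists>q>0. \<forall>T\<ge>1. \<forall>n. q * T \<le> real n \<longrightarrow> (\<forall>x.
    a * exp (- \<gamma> * T / 2) \<le> measure \<Omega> {\<omega> \<in> space \<Omega>. c * sqrt (real n * T) \<le> addfun (mg u) n x \<omega>}))"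
proof -
  obtain K where K: "1 \<le> K" and w: "admissible_weight (mg u) K" using mg_weight[OF u] by auto
  \<comment> \<open>The midpoint of \<open>c / s\<close> and 1: blocks aim at \<open>b * s\<close>,
    above the required \<open>c\<close>, while the Gaussian rate \<open>b\<^sup>2\<close> stays
    below 1.\<close>
  define b where "b = (c + s) / 2 / s"
  have b: "c < b * s" "0 < b" "b < 1" using c s by (auto simp: b_def field_simps)
  define \<gamma> where "\<gamma> = (b\<^sup>2 + 1) / 2"
  have b2: "b\<^sup>2 < 1" using b by (simp add: power_less_one_iff)
  have \<gamma>: "0 < \<gamma>" "b\<^sup>2 < \<gamma>" "\<gamma> < 1" using b2 b by (auto simp: \<gamma>_def add_nonneg_pos)
  \<comment> \<open>Minus the logarithm of half the bound in \<open>normal_law_tail\<close> at level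
    \<open>b * Z\<close>; the half makes \<open>exp (- cost Z)\<close> strictly smaller than the
    tail. Per unit of \<open>T\<close> the cost is \<open>cost Z / Z\<^sup>2\<close>, with limit
    \<open>b\<^sup>2 / 2\<close>.\<close>
  define cost where "cost Z = (b * Z + 1)\<^sup>2 / 2 + ln (2 * sqrt (2 * pi))" for Z
  have "((\<lambda>Z. cost Z / Z\<^sup>2) \<longlongrightarrow> b\<^sup>2 / 2) at_top"
    unfolding cost_def using b by real_asymp
  then have "eventually (\<lambda>Z. cost Z / Z\<^sup>2 < \<gamma> / 2) at_top"
    using \<gamma> by (intro order_tendstoD) auto
  then have "eventually (\<lambda>Z. cost Z / Z\<^sup>2 < \<gamma> / 2 \<and> 1 \<le> Z) at_top"
    by (intro eventually_conj eventually_ge_at_top)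
  then obtain Z where Z: "cost Z / Z\<^sup>2 < \<gamma> / 2" "1 \<le> Z"
    by (auto simp: eventually_at_top_linorder)
  define a where "a = exp (- cost Z)"
  have a0: "0 < a" by (simp add: a_def)
  have a1: "a \<le> 1"
  proof -
    have "1 \<le> sqrt (2 * pi)" using pi_ge_two by simp
    then have "1 \<le> 2 * sqrt (2 * pi)" by linarith
    then have "0 \<le> cost Z" by (simp add: cost_def)
    then show ?thesis by (simp add: a_def)
  qed
  have a_half: "a = exp (- ((b * Z + 1) * s)\<^sup>2 / (2 * s\<^sup>2)) / sqrt (2 * pi) / 2"
  proof -
    have "0 < 2 * sqrt (2 * pi)" by simp
    then have e1: "exp (- ln (2 * sqrt (2 * pi))) = 1 / (2 * sqrt (2 * pi))"
      by (simp only: exp_minus exp_ln inverse_eq_divide)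
    have e2: "- ((b * Z + 1) * s)\<^sup>2 / (2 * s\<^sup>2) = - ((b * Z + 1)\<^sup>2 / 2)"
      using s by (simp add: power_mult_distrib)
    have "a = exp (- ((b * Z + 1)\<^sup>2 / 2)) * exp (- ln (2 * sqrt (2 * pi)))"
      unfolding a_def cost_def by (simp flip: exp_add)
    then show ?thesis unfolding e2 e1 by simp
  qed
  have "a < measure (normal_law (s\<^sup>2)) {b * Z * s<..}"
  proof -
    have "0 < exp (- ((b * Z + 1) * s)\<^sup>2 / (2 * s\<^sup>2)) / sqrt (2 * pi)" by simp
    moreover have "y / 2 < y" if "0 < y" for y :: real using that by simp
    ultimately have "a < exp (- ((b * Z + 1) * s)\<^sup>2 / (2 * s\<^sup>2)) / sqrt (2 * pi)" unfolding a_half by blast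
    also have "\<dots> \<le> measure (normal_law (s\<^sup>2)) {b * Z * s<..}"
      by (rule normal_law_tail[OF s(1)]) (use b Z in simp)
    finally show ?thesis .
  qed
  from uniform_tail[OF u s this] obtain m1 where
    m1: "\<And>n x. m1 \<le> n \<Longrightarrow> a \<le> measure \<Omega> {\<omega> \<in> space \<Omega>. b * Z * s * sqrt (real n) \<le> addfun (mg u) n x \<omega>}"
    by auto
  \<comment> \<open>The gap between \<open>c\<close> and \<open>b * s\<close> absorbs the rounding:
    blocks counted with one extra step, and a loss \<open>K\<close> per block for the leftover steps
    at the end.\<close>
  have "eventually (\<lambda>n. c * Z * sqrt (real n + 1) + K \<le> b * Z * s * sqrt (real n)) sequentially"
  proof -
    define d where "d = b * s - c"
    have d: "0 < d" using b by (simp add: d_def)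
    have "((\<lambda>n. (c * Z * sqrt (real n + 1) + K) / sqrt (real n)) \<longlongrightarrow> c * Z) sequentially"
      by real_asymp
    moreover have "c * Z < b * s * Z" using b Z by (intro mult_strict_right_mono) auto
    ultimately have "eventually (\<lambda>n. (c * Z * sqrt (real n + 1) + K) / sqrt (real n) < b * s * Z) sequentially"
      by (rule order_tendstoD)
    then show ?thesis
      using eventually_gt_at_top[of "0::nat"]
    proof eventually_elim
      case (elim n)
      then show ?case by (simp add: pos_divide_less_eq mult_ac)
    qed
  qed
  then obtain m2 where m2: "\<And>n. m2 \<le> n \<Longrightarrow> c * Z * sqrt (real n + 1) + K \<le> b * Z * s * sqrt (real n)"
    by (auto simp: eventually_sequentially)
  define m where "m = max 1 (max m1 m2)"
  \<comment> \<open>At most \<open>2 * T\<close> blocks are used, so each has length at least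
    \<open>m\<close>.\<close>
  define q where "q = 2 * real m"
  have "a * exp (- \<gamma> * T / 2) \<le> measure \<Omega> {\<omega> \<in> space \<Omega>. c * sqrt (real n * T) \<le> addfun (mg u) n x \<omega>}"
    if T: "1 \<le> T" and n: "q * T \<le> real n" for T n x
  proof -
    define r where "r = nat \<lceil>T / Z\<^sup>2\<rceil>"
    have TZ: "0 < T / Z\<^sup>2" "T / Z\<^sup>2 \<le> T" using T Z by (auto simp: field_simps one_le_power mult_le_cancel_left1 mult.commute)
    have r: "1 \<le> r" "T / Z\<^sup>2 \<le> real r" "real r \<le> T / Z\<^sup>2 + 1"
      using TZ unfolding r_def by linarith+
    define l where "l = n div r"
    have ml: "m \<le> l"
    proof -
      have "real (m * r) \<le> real m * (2 * T)"
        using r TZ T by (simp add: mult_left_mono)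
      also have "\<dots> \<le> real n" using n by (simp add: q_def mult_ac)
      finally have "m * r \<le> n" by linarith
      then show ?thesis unfolding l_def using r(1) by (simp add: less_eq_div_iff_mult_less_eq)
    qed
    define e where "e = n mod r"
    have nle: "n = r * l + e" "e < r" using r(1) by (auto simp: l_def e_def)
    define y where "y = b * Z * s * sqrt (real l)"
    have target: "c * sqrt (real n * T) + real r * K \<le> real r * y"
    proof -
      have "real n \<le> real r * (real l + 1)"
        using nle by (simp add: algebra_simps)
      moreover have "T \<le> real r * Z\<^sup>2" using r(2) Z by (simp add: pos_divide_le_eq)
      ultimately have "real n * T \<le> (real r * (real l + 1)) * (real r * Z\<^sup>2)"
        using T by (intro mult_mono) auto
      also have "\<dots> = (real r * Z)\<^sup>2 * (real l + 1)" by (simp add: power2_eq_square)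
      finally have "sqrt (real n * T) \<le> sqrt ((real r * Z)\<^sup>2 * (real l + 1))" by (rule real_sqrt_le_mono)
      also have "\<dots> = real r * Z * sqrt (real l + 1)" using Z by (simp add: real_sqrt_mult)
      finally have "c * sqrt (real n * T) \<le> c * (real r * Z * sqrt (real l + 1))"
        using c by (intro mult_left_mono) auto
      moreover have "real r * (c * Z * sqrt (real l + 1) + K) \<le> real r * y"
        unfolding y_def using m2[of l] ml by (intro mult_left_mono) (auto simp: m_def)
      ultimately show ?thesis by (simp add: algebra_simps)
    qed
    have "exp (- \<gamma> * T / 2) \<le> exp (- cost Z * (T / Z\<^sup>2))"
    proof -
      have "cost Z / Z\<^sup>2 * T \<le> \<gamma> / 2 * T" using Z(1) T by (intro mult_right_mono) auto
      then show ?thesis by simp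
    qed
    then have "a * exp (- \<gamma> * T / 2) \<le> a * exp (- cost Z * (T / Z\<^sup>2))"
      using a0 by (intro mult_left_mono) auto
    \<comment> \<open>The prefactor \<open>a\<close> pays for rounding the number of blocks
      up.\<close>
    also have "\<dots> = exp (- cost Z * (T / Z\<^sup>2 + 1))" by (simp add: a_def distrib_left exp_add[symmetric])
    also have "\<dots> \<le> exp (- cost Z * real r)"
      using r(3) a1 by (simp add: a_def mult_left_mono)
    also have "\<dots> = a ^ r" by (simp add: a_def exp_of_nat_mult[symmetric] mult.commute)
    also have "\<dots> \<le> measure \<Omega> {\<omega> \<in> space \<Omega>. real r * y \<le> addfun (mg u) (r * l) x \<omega>}"
      using m1[of l] ml a0 unfolding y_def by (intro block_tail[OF w]) (auto simp: m_def)
    also have "\<dots> \<le> measure \<Omega> {\<omega> \<in> space \<Omega>. c * sqrt (real n * T) \<le> addfun (mg u) n x \<omega>}"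
    proof (rule seq.P.finite_measure_mono[OF _ mg_event_measurable(1)[OF w]])
      show "{\<omega> \<in> space \<Omega>. real r * y \<le> addfun (mg u) (r * l) x \<omega>}
          \<subseteq> {\<omega> \<in> space \<Omega>. c * sqrt (real n * T) \<le> addfun (mg u) n x \<omega>}"
      proof clarify
        fix \<omega> assume \<omega>: "\<omega> \<in> space \<Omega>" and le: "real r * y \<le> addfun (mg u) (r * l) x \<omega>"
        have "addfun (mg u) (r * l) x \<omega> - real e * K \<le> addfun (mg u) n x \<omega>"
          unfolding nle(1) by (rule addfun_mg_lower[OF w \<omega>])
        moreover have "real e * K \<le> real r * K" using nle(2) K by (intro mult_right_mono) auto
        ultimately show "c * sqrt (real n * T) \<le> addfun (mg u) n x \<omega>" using le target by linarith
      qed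
    qed
    finally show ?thesis .
  qed
  moreover have "0 < q" by (simp add: q_def m_def)
  ultimately show ?thesis using a0 \<gamma> by blast
qed

end

context contracting_walk
begin

text \<open>A second Borel-Cantelli argument without independence: the lower bound for each block
  increment is uniform in the state at its start, so by the Markov property the probability of
  failure on a run of blocks is at most \<open>exp\<close> of minus a divergent sum.\<close>

lemma lil_lower_frequently:
  assumes u: "regular u" and s: "0 < s" "integral\<^sup>L \<nu> (qv u) = s\<^sup>2" and c1: "0 \<le> c1" "c1 < s"
    and b: "2 \<le> (b :: nat)"
  shows "AE \<omega> in \<Omega>. \<exists>\<^sub>F k in sequentially. c1 * sqrt (real (b ^ Suc k - b ^ k) * (2 * ln (ln (real (b ^ Suc k)))))
    \<le> addfun (mg u) (b ^ Suc k) x \<omega> - addfun (mg u) (b ^ k) x \<omega>"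
proof -
  obtain K where w: "admissible_weight (mg u) K" using mg_weight[OF u] by auto
  from moderate_deviation_lower[OF u s c1] obtain a \<gamma> q where a: "0 < a" and \<gamma>: "0 < \<gamma>" "\<gamma> < 1"
    and q: "0 < q" and dev: "\<forall>T\<ge>1. \<forall>n. q * T \<le> real n \<longrightarrow> (\<forall>x.
    a * exp (- \<gamma> * T / 2) \<le> measure \<Omega> {\<omega> \<in> space \<Omega>. c1 * sqrt (real n * T) \<le> addfun (mg u) n x \<omega>})"
    by (elim exE conjE) (rule that; assumption)
  define \<beta> where "\<beta> = real b"
  have \<beta>: "1 < \<beta>" "0 < ln \<beta>" using b by (auto simp: \<beta>_def)
  define l where "l k = b ^ Suc k - b ^ k" for k
  \<comment> \<open>With this choice \<open>exp (- \<gamma> * T k / 2)\<close> is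
    \<open>ln (b ^ Suc k)\<close> to the power \<open>- \<gamma>\<close>, of order
    \<open>k powr (- \<gamma>)\<close>; the sum diverges because
    \<open>\<gamma> < 1\<close>.\<close>
  define T where "T k = 2 * ln (ln (real (b ^ Suc k)))" for k
  define g where "g k = c1 * sqrt (real (l k) * T k)" for k
  define D where "D k \<omega> = addfun (mg u) (b ^ Suc k) x \<omega> - addfun (mg u) (b ^ k) x \<omega>" for k \<omega>
  define pk where "pk k = a * exp (- \<gamma> * T k / 2)" for k
  have bl: "b ^ Suc k = b ^ k + l k" for k using b by (simp add: l_def)
  have T_eq: "T k = 2 * ln (real (Suc k) * ln \<beta>)" for k
    using \<beta> b by (simp add: T_def \<beta>_def ln_realpow flip: power_Suc)
  have l_eq: "real (l k) = (\<beta> - 1) * \<beta> ^ k" for k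
    using b by (simp add: l_def of_nat_diff \<beta>_def algebra_simps)
  have "eventually (\<lambda>k. 1 \<le> 2 * ln (real (Suc k) * ln \<beta>)) sequentially" using \<beta> by real_asymp
  moreover have "eventually (\<lambda>k. q * (2 * ln (real (Suc k) * ln \<beta>)) \<le> (\<beta> - 1) * \<beta> ^ k) sequentially"
    using \<beta> q by real_asymp
  ultimately have "eventually (\<lambda>k. 1 \<le> T k \<and> q * T k \<le> real (l k)) sequentially"
    unfolding T_eq l_eq by (rule eventually_conj)
  then obtain k0 where k0: "\<forall>k\<ge>k0. 1 \<le> T k \<and> q * T k \<le> real (l k)" unfolding eventually_sequentially ..
  have tail: "pk k \<le> measure \<Omega> {\<omega> \<in> space \<Omega>. g k \<le> addfun (mg u) (l k) y \<omega>}" if "k0 \<le> k" for k y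
    using dev[rule_format, of "T k" "l k" y] k0[rule_format, OF that] by (simp add: pk_def g_def)
  have pk0: "0 \<le> pk k" for k using a by (simp add: pk_def)
  have pk_eq: "pk k = a * ln \<beta> powr (- \<gamma>) * real (Suc k) powr (- \<gamma>)" for k
  proof -
    have pos: "0 < real (Suc k) * ln \<beta>" using \<beta> by simp
    have "exp (- \<gamma> * T k / 2) = (real (Suc k) * ln \<beta>) powr (- \<gamma>)"
      using pos \<beta> by (simp add: T_eq powr_def)
    then show ?thesis using \<beta> by (simp add: pk_def powr_mult mult_ac)
  qed
  have div: "\<not> summable pk"
  proof
    assume "summable pk"
    moreover have "a * ln \<beta> powr (- \<gamma>) \<noteq> 0" using a \<beta> by simp
    ultimately have "summable (\<lambda>k. real (Suc k) powr (- \<gamma>))"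
      unfolding pk_eq[abs_def] by (simp only: summable_cmult_iff simp_thms)
    then have "summable (\<lambda>k. real k powr (- \<gamma>))" by (subst (asm) summable_Suc_iff)
    then show False using \<gamma> by (simp add: summable_real_powr_iff)
  qed
  have meas: "{\<omega> \<in> space \<Omega>. \<forall>k\<in>I. \<not> g k \<le> D k \<omega>} \<in> sets \<Omega>" for I
  proof -
    have m: "D k \<in> borel_measurable \<Omega>" for k
      unfolding D_def by (intro borel_measurable_diff measurable_addfun[OF w])
    have "{\<omega> \<in> space \<Omega>. \<not> g k \<le> D k \<omega>} \<in> sets \<Omega>" for k
      using borel_measurable_less[OF m borel_measurable_const, of k "g k"] by (simp add: not_le)
    then show ?thesis by (intro sets.sets_Collect_countable_Ball) auto
  qed
  \<comment> \<open>Given the past, block \<open>k\<close> fails with probability at most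
    \<open>1 - pk k\<close>, hence at most \<open>exp (- pk k)\<close>.\<close>
  have none: "measure \<Omega> {\<omega> \<in> space \<Omega>. \<forall>k\<in>{j..<j + m}. \<not> g k \<le> D k \<omega>} \<le> exp (- (\<Sum>k=j..<j + m. pk k))"
    if j: "k0 \<le> j" for j m
  proof (induction m)
    case (Suc m)
    let ?Q = "\<lambda>\<omega>. \<forall>k\<in>{j..<j + m}. \<not> g k \<le> D k \<omega>"
    let ?R = "\<lambda>y \<omega>. \<not> g (j + m) \<le> addfun (mg u) (l (j + m)) y \<omega>"
    have pre: "?Q (comb_seq (b ^ (j + m)) \<omega> \<omega>') \<longleftrightarrow> ?Q \<omega>" for \<omega> \<omega>'
    proof (rule ball_cong[OF refl])
      fix k assume k: "k \<in> {j..<j + m}"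
      have "b ^ Suc k \<le> b ^ (j + m)" "b ^ k \<le> b ^ (j + m)"
        using k b by (auto intro!: power_increasing simp del: power_Suc)
      then show "(\<not> g k \<le> D k (comb_seq (b ^ (j + m)) \<omega> \<omega>')) = (\<not> g k \<le> D k \<omega>)"
        by (simp add: D_def addfun_comb_seq_prefix del: power_Suc)
    qed
    have "measure \<Omega> {\<omega>' \<in> space \<Omega>. ?R y \<omega>'} \<le> 1 - pk (j + m)" for y
    proof -
      have "{\<omega>' \<in> space \<Omega>. ?R y \<omega>'} = space \<Omega> - {\<omega>' \<in> space \<Omega>. g (j + m) \<le> addfun (mg u) (l (j + m)) y \<omega>'}"
        by auto
      then have "measure \<Omega> {\<omega>' \<in> space \<Omega>. ?R y \<omega>'}
          = 1 - measure \<Omega> {\<omega>' \<in> space \<Omega>. g (j + m) \<le> addfun (mg u) (l (j + m)) y \<omega>'}"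
        using seq.P.prob_compl[OF mg_event_measurable(1)[OF w]] by simp
      then show ?thesis using tail[of "j + m" y] j by simp
    qed
    from markov_bounds(2)[where Q="?Q" and R="?R" and n="b ^ (j + m)" and x=x, OF meas pre mg_event_measurable(3)[OF w] this]
    have "measure \<Omega> {\<omega> \<in> space \<Omega>. ?Q \<omega> \<and> ?R (orbit f \<omega> (b ^ (j + m)) x) (\<lambda>i. \<omega> (b ^ (j + m) + i))}
        \<le> (1 - pk (j + m)) * measure \<Omega> {\<omega> \<in> space \<Omega>. ?Q \<omega>}" .
    moreover have "{\<omega> \<in> space \<Omega>. ?Q \<omega> \<and> ?R (orbit f \<omega> (b ^ (j + m)) x) (\<lambda>i. \<omega> (b ^ (j + m) + i))}
        = {\<omega> \<in> space \<Omega>. \<forall>k\<in>{j..<j + Suc m}. \<not> g k \<le> D k \<omega>}"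
    proof -
      have "D (j + m) \<omega> = addfun (mg u) (l (j + m)) (orbit f \<omega> (b ^ (j + m)) x) (\<lambda>i. \<omega> (b ^ (j + m) + i))" for \<omega>
        unfolding D_def bl addfun_add by simp
      moreover have "{j..<j + Suc m} = insert (j + m) {j..<j + m}" by auto
      ultimately show ?thesis by auto
    qed
    ultimately have "measure \<Omega> {\<omega> \<in> space \<Omega>. \<forall>k\<in>{j..<j + Suc m}. \<not> g k \<le> D k \<omega>}
        \<le> (1 - pk (j + m)) * measure \<Omega> {\<omega> \<in> space \<Omega>. ?Q \<omega>}" by simp
    also have "\<dots> \<le> exp (- pk (j + m)) * exp (- (\<Sum>k=j..<j + m. pk k))"
      using Suc exp_ge_add_one_self[of "- pk (j + m)"] by (intro mult_mono) auto
    also have "\<dots> = exp (- (\<Sum>k=j..<j + Suc m. pk k))" by (simp flip: exp_add)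
    finally show ?case .
  qed simp
  have null: "measure \<Omega> {\<omega> \<in> space \<Omega>. \<forall>k\<in>{j..}. \<not> g k \<le> D k \<omega>} = 0" if j: "k0 \<le> j" for j
  proof (rule ccontr)
    assume "measure \<Omega> {\<omega> \<in> space \<Omega>. \<forall>k\<in>{j..}. \<not> g k \<le> D k \<omega>} \<noteq> 0"
    then have pos: "0 < measure \<Omega> {\<omega> \<in> space \<Omega>. \<forall>k\<in>{j..}. \<not> g k \<le> D k \<omega>}" (is "0 < ?e")
      by (simp add: zero_less_measure_iff)
    have "(\<Sum>i<m. pk (i + j)) \<le> - ln ?e" for m
    proof -
      have "?e \<le> measure \<Omega> {\<omega> \<in> space \<Omega>. \<forall>k\<in>{j..<j + m}. \<not> g k \<le> D k \<omega>}"
        by (intro seq.P.finite_measure_mono meas) auto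
      also have "\<dots> \<le> exp (- (\<Sum>k=j..<j + m. pk k))" by (rule none[OF j])
      finally have "ln ?e \<le> - (\<Sum>k=j..<j + m. pk k)"
        by (subst (asm) ln_le_cancel_iff[OF pos exp_gt_zero, symmetric]) (simp only: ln_exp)
      moreover have "(\<Sum>k=j..<j + m. pk k) = (\<Sum>i<m. pk (i + j))"
        using sum.shift_bounds_nat_ivl[of pk 0 j m] by (simp add: atLeast0LessThan add.commute)
      ultimately show ?thesis by simp
    qed
    then have "summable (\<lambda>i. pk (i + j))" by (intro summableI_nonneg_bounded) (auto simp: pk0)
    then show False using div by (simp add: summable_iff_shift)
  qed
  have "AE \<omega> in \<Omega>. \<not> (\<forall>k\<in>{k0 + i..}. \<not> g k \<le> D k \<omega>)" for i
  proof (rule AE_I)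
    show "{\<omega> \<in> space \<Omega>. \<not> \<not> (\<forall>k\<in>{k0 + i..}. \<not> g k \<le> D k \<omega>)} \<subseteq> {\<omega> \<in> space \<Omega>. \<forall>k\<in>{k0 + i..}. \<not> g k \<le> D k \<omega>}"
      by auto
    show "emeasure \<Omega> {\<omega> \<in> space \<Omega>. \<forall>k\<in>{k0 + i..}. \<not> g k \<le> D k \<omega>} = 0"
      using null[of "k0 + i"] by (simp add: seq.P.emeasure_eq_measure)
  qed (rule meas)
  then have "AE \<omega> in \<Omega>. \<forall>i. \<not> (\<forall>k\<in>{k0 + i..}. \<not> g k \<le> D k \<omega>)" unfolding AE_all_countable by (rule allI)
  then have "AE \<omega> in \<Omega>. \<exists>\<^sub>F k in sequentially. g k \<le> D k \<omega>"
  proof eventually_elim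
    case (elim \<omega>)
    show ?case
      unfolding frequently_sequentially
    proof
      fix i
      have "\<exists>k\<in>{k0 + i..}. g k \<le> D k \<omega>" using elim[rule_format, of i] by simp
      then obtain k where "k0 + i \<le> k" "g k \<le> D k \<omega>" by auto
      then show "\<exists>k\<ge>i. g k \<le> D k \<omega>" by (intro exI[of _ k]) simp
    qed
  qed
  then show ?thesis by (simp only: g_def D_def l_def T_def)
qed

lemma qv_uminus: "qv (\<lambda>x. - u x) = qv u"
  by (simp add: qv_def mg_uminus fun_eq_iff)

text \<open>For large \<open>b\<close> the increment over a block is almost the whole value at its
  end. The value at the start of the block is controlled by the upper bound for \<open>- u\<close>,
  whose contribution shrinks like \<open>sqrt (1 / b)\<close>.\<close>

lemma lil_lower:
  assumes u: "regular u" and s: "0 < s" "integral\<^sup>L \<nu> (qv u) = s\<^sup>2" and c: "c < s"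
  shows "AE \<omega> in \<Omega>. \<exists>\<^sub>F n in sequentially. c * sqrt (2 * real n * ln (ln (real n))) \<le> addfun (mg u) n x \<omega>"
proof -
  \<comment> \<open>Negative \<open>c\<close> are reduced to 0, since the block estimate requires a
    nonnegative constant.\<close>
  define c0 where "c0 = max c 0"
  define c1 where "c1 = (c0 + s) / 2"
  have c1: "0 \<le> c1" "c1 < s" "c0 < c1" "0 \<le> c0" "c \<le> c0" using c s by (auto simp: c0_def c1_def)
  have "(\<lambda>b::nat. c1 * sqrt (1 - 1 / real b) - (s + 1) * sqrt (1 / real b)) \<longlonglongrightarrow> c1"
    by real_asymp
  then have "eventually (\<lambda>b::nat. c0 < c1 * sqrt (1 - 1 / real b) - (s + 1) * sqrt (1 / real b)) sequentially"
    using c1(3) by (rule order_tendstoD)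
  then have "eventually (\<lambda>b::nat. c0 < c1 * sqrt (1 - 1 / real b) - (s + 1) * sqrt (1 / real b) \<and> 2 \<le> b) sequentially"
    by (intro eventually_conj eventually_ge_at_top)
  then obtain b :: nat where b0: "c0 < c1 * sqrt (1 - 1 / real b) - (s + 1) * sqrt (1 / real b)" and b: "2 \<le> b"
    by (auto dest: eventually_happens)
  have pow_lim: "filterlim (\<lambda>k. b ^ k) at_top sequentially"
    using b by (intro filterlim_subseq strict_monoI power_strict_increasing) auto
  have pow_Suc_lim: "filterlim (\<lambda>k. b ^ Suc k) at_top sequentially"
    using b by (intro filterlim_subseq strict_monoI power_strict_increasing) auto
  have "sqrt (integral\<^sup>L \<nu> (qv (\<lambda>x. - u x))) < s + 1" using s by (simp add: qv_uminus)
  from lil_upper[OF regular_uminus[OF u] this, of x] lil_lower_frequently[OF u s c1(1,2) b, of x]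
  show ?thesis
  proof eventually_elim
    case (elim \<omega>)
    let ?M = "\<lambda>n. addfun (mg u) n x \<omega>"
    have "eventually (\<lambda>n. - ?M n \<le> (s + 1) * sqrt (2 * real n * ln (ln (real n)))) sequentially"
      using elim(1) by (simp only: addfun_mg_uminus)
    then have "eventually (\<lambda>k. - ?M (b ^ k) \<le> (s + 1) * sqrt (2 * real (b ^ k) * ln (ln (real (b ^ k))))) sequentially"
      using pow_lim by (rule eventually_compose_filterlim)
    moreover have "eventually (\<lambda>k::nat. 2 \<le> k) sequentially" by (rule eventually_ge_at_top)
    ultimately have ev: "eventually (\<lambda>k. (c1 * sqrt (real (b ^ Suc k - b ^ k) * (2 * ln (ln (real (b ^ Suc k)))))
        \<le> ?M (b ^ Suc k) - ?M (b ^ k)) \<longrightarrow>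
        c * sqrt (2 * real (b ^ Suc k) * ln (ln (real (b ^ Suc k)))) \<le> ?M (b ^ Suc k)) sequentially"
    proof eventually_elim
      case (elim k)
      show ?case
      proof
        assume G: "c1 * sqrt (real (b ^ Suc k - b ^ k) * (2 * ln (ln (real (b ^ Suc k))))) \<le> ?M (b ^ Suc k) - ?M (b ^ k)"
        define n where "n = real (b ^ Suc k)"
        define t where "t = ln (ln n)"
        define X where "X = sqrt (2 * n * t)"
        \<comment> \<open>Beyond \<open>exp 1\<close> the iterated logarithm is nonnegative, so the
          square roots can be compared monotonically.\<close>
        have n4: "4 \<le> real (b ^ k)"
        proof -
          have "(2::nat) ^ 2 \<le> 2 ^ k" using elim(2) by (intro power_increasing) auto
          also have "\<dots> \<le> b ^ k" using b by (intro power_mono) auto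
          finally have "real 4 \<le> real (b ^ k)" by (simp only: of_nat_le_iff) simp
          then show ?thesis by (simp only: of_nat_numeral)
        qed
        have nb: "real (b ^ k) = n / real b" using b by (simp add: n_def)
        have le_n: "real (b ^ k) \<le> n" unfolding n_def using b by simp
        have ln_1: "1 \<le> ln (real (b ^ k))"
        proof -
          have "exp 1 \<le> real (b ^ k)" using exp_le n4 by linarith
          then show ?thesis using n4 by (subst ln_ge_iff) linarith+
        qed
        have lnn: "ln (real (b ^ k)) \<le> ln n" using le_n n4 by (intro ln_mono) linarith+
        have t: "0 \<le> t" "0 \<le> ln (ln (real (b ^ k)))" "ln (ln (real (b ^ k))) \<le> t"
          unfolding t_def using ln_1 lnn by simp_all
        have e1: "sqrt (real (b ^ Suc k - b ^ k) * (2 * t)) = sqrt (1 - 1 / real b) * X"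
        proof -
          have eq: "real (b ^ Suc k - b ^ k) = n - n / real b"
            unfolding nb[symmetric] n_def using b by (simp add: of_nat_diff)
          have "real (b ^ Suc k - b ^ k) * (2 * t) = (1 - 1 / real b) * (2 * n * t)"
            unfolding eq by (simp add: algebra_simps)
          then show ?thesis by (simp only: X_def real_sqrt_mult)
        qed
        have e2: "sqrt (2 * real (b ^ k) * ln (ln (real (b ^ k)))) \<le> sqrt (1 / real b) * X"
        proof -
          have "2 * real (b ^ k) * ln (ln (real (b ^ k))) \<le> 2 * real (b ^ k) * t"
            using t by (intro mult_left_mono) auto
          also have "\<dots> = (1 / real b) * (2 * n * t)" unfolding nb by simp
          finally have "sqrt (2 * real (b ^ k) * ln (ln (real (b ^ k)))) \<le> sqrt ((1 / real b) * (2 * n * t))"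
            by (rule real_sqrt_le_mono)
          then show ?thesis by (simp only: X_def real_sqrt_mult)
        qed
        have X0: "0 \<le> X" unfolding X_def using t le_n n4 by simp
        have "c * X \<le> (c1 * sqrt (1 - 1 / real b) - (s + 1) * sqrt (1 / real b)) * X"
          using b0 c1(5) X0 by (intro mult_right_mono) auto
        also have "\<dots> = c1 * (sqrt (1 - 1 / real b) * X) - (s + 1) * (sqrt (1 / real b) * X)"
          by (simp only: left_diff_distrib mult.assoc)
        also have "\<dots> \<le> c1 * (sqrt (1 - 1 / real b) * X) + ?M (b ^ k)"
          using elim(1) mult_left_mono[OF e2, of "s + 1"] s(1) by linarith
        also have "\<dots> \<le> ?M (b ^ Suc k)"
          using G unfolding n_def[symmetric] t_def[symmetric] e1 by linarith
        finally show "c * sqrt (2 * real (b ^ Suc k) * ln (ln (real (b ^ Suc k)))) \<le> ?M (b ^ Suc k)"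
          by (simp only: X_def n_def t_def)
      qed
    qed
    have fr: "\<exists>\<^sub>F k in sequentially. c * sqrt (2 * real (b ^ Suc k) * ln (ln (real (b ^ Suc k)))) \<le> ?M (b ^ Suc k)"
      by (rule frequently_rev_mp[OF elim(2) ev])
    show ?case
    proof (rule ccontr)
      assume "\<not> ?thesis"
      then have "eventually (\<lambda>n. \<not> c * sqrt (2 * real n * ln (ln (real n))) \<le> ?M n) sequentially"
        by (simp only: not_frequently)
      then have "eventually (\<lambda>k. \<not> c * sqrt (2 * real (b ^ Suc k) * ln (ln (real (b ^ Suc k)))) \<le> ?M (b ^ Suc k)) sequentially"
        using pow_Suc_lim by (rule eventually_compose_filterlim)
      with fr show False unfolding frequently_def by (rule notE)
    qed
  qed
qed

text \<open>Upper and lower bounds for the martingale hold almost surely along the countably many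
  tolerances \<open>1 / (m + 1)\<close>. The normalisation tends to infinity, so the bounded
  boundary terms do not affect the limit superior.\<close>

theorem law_of_iterated_logarithm:
  assumes u: "regular u" "\<And>x. u x - P u x = \<phi> x - integral\<^sup>L \<nu> \<phi>"
  shows "AE \<omega> in \<Omega>. limsup (\<lambda>n. ereal (1 / sqrt (2 * real n * ln (ln (real n))) * centered_sum f \<nu> \<phi> n x \<omega>))
    = ereal (sqrt (integral\<^sup>L \<nu> (qv u)))"
proof -
  define s where "s = sqrt (integral\<^sup>L \<nu> (qv u))"
  have s: "0 \<le> s" "integral\<^sup>L \<nu> (qv u) = s\<^sup>2" using integral_qv_nonneg by (auto simp: s_def)
  define \<Phi> where "\<Phi> n = sqrt (2 * real n * ln (ln (real n)))" for n
  have \<Phi>: "filterlim \<Phi> at_top sequentially" unfolding \<Phi>_def by real_asymp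
  obtain b where b: "0 \<le> b" "\<And>x. \<bar>u x\<bar> \<le> b"
    using continuous_bounded[OF regular_continuous[OF u(1)]] by auto
  have up: "AE \<omega> in \<Omega>. \<forall>m::nat. eventually (\<lambda>n. addfun (mg u) n x \<omega> \<le> (s + 1 / (real m + 1)) * \<Phi> n) sequentially"
    unfolding AE_all_countable \<Phi>_def by (intro allI lil_upper u) (simp add: s_def[symmetric])
  have lo: "AE \<omega> in \<Omega>. \<forall>m::nat. \<exists>\<^sub>F n in sequentially. (s - 1 / (real m + 1)) * \<Phi> n \<le> addfun (mg u) n x \<omega>"
    unfolding AE_all_countable
  proof
    fix m :: nat
    show "AE \<omega> in \<Omega>. \<exists>\<^sub>F n in sequentially. (s - 1 / (real m + 1)) * \<Phi> n \<le> addfun (mg u) n x \<omega>"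
    proof (cases "s = 0")
      case False
      then show ?thesis unfolding \<Phi>_def by (intro lil_lower[OF u(1) _ s(2)]) (use s(1) in auto)
    next
      case True
      have "sqrt (integral\<^sup>L \<nu> (qv (\<lambda>x. - u x))) < 1 / (real m + 1)" using s True by (simp add: qv_uminus)
      from lil_upper[OF regular_uminus[OF u(1)] this, of x] show ?thesis
      proof eventually_elim
        case (elim \<omega>)
        then have "eventually (\<lambda>n. (s - 1 / (real m + 1)) * \<Phi> n \<le> addfun (mg u) n x \<omega>) sequentially"
          by (rule eventually_mono) (simp add: True addfun_mg_uminus \<Phi>_def)
        then show ?case by (rule eventually_frequently[OF sequentially_bot])
      qed
    qed
  qed
  show ?thesis
    using up lo
  proof eventually_elim
    case (elim \<omega>)
    define X where "X n = 1 / \<Phi> n * centered_sum f \<nu> \<phi> n x \<omega>" for n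
    have close: "\<bar>centered_sum f \<nu> \<phi> n x \<omega> - addfun (mg u) n x \<omega>\<bar> \<le> 2 * b" for n
      using b(2)[of x] b(2)[of "orbit f \<omega> n x"] unfolding centered_sum_eq[OF u(2)] by simp
    have large: "eventually (\<lambda>n. 0 < \<Phi> n \<and> 2 * b < d * \<Phi> n) sequentially" if d: "0 < d" for d
    proof -
      have "\<forall>Z. eventually (\<lambda>n. Z < \<Phi> n) sequentially"
        using \<Phi> unfolding filterlim_at_top_dense .
      then have "eventually (\<lambda>n. max 0 (2 * b / d) < \<Phi> n) sequentially" by (rule spec)
      then show ?thesis
        by (rule eventually_mono) (use d in \<open>simp add: pos_divide_less_eq mult.commute\<close>)
    qed
    have "limsup (\<lambda>n. ereal (X n)) \<le> ereal s"
      unfolding Limsup_le_iff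
    proof (intro allI impI)
      fix y assume y: "ereal s < y"
      obtain r where r: "s < r" "ereal r \<le> y"
        using ereal_dense2[OF y] by (auto intro: less_imp_le)
      define d where "d = (r - s) / 2"
      have d: "0 < d" using r by (simp add: d_def)
      obtain m :: nat where m: "1 / (real m + 1) < d"
        using reals_Archimedean[OF d] by (auto simp: inverse_eq_divide add.commute)
      from elim(1)[rule_format, of m] large[OF d]
      show "\<forall>\<^sub>F n in sequentially. ereal (X n) < y"
      proof eventually_elim
        case (elim n)
        have "1 / (real m + 1) * \<Phi> n \<le> d * \<Phi> n" using m elim by (intro mult_right_mono) auto
        moreover have "(s + 1 / (real m + 1)) * \<Phi> n = s * \<Phi> n + 1 / (real m + 1) * \<Phi> n"
          by (rule distrib_right)
        ultimately have "centered_sum f \<nu> \<phi> n x \<omega> < s * \<Phi> n + d * \<Phi> n + d * \<Phi> n"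
          using close[of n] elim(1) elim(2)[THEN conjunct2] by linarith
        also have "\<dots> = r * \<Phi> n" by (simp add: d_def field_simps)
        finally have "X n < r" using elim by (simp add: X_def pos_divide_less_eq)
        then have "ereal (X n) < ereal r" by simp
        then show ?case using r(2) by (rule less_le_trans)
      qed
    qed
    moreover have "ereal s \<le> limsup (\<lambda>n. ereal (X n))"
    proof (rule ccontr)
      assume "\<not> ?thesis"
      then have "limsup (\<lambda>n. ereal (X n)) < ereal s" by (rule not_le_imp_less)
      from dense[OF this] obtain y where y: "y < ereal s" and ly: "limsup (\<lambda>n. ereal (X n)) < y" by auto
      obtain r where r: "r < s" "y \<le> ereal r"
        using ereal_dense2[OF y] by (auto intro: less_imp_le)
      define d where "d = (s - r) / 3"
      have d: "0 < d" using r by (simp add: d_def)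
      obtain m :: nat where m: "1 / (real m + 1) < d"
        using reals_Archimedean[OF d] by (auto simp: inverse_eq_divide add.commute)
      have ev: "eventually (\<lambda>n. (s - 1 / (real m + 1)) * \<Phi> n \<le> addfun (mg u) n x \<omega> \<longrightarrow> y < ereal (X n)) sequentially"
        using large[OF d]
      proof eventually_elim
        case (elim n)
        show ?case
        proof
          assume G: "(s - 1 / (real m + 1)) * \<Phi> n \<le> addfun (mg u) n x \<omega>"
          have "1 / (real m + 1) * \<Phi> n \<le> d * \<Phi> n" using m elim by (intro mult_right_mono) auto
          moreover have "0 < d * \<Phi> n" using d elim by simp
          moreover have "(s - 1 / (real m + 1)) * \<Phi> n = s * \<Phi> n - 1 / (real m + 1) * \<Phi> n"
            by (rule left_diff_distrib)
          ultimately have "s * \<Phi> n - d * \<Phi> n - d * \<Phi> n - d * \<Phi> n < centered_sum f \<nu> \<phi> n x \<omega>"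
            using close[of n] elim[THEN conjunct2] G by linarith
          moreover have "s * \<Phi> n - d * \<Phi> n - d * \<Phi> n - d * \<Phi> n = r * \<Phi> n" by (simp add: d_def field_simps)
          ultimately have "r < X n" using elim by (simp add: X_def pos_less_divide_eq)
          then have "ereal r < ereal (X n)" by simp
          with r(2) show "y < ereal (X n)" by (rule le_less_trans)
        qed
      qed
      have fr: "\<exists>\<^sub>F n in sequentially. y < ereal (X n)"
        by (rule frequently_rev_mp[OF elim(2)[rule_format, of m] ev])
      have "eventually (\<lambda>n. \<not> y < ereal (X n)) sequentially"
        using Limsup_lessD[OF ly] by (rule eventually_mono) (rule less_not_sym)
      with fr show False unfolding frequently_def by (rule notE)
    qed
    ultimately show ?case unfolding X_def \<Phi>_def s_def[symmetric] by (rule antisym)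
  qed
qed

end

lemma hoelder_continuous_on:
  assumes "0 < \<alpha>" "0 \<le> C" and h: "\<And>x y. \<bar>h x - h y\<bar> \<le> C * dist (x :: circle) y powr \<alpha>"
  shows "continuous_on UNIV (h :: circle \<Rightarrow> real)"
  unfolding continuous_on_iff
proof (intro ballI allI impI)
  fix x :: circle and e :: real assume e: "0 < e"
  let ?d = "(e / (C + 1)) powr (1 / \<alpha>)"
  have "dist (h y) (h x) < e" if y: "dist y x < ?d" for y
  proof -
    have "dist y x powr \<alpha> \<le> ?d powr \<alpha>" using y assms(1) by (intro powr_mono2) auto
    also have "\<dots> = e / (C + 1)" using e assms by (simp add: powr_powr)
    finally have "C * dist y x powr \<alpha> \<le> C * (e / (C + 1))" using assms(2) by (rule mult_left_mono)
    also have "\<dots> < e" using e assms(2) by (simp add: field_simps)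
    finally show ?thesis using h[of y x] by (simp add: dist_real_def)
  qed
  moreover have "0 < ?d" using e assms(2) by simp
  ultimately show "\<exists>d>0. \<forall>x'\<in>UNIV. dist x' x < d \<longrightarrow> dist (h x') (h x) < e" by blast
qed

theorem corollary1p8:
  fixes N :: nat
    and f :: "nat \<Rightarrow> circle \<Rightarrow> circle"
    and \<mu> :: "nat measure"
    and \<nu> :: "circle measure"
    and h :: "circle \<Rightarrow> real"
  assumes homeo: "\<forall>i<N. \<exists>g. homeomorphism UNIV UNIV (f i) g"
    and prox: "proximal N f"
    and no_inv: "\<not> (\<exists>m. common_invariant N f m)"
    and mu: "nondegenerate_prob N \<mu>"
    and nu: "stationary N f \<mu> \<nu>"
    and h: "hoelder_continuous h"
  shows "\<exists>\<sigma>2 :: real.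
      (\<lambda>n. 1 / real n *
         (\<integral>p. (centered_sum f \<nu> h n (snd p) (fst p))\<^sup>2 \<partial>(bernoulli \<mu> \<Otimes>\<^sub>M \<nu>)))
        \<longlonglongrightarrow> \<sigma>2
    \<and> (\<forall>x. AE \<omega> in bernoulli \<mu>.
         (\<lambda>n. 1 / real n * (\<Sum>k<n. h (orbit f \<omega> k x))) \<longlonglongrightarrow> integral\<^sup>L \<nu> h)
    \<and> (\<forall>x. weak_conv_m
         (\<lambda>n. distr (bernoulli \<mu>) borel (\<lambda>\<omega>. 1 / sqrt (real n) * centered_sum f \<nu> h n x \<omega>))
         (normal_law \<sigma>2))
    \<and> (\<forall>x. AE \<omega> in bernoulli \<mu>.
         limsup (\<lambda>n. ereal (1 / sqrt (2 * real n * ln (ln (real n))) * centered_sum f \<nu> h n x \<omega>))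
           = ereal (sqrt \<sigma>2))"
proof -
  define p where "p i = measure \<mu> {i}" for i
  interpret circle_system N p f
  proof
    fix i assume i: "i < N"
    obtain g where g: "homeomorphism UNIV UNIV (f i) g" using homeo i by auto
    show "continuous_on UNIV (f i)" using g by (simp add: homeomorphism_def)
    show "inj (f i)" using g unfolding homeomorphism_def by (metis UNIV_I injI)
    show "0 < p i" using mu i by (simp add: nondegenerate_prob_def p_def)
  next
    interpret prob_space \<mu> using mu by (simp add: nondegenerate_prob_def)
    have sets: "sets \<mu> = Pow {..<N}" using mu by (simp add: nondegenerate_prob_def)
    have "space \<mu> = {..<N}"
      using sets.top[of \<mu>] sets.sets_into_space[of "{..<N}" \<mu>] by (auto simp: sets)
    then have "1 = measure \<mu> {..<N}" using prob_space by simp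
    also have "\<dots> = (\<Sum>i<N. measure \<mu> {i})"
      by (rule finite_measure_eq_sum_singleton) (auto simp: sets)
    finally show "(\<Sum>i<N. p i) = 1" by (simp add: p_def)
  qed
  obtain \<alpha> C where \<alpha>: "0 < \<alpha>" and C: "0 \<le> C" and hC: "\<And>x y. \<bar>h x - h y\<bar> \<le> C * dist x y powr \<alpha>"
    using h unfolding hoelder_continuous_def by auto
  \<comment> \<open>The exponent of \<open>h\<close> is built into \<open>E\<close>, so that
    \<open>h\<close> becomes Lipschitz with respect to \<open>E\<close> with its Hoelder
    constant.\<close>
  from contraction_on_average[OF no_inv prox \<alpha>] obtain E :: "circle \<times> circle \<Rightarrow> real" and C' \<kappa> :: real
    where C': "0 \<le> C'" and \<kappa>: "0 < \<kappa>" "\<kappa> < 1" and "\<forall>z. 0 \<le> E z \<and> E z \<le> 1"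
      and dE: "\<forall>x y. dist x y powr \<alpha> \<le> E (x, y)" and "\<forall>n z. (L ^^ n) E z \<le> C' * \<kappa> ^ n * E z"
    by (elim exE conjE) (rule that; assumption)
  then interpret contracting_walk N p f \<mu> \<nu> E C' \<kappa>
    by unfold_locales (simp_all add: mu nu p_def del: split_paired_All)
  have reg: "regular h"
    unfolding regular_def
  proof (intro conjI exI[of _ C] allI)
    show "continuous_on UNIV h" by (rule hoelder_continuous_on[OF \<alpha> C hC])
    show "0 \<le> C" by (rule C)
    show "\<bar>h x - h y\<bar> \<le> C * E (x, y)" for x y
      using hC[of x y] mult_left_mono[OF dE[rule_format, of x y] C] by (rule order_trans)
  qed
  obtain u where u: "regular u" "\<And>x. u x - P u x = h x - integral\<^sup>L \<nu> h"
    using poisson_equation[OF reg] by auto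
  obtain b where b: "\<And>x. \<bar>u x\<bar> \<le> b"
    using continuous_bounded[OF regular_continuous[OF u(1)]] by auto
  show ?thesis
  \<comment> \<open>One solution \<open>u\<close> serves all assertions, so the variance limit, the
    normal law and the iterated logarithm share the constant
    \<open>integral\<^sup>L \<nu> (qv u)\<close>.\<close>
  proof (intro exI[of _ "integral\<^sup>L \<nu> (qv u)"] conjI allI)
    show "(\<lambda>n. 1 / real n * (\<integral>p. (centered_sum f \<nu> h n (snd p) (fst p))\<^sup>2 \<partial>(bernoulli \<mu> \<Otimes>\<^sub>M \<nu>)))
        \<longlonglongrightarrow> integral\<^sup>L \<nu> (qv u)"
      by (rule variance_limit[OF u reg])
    fix x
    show "AE \<omega> in bernoulli \<mu>. (\<lambda>n. 1 / real n * (\<Sum>k<n. h (orbit f \<omega> k x))) \<longlonglongrightarrow> integral\<^sup>L \<nu> h"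
      using strong_law[OF reg, of x] by simp
    show "weak_conv_m (\<lambda>n. distr (bernoulli \<mu>) borel (\<lambda>\<omega>. 1 / sqrt (real n) * centered_sum f \<nu> h n x \<omega>))
        (normal_law (integral\<^sup>L \<nu> (qv u)))"
    proof (rule central_limit_mg[OF u(1) centered_sum_measurable[OF reg]])
      show "\<bar>centered_sum f \<nu> h n x \<omega> - addfun (mg u) n x \<omega>\<bar> \<le> 2 * b" for n \<omega>
        using b[of x] b[of "orbit f \<omega> n x"] unfolding centered_sum_eq[OF u(2)] by simp
    qed
    show "AE \<omega> in bernoulli \<mu>.
        limsup (\<lambda>n. ereal (1 / sqrt (2 * real n * ln (ln (real n))) * centered_sum f \<nu> h n x \<omega>))
          = ereal (sqrt (integral\<^sup>L \<nu> (qv u)))"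
      by (rule law_of_iterated_logarithm[OF u])
  qed
qed

end
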